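(* Let $1\le p,q<\infty$ and let $G\subseteq\mathbb{D}$ be a measurable set. The following are equivalent: (a) There exist $\beta\in(0,1)$ and a constant $K>0$ such that for every $f\in AT^q_p$, $$\left(\int_{\mathbb{T}}\left(\int_{\Gamma_\beta(\xi)\cap G}|f(z)|^p\,\frac{dm(z)}{1-|z|}\right)^{q/p}|d\xi|\right)^{1/q}\ \ge\ K\,\|f\|_{T^q_p}.$$ (b) There exist $\eta\in(0,1)$ and $\delta>0$ such that $m(G\cap\Delta(\alpha,\eta))\ge\delta\, m(\Delta(\alpha,\eta))$ for all $\alpha\in\mathbb{D}$. (c) There exist $\eta\in(0,1)$ and $\delta>0$ such that $m(G\cap\Delta_\eta(\alpha))\ge\delta\, m(\Delta_\eta(\alpha))$ for all $\alpha\in\mathbb{D}$.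
   Context: $\mathbb{D}$ is the open unit disc, $\mathbb{T}$ the unit circle with arc-length measure $|d\xi|$, and $dm$ the normalized area Lebesgue measure on $\mathbb{D}$. For $\beta\in(0,1)$ and $\xi\in\mathbb{T}$, $\Gamma_\beta(\xi)=\{z\in\mathbb{D}:|z|<\beta\}\cup\bigcup_{|z|<\beta}[z,\xi)$, where $[z,\xi)$ is the half-open segment from $z$ to $\xi$. For $0<p,q<\infty$ and measurable $f$ on $\mathbb{D}$, $\|f\|_{T^q_p}=\left(\int_{\mathbb{T}}\left(\int_{\Gamma_{1/2}(\xi)}|f(z)|^p\frac{dm(z)}{1-|z|}\right)^{q/p}|d\xi|\right)^{1/q}$; the tent space $T^q_p$ consists of measurable $f$ with $\|f\|_{T^q_p}<\infty$, and $AT^q_p=T^q_p\cap\mathcal{H}(\mathbb{D})$, where $\mathcal{H}(\mathbb{D})$ denotes the analytic functions on $\mathbb{D}$. For $\alpha\in\mathbb{D}$, $\eta\in(0,1)$: the pseudohyperbolic disc is $\Delta(\alpha,\eta)=\{z\in\mathbb{D}:|\frac{\alpha-z}{1-\bar\alpha z}|<\eta\}$ and the Euclidean disc is $\Delta_\eta(\alpha)=\{z\in\mathbb{D}:|z-\alpha|<\eta(1-|\alpha|)\}$. *)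

theory Defs
  imports "HOL-Analysis.Analysis"
begin

definition disc_measure :: "complex measure" where
  "disc_measure = scale_measure (ennreal (1 / pi)) (restrict_space lebesgue (ball 0 1))"

definition circle_measure :: "complex measure" where
  "circle_measure = distr (restrict_space lborel {0..<2*pi}) borel cis"

definition enn_powr :: "ennreal \<Rightarrow> real \<Rightarrow> ennreal" where
  "enn_powr x r = (if x = \<infinity> then \<infinity> else ennreal (enn2real x powr r))"

definition Gamma_region :: "real \<Rightarrow> complex \<Rightarrow> complex set" where
  "Gamma_region \<beta> \<xi> = {z. cmod z < \<beta>} \<union> (\<Union>w\<in>{w. cmod w < \<beta>}. closed_segment w \<xi> - {\<xi>})"

definition tent_inner :: "real \<Rightarrow> complex set \<Rightarrow> (complex \<Rightarrow> complex) \<Rightarrow> ennreal" where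
  "tent_inner p S f = (\<integral>\<^sup>+ z \<in> S. ennreal (cmod (f z) powr p / (1 - cmod z)) \<partial>disc_measure)"

definition tent_functional :: "real \<Rightarrow> real \<Rightarrow> real \<Rightarrow> complex set \<Rightarrow> (complex \<Rightarrow> complex) \<Rightarrow> ennreal" where
  "tent_functional p q \<beta> G f =
     enn_powr (\<integral>\<^sup>+ \<xi>. enn_powr (tent_inner p (Gamma_region \<beta> \<xi> \<inter> G) f) (q / p) \<partial>circle_measure) (1 / q)"

definition tent_norm :: "real \<Rightarrow> real \<Rightarrow> (complex \<Rightarrow> complex) \<Rightarrow> ennreal" where
  "tent_norm p q f =
     enn_powr (\<integral>\<^sup>+ \<xi>. enn_powr (tent_inner p (Gamma_region (1/2) \<xi>) f) (q / p) \<partial>circle_measure) (1 / q)"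

definition AT :: "real \<Rightarrow> real \<Rightarrow> (complex \<Rightarrow> complex) set" where
  "AT p q = {f. f holomorphic_on ball 0 1 \<and> tent_norm p q f < \<infinity>}"

definition pseudo_disc :: "complex \<Rightarrow> real \<Rightarrow> complex set" where
  "pseudo_disc \<alpha> \<eta> = {z \<in> ball 0 1. cmod ((\<alpha> - z) / (1 - cnj \<alpha> * z)) < \<eta>}"

definition eucl_disc :: "real \<Rightarrow> complex \<Rightarrow> complex set" where
  "eucl_disc \<eta> \<alpha> = {z \<in> ball 0 1. cmod (z - \<alpha>) < \<eta> * (1 - cmod \<alpha>)}"

end

theory Submission
  imports Defs "HOL-Complex_Analysis.Complex_Analysis"
begin

text \<open>
  Density implies sampling. If \<open>E\<close> fills a fixed proportion of a disc around \<open>\<alpha>\<close>, a normal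
  family argument gives \<open>|f(\<alpha>)|^p \<le> C avg_E |f|^p + \<epsilon> avg |f|^p\<close> with \<open>\<epsilon>\<close> as small as we please,
  because zero sets of holomorphic functions are null. Integrating over a cone yields
  \<open>A_3 \<le> C A_c'(G) + \<epsilon> A_c'\<close> for the area functions, and the last term is absorbed once the \<open>L^s\<close>
  norms (\<open>s = q/p\<close>) of area functions of different apertures are known to be comparable.
  For this, write \<open>A^s\<close> as a telescoping sum over dyadic annuli. On the shadow of a
  point the truncated area functions are comparable after opening the cone five times, so
  Fubini and Young give \<open>N(c) \<le> C c (\<tau>^(-m) N(11/10) + \<tau> N(5c))\<close>, which is iterated
  along the apertures \<open>5^j c\<close>.

  Sampling implies density. The functions \<open>(1 - cnj a z)^(-M/p)\<close> concentrate so strongly near \<open>a\<close>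
  that the part of the area function outside a large pseudohyperbolic disc around \<open>a\<close> is a small
  proportion of the norm, and the part inside is controlled by the measure of \<open>G\<close> there.
\<close>

section \<open>Stolz regions, arcs of the circle and powers in the extended reals\<close>

text \<open>The exponent \<open>s = q/p\<close> may be smaller than 1, so duality and the triangle
  inequality in \<open>L^s\<close> are not at hand and the aperture comparison has to be done
  directly for every \<open>s > 0\<close>. Below 1 the power \<open>s - 1\<close> of a truncated
  area function is negative; this is why a weight is required to charge a fixed small ball about 0,
  which keeps every base positive. Iteration and absorption need finite quantities. The iteration
  runs on finite measures carried by a smaller disc, with a constant independent of the measure, and
  passes to weights by monotone convergence. The sampling inequality absorbs its error into the tent
  norm, whose finiteness is the hypothesis \<open>f \<in> AT p q\<close>. Cones are given by the
  distance inequality \<open>stolz\<close> and not by segments: the points \<xi> whose cone contains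
  a given z then form a ball about z, so that shadows are measured at once and cones are compared by
  the triangle inequality. At unimodular \<xi> apertures up to 1 give empty cones; 11/10 exceeds 1
  and is still small enough to fit into the region of aperture 1/2.\<close>

definition stolz :: "real \<Rightarrow> complex \<Rightarrow> complex set" where
  "stolz c \<xi> = {z. cmod (z - \<xi>) < c * (1 - cmod z)}"

lemma open_stolz: "open (stolz c \<xi>)"
  unfolding stolz_def by (intro open_Collect_less continuous_intros)

lemma stolz_borel [measurable]: "stolz c \<xi> \<in> sets borel"
  by (simp add: open_stolz)

lemma stolz_subset_disc: "0 < c \<Longrightarrow> stolz c \<xi> \<subseteq> ball 0 1"
proof
  fix z assume c: "0 < c" "z \<in> stolz c \<xi>"
  then have "0 < c * (1 - cmod z)"
    using norm_ge_zero[of "z - \<xi>"] unfolding stolz_def mem_Collect_eq by linarith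
  then show "z \<in> ball 0 1" using c by (simp add: zero_less_mult_iff)
qed

lemma stolz_mono: "0 < c \<Longrightarrow> c \<le> c' \<Longrightarrow> stolz c \<xi> \<subseteq> stolz c' \<xi>"
proof
  fix z assume a: "0 < c" "c \<le> c'" "z \<in> stolz c \<xi>"
  then have "z \<in> ball 0 1" using stolz_subset_disc by blast
  then have "c * (1 - cmod z) \<le> c' * (1 - cmod z)"
    using a by (intro mult_right_mono) auto
  then show "z \<in> stolz c' \<xi>" using a unfolding stolz_def by auto
qed

text \<open>A point of a segment is (1 - t) \<xi> + t w with |w| < \<beta>, so each t contributes a
  scaled ball. This exhibits the region as an open set minus its vertex, together with a disc;
  measurability and both comparisons with \<open>stolz\<close> rest on this form. The disc is added
  back because \<xi> is arbitrary here and may itself lie in it.\<close>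

lemma Gamma_region_eq:
  assumes "0 < \<beta>"
  shows "Gamma_region \<beta> \<xi> = (\<Union>t\<in>{0<..1}. ball (of_real (1 - t) * \<xi>) (t * \<beta>)) - {\<xi>} \<union> ball 0 \<beta>"
proof (intro set_eqI iffI)
  fix z assume z: "z \<in> Gamma_region \<beta> \<xi>"
  show "z \<in> (\<Union>t\<in>{0<..1}. ball (of_real (1 - t) * \<xi>) (t * \<beta>)) - {\<xi>} \<union> ball 0 \<beta>"
  proof (cases "cmod z < \<beta>")
    case False
    then obtain w where w: "cmod w < \<beta>" "z \<in> closed_segment w \<xi>" "z \<noteq> \<xi>"
      using z unfolding Gamma_region_def by auto
    then obtain u where u: "0 \<le> u" "u \<le> 1" "z = (1 - u) *\<^sub>R w + u *\<^sub>R \<xi>"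
      unfolding closed_segment_def by auto
    have "u \<noteq> 1" using u w by auto
    have "dist (of_real (1 - (1 - u)) * \<xi>) z = (1 - u) * cmod w"
      using u by (simp add: dist_norm scaleR_conv_of_real norm_minus_commute norm_mult flip: of_real_diff)
    also have "\<dots> < (1 - u) * \<beta>" using u w \<open>u \<noteq> 1\<close> by simp
    finally have "z \<in> ball (of_real (1 - (1 - u)) * \<xi>) ((1 - u) * \<beta>)" by simp
    moreover have "1 - u \<in> {0<..1}" using u \<open>u \<noteq> 1\<close> by auto
    ultimately show ?thesis using w(3) by blast
  qed simp
next
  fix z assume z: "z \<in> (\<Union>t\<in>{0<..1}. ball (of_real (1 - t) * \<xi>) (t * \<beta>)) - {\<xi>} \<union> ball 0 \<beta>"
  show "z \<in> Gamma_region \<beta> \<xi>"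
  proof (cases "cmod z < \<beta>")
    case True then show ?thesis unfolding Gamma_region_def by auto
  next
    case False
    then obtain t where t: "0 < t" "t \<le> 1" "cmod (of_real (1 - t) * \<xi> - z) < t * \<beta>" "z \<noteq> \<xi>"
      using z by (auto simp: dist_norm)
    define w where "w = (z - of_real (1 - t) * \<xi>) / of_real t"
    have "cmod w = cmod (of_real (1 - t) * \<xi> - z) / t"
      unfolding w_def using t by (simp add: norm_divide norm_minus_commute)
    then have "cmod w < \<beta>" using t by (simp add: pos_divide_less_eq mult.commute)
    moreover have "z = (1 - (1 - t)) *\<^sub>R w + (1 - t) *\<^sub>R \<xi>"
      unfolding w_def using t by (simp add: scaleR_conv_of_real field_simps)
    then have "z \<in> closed_segment w \<xi>" unfolding closed_segment_def using t
      by (intro CollectI exI[of _ "1 - t"]) auto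
    ultimately show ?thesis unfolding Gamma_region_def using t by blast
  qed
qed

text \<open>In the ball of parameter t one has |z - \<xi>| < t (1 + \<beta>) and 1 - |z| >= t (1 -
  \<beta>); the aperture is the ratio of these bounds.\<close>

lemma Gamma_region_subset_stolz:
  assumes "0 < \<beta>" "\<beta> < 1" "cmod \<xi> = 1"
  shows "Gamma_region \<beta> \<xi> \<subseteq> stolz ((1 + \<beta>) / (1 - \<beta>)) \<xi>"
proof
  fix z assume "z \<in> Gamma_region \<beta> \<xi>"
  then obtain t where t: "0 < t" "t \<le> 1" "cmod (of_real (1 - t) * \<xi> - z) < t * \<beta>"
  proof (cases "z \<in> ball 0 \<beta>")
    case True
    then show ?thesis using that[of 1] by auto
  next
    case False
    then show ?thesis using that \<open>z \<in> _\<close> unfolding Gamma_region_eq[OF assms(1)] by (auto simp: dist_norm)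
  qed
  have n: "cmod (of_real (1 - t) * \<xi>) = 1 - t" "cmod (of_real t * \<xi>) = t"
    using t assms unfolding norm_mult norm_of_real by auto
  have eq: "z - \<xi> = - (of_real (1 - t) * \<xi> - z) - of_real t * \<xi>" by (simp add: algebra_simps)
  have "cmod (z - \<xi>) \<le> cmod (of_real (1 - t) * \<xi> - z) + cmod (of_real t * \<xi>)"
    unfolding eq by (rule norm_triangle_ineq4[THEN order_trans]) (simp add: norm_minus_commute)
  then have 1: "cmod (z - \<xi>) < t * (1 + \<beta>)" using t n by (simp add: algebra_simps)
  have eq: "z = of_real (1 - t) * \<xi> - (of_real (1 - t) * \<xi> - z)" by simp
  have "cmod z \<le> cmod (of_real (1 - t) * \<xi>) + cmod (of_real (1 - t) * \<xi> - z)"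
    by (subst eq, rule norm_triangle_ineq4)
  then have "t * (1 - \<beta>) \<le> 1 - cmod z" using n t by (simp add: algebra_simps)
  then have "(1 + \<beta>) / (1 - \<beta>) * (t * (1 - \<beta>)) \<le> (1 + \<beta>) / (1 - \<beta>) * (1 - cmod z)"
    using assms by (intro mult_left_mono) auto
  moreover have "(1 + \<beta>) / (1 - \<beta>) * (t * (1 - \<beta>)) = t * (1 + \<beta>)" using assms by simp
  ultimately show "z \<in> stolz ((1 + \<beta>) / (1 - \<beta>)) \<xi>"
    using 1 unfolding stolz_def by simp
qed

text \<open>The number b = sqrt (1 - \<beta>^2) is the length of a tangent from \<xi> to the circle
  of radius \<beta> about 0, and the hypothesis says that c b <= 1. Hence w b < 1 - |z| for w = |z -
  \<xi>|: points with w > b lie in the disc about 0, the others in the cone spanned by the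
  tangents.\<close>

lemma stolz_subset_Gamma_region:
  assumes "0 < \<beta>" "\<beta> < 1" "cmod \<xi> = 1" "0 < c" "c\<^sup>2 * (1 - \<beta>\<^sup>2) \<le> 1"
  shows "stolz c \<xi> \<subseteq> Gamma_region \<beta> \<xi>"
proof
  fix z assume z: "z \<in> stolz c \<xi>"
  then have z1: "cmod z < 1" using stolz_subset_disc[OF assms(4), of \<xi>] by auto
  then have z\<xi>: "z \<noteq> \<xi>" using assms by auto
  define w where "w = cmod (z - \<xi>)"
  define h where "h = 1 - cmod z"
  define b where "b = sqrt (1 - \<beta>\<^sup>2)"
  have \<beta>2: "\<beta>\<^sup>2 < 1" using assms by (simp add: abs_square_less_1)
  have b: "0 < b" "b\<^sup>2 = 1 - \<beta>\<^sup>2" unfolding b_def using \<beta>2 by auto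
  have w: "0 < w" "w < c * h" using z z\<xi> unfolding w_def h_def stolz_def by auto
  have "(c * b)\<^sup>2 \<le> 1\<^sup>2" using assms b by (simp add: power_mult_distrib)
  then have cb: "c * b \<le> 1" by (rule power2_le_imp_le) simp
  have "w * b < c * h * b" using w b by (intro mult_strict_right_mono)
  also have "\<dots> = h * (c * b)" by simp
  also have "\<dots> \<le> h * 1" using cb z1 unfolding h_def by (intro mult_left_mono) auto
  finally have wb: "w * b < h" by simp
  show "z \<in> Gamma_region \<beta> \<xi>"
  proof (cases "w \<le> b")
    case False
    then have "b * b < w * b" using b by (intro mult_strict_right_mono) auto
    then have "1 - \<beta>\<^sup>2 < h" using wb b(2) unfolding power2_eq_square by linarith
    then have "cmod z < \<beta>\<^sup>2" unfolding h_def by simp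
    also have "\<beta>\<^sup>2 \<le> \<beta>" using assms by (simp add: power2_eq_square mult_le_one mult_left_le)
    finally show ?thesis unfolding Gamma_region_def by auto
  next
    case True
    \<comment> \<open>This t minimises w^2 - 2 t w b + t^2 b^2, the bound obtained below for |(1 -
      t) \<xi> - z|^2 - (t \<beta>)^2. The minimum is (w - t b)^2 = 0, and w b < h makes the
      inequality strict.\<close>
    define t where "t = w / b"
    have t: "0 < t" "t \<le> 1" "w = t * b" unfolding t_def using True w b by auto
    define x where "x = Re (z * cnj \<xi>)"
    have xz: "x \<le> cmod z" unfolding x_def using assms complex_Re_le_cmod[of "z * cnj \<xi>"] by (simp add: norm_mult)
    have \<xi>1: "(Re \<xi>)\<^sup>2 + (Im \<xi>)\<^sup>2 = 1" using assms cmod_power2[of \<xi>] by simp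
    have w2: "w\<^sup>2 = (cmod z)\<^sup>2 - 2 * x + 1"
      unfolding w_def x_def cmod_power2 using \<xi>1 by (simp add: power2_eq_square algebra_simps)
    have "(cmod (of_real (1 - t) * \<xi> - z))\<^sup>2 = (1 - t)\<^sup>2 - 2 * (1 - t) * x + (cmod z)\<^sup>2"
    proof -
      have "(cmod (of_real (1 - t) * \<xi> - z))\<^sup>2 = (1 - t)\<^sup>2 * ((Re \<xi>)\<^sup>2 + (Im \<xi>)\<^sup>2) - 2 * (1 - t) * x + (cmod z)\<^sup>2"
        unfolding x_def cmod_power2 by (simp add: power2_eq_square algebra_simps)
      then show ?thesis using \<xi>1 by simp
    qed
    also have "\<dots> = w\<^sup>2 + t\<^sup>2 - 2 * t * (1 - x)" unfolding w2 by (simp add: power2_eq_square algebra_simps)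
    also have "\<dots> \<le> w\<^sup>2 + t\<^sup>2 - 2 * t * h"
      using xz t unfolding h_def by (simp add: mult_left_mono)
    also have "\<dots> < w\<^sup>2 + t\<^sup>2 - 2 * t * (w * b)"
      using wb t by simp
    also have "\<dots> = t\<^sup>2 * (1 - b\<^sup>2)" unfolding t(3) by (simp add: power2_eq_square algebra_simps)
    also have "\<dots> = (t * \<beta>)\<^sup>2" using b by (simp add: power_mult_distrib)
    finally have "cmod (of_real (1 - t) * \<xi> - z) < t * \<beta>"
      by (rule power2_less_imp_less) (use t assms in auto)
    then have "z \<in> ball (of_real (1 - t) * \<xi>) (t * \<beta>)" by (simp add: dist_norm)
    then show ?thesis unfolding Gamma_region_eq[OF assms(1)] using t z\<xi> by auto
  qed
qed

section \<open>Arc length on the unit circle, carried as a measure on the plane\<close>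

lemma sets_circle_measure [simp, measurable_cong]: "sets circle_measure = sets borel"
  and space_circle_measure [simp]: "space circle_measure = UNIV"
  unfolding circle_measure_def by auto

lemma cis_measurable [measurable]: "cis \<in> borel_measurable borel"
  by (intro borel_measurable_continuous_onI continuous_intros)

lemma cis_restrict_measurable: "cis \<in> borel_measurable (restrict_space lborel {0..<2*pi})"
  by (rule measurable_restrict_space1) simp

lemma emeasure_circle_measure:
  assumes "A \<in> sets borel"
  shows "emeasure circle_measure A = emeasure lborel {t \<in> {0..<2*pi}. cis t \<in> A}"
proof -
  have "emeasure circle_measure A = emeasure (restrict_space lborel {0..<2*pi}) (cis -` A \<inter> {0..<2*pi})"
    unfolding circle_measure_def by (subst emeasure_distr[OF cis_restrict_measurable assms]) (simp add: space_restrict_space)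
  also have "\<dots> = emeasure lborel (cis -` A \<inter> {0..<2*pi})"
    by (subst emeasure_restrict_space) auto
  also have "cis -` A \<inter> {0..<2*pi} = {t \<in> {0..<2*pi}. cis t \<in> A}" by auto
  finally show ?thesis .
qed

lemma emeasure_circle_UNIV: "emeasure circle_measure UNIV = ennreal (2 * pi)"
proof -
  have "{t \<in> {0..<2*pi}. cis t \<in> UNIV} = {0..<2*pi}" by auto
  then show ?thesis by (subst emeasure_circle_measure) simp_all
qed

lemma finite_circle_measure: "finite_measure circle_measure"
  by (rule finite_measureI) (simp add: emeasure_circle_UNIV)

text \<open>\<open>circle_measure\<close> lives on the whole plane; this allows estimates valid only
  for unimodular \<xi> to be integrated.\<close>

lemma AE_circle: "AE \<xi> in circle_measure. cmod \<xi> = 1"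
proof -
  have "{\<xi>. cmod \<xi> \<noteq> 1} \<in> null_sets circle_measure"
    by (intro null_setsI, subst emeasure_circle_measure) auto
  then show ?thesis by (rule AE_I') auto
qed

text \<open>The chord is 2 |sin (t/2)|. For |x| <= pi/2 < 1.6 the cubic Taylor remainder of the sine
  is at most (1.6^2/6) |x| < |x|/2, hence |sin x| >= |x|/2.\<close>

lemma abs_le_norm_cis_diff_1:
  assumes "\<bar>t\<bar> \<le> pi"
  shows "\<bar>t\<bar> \<le> 2 * cmod (cis t - 1)"
proof -
  define x where "x = t / 2"
  have x: "\<bar>x\<bar> \<le> 1.6" using assms pi_approx unfolding x_def by simp
  have "\<bar>sin x - (\<Sum>m<3. sin_coeff m * x ^ m)\<bar> \<le> inverse (fact 3) * \<bar>x\<bar> ^ 3"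
    by (rule Maclaurin_sin_bound)
  also have "(\<Sum>m<3. sin_coeff m * x ^ m) = x"
    by (simp add: numeral_3_eq_3 sin_coeff_def)
  also have "inverse (fact 3) * \<bar>x\<bar> ^ 3 = \<bar>x\<bar> * (\<bar>x\<bar> * \<bar>x\<bar>) / 6" by (simp add: fact_numeral power3_eq_cube)
  also have "\<dots> \<le> \<bar>x\<bar> * (1.6 * 1.6) / 6"
    using x by (intro divide_right_mono mult_left_mono mult_mono) auto
  finally have "\<bar>sin x - x\<bar> \<le> \<bar>x\<bar> / 2" by simp
  then have "\<bar>x\<bar> / 2 \<le> \<bar>sin x\<bar>" by linarith
  moreover have "cmod (cis t - 1) = 2 * \<bar>sin x\<bar>"
    unfolding x_def cis_conv_exp by (rule dist_exp_i_1)
  ultimately show ?thesis unfolding x_def by simp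
qed

lemma norm_cis_diff_1_le: "cmod (cis t - 1) \<le> \<bar>t\<bar>"
proof -
  have "cmod (cis t - 1) = 2 * \<bar>sin (t / 2)\<bar>"
    unfolding cis_conv_exp by (rule dist_exp_i_1)
  then show ?thesis using abs_sin_x_le_abs_x[of "t / 2"] by simp
qed

lemma norm_cis_diff: "cmod (cis a - cis b) = cmod (cis (a - b) - 1)"
proof -
  have "cis a - cis b = cis b * (cis (a - b) - 1)" by (simp add: algebra_simps cis_mult)
  then show ?thesis by (simp add: norm_mult)
qed

text \<open>If one parameter \<open>t0\<close> belongs to the ball, every other one is within chord
  2r, hence within arc 4r of it modulo 2 pi. The parameter interval is cut at 0, so three translates
  of an interval of length 8r are used, which gives 24.\<close>

lemma circle_ball_upper:
  assumes "0 \<le> r"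
  shows "emeasure circle_measure (ball z r) \<le> ennreal (24 * r)"
proof (cases "\<exists>t0\<in>{0..<2*pi}. cis t0 \<in> ball z r")
  case False
  then have e: "{t \<in> {0..<2*pi}. cis t \<in> ball z r} = {}" by auto
  show ?thesis by (subst emeasure_circle_measure, simp, subst e) simp
next
  case True
  then obtain t0 where t0: "t0 \<in> {0..<2*pi}" "cis t0 \<in> ball z r" by blast
  define I where "I k = {t0 + 2*pi*k - 4*r .. t0 + 2*pi*k + 4*r}" for k
  have sub: "{t \<in> {0..<2*pi}. cis t \<in> ball z r} \<subseteq> I 0 \<union> I 1 \<union> I (-1)"
  proof
    fix t assume t: "t \<in> {t \<in> {0..<2*pi}. cis t \<in> ball z r}"
    have "dist (cis t) (cis t0) \<le> dist z (cis t) + dist z (cis t0)"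
      by (metis dist_commute dist_triangle)
    then have "cmod (cis (t - t0) - 1) \<le> 2 * r"
      using t t0 by (simp add: dist_norm norm_cis_diff)
    moreover have "cis (t - t0 + 2*pi) = cis (t - t0)" "cis (t - t0 - 2*pi) = cis (t - t0)"
      by (simp_all flip: cis_mult cis_divide)
    moreover have "\<bar>t - t0\<bar> \<le> pi \<or> \<bar>t - t0 + 2*pi\<bar> \<le> pi \<or> \<bar>t - t0 - 2*pi\<bar> \<le> pi"
      using t t0 by auto
    ultimately have "\<bar>t - t0\<bar> \<le> 4 * r \<or> \<bar>t - t0 + 2*pi\<bar> \<le> 4 * r \<or> \<bar>t - t0 - 2*pi\<bar> \<le> 4 * r"
      using abs_le_norm_cis_diff_1[of "t - t0"] abs_le_norm_cis_diff_1[of "t - t0 + 2*pi"]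
        abs_le_norm_cis_diff_1[of "t - t0 - 2*pi"] by auto
    then show "t \<in> I 0 \<union> I 1 \<union> I (-1)" unfolding I_def by auto
  qed
  have mI: "emeasure lborel (I k) = ennreal (8 * r)" for k
    unfolding I_def using assms by simp
  have [measurable]: "I k \<in> sets borel" for k unfolding I_def by simp
  have "emeasure circle_measure (ball z r) \<le> emeasure lborel (I 0 \<union> I 1 \<union> I (-1))"
    by (subst emeasure_circle_measure, simp, rule emeasure_mono[OF sub]) simp
  also have "\<dots> \<le> emeasure lborel (I 0) + emeasure lborel (I 1) + emeasure lborel (I (-1))"
    by (intro order_trans[OF emeasure_subadditive] add_mono order_refl) auto
  also have "\<dots> = ennreal (24 * r)" unfolding mI using assms by (simp flip: ennreal_plus)
  finally show ?thesis .
qed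

text \<open>The arc about u may cross the cut at parameter 0, but one half of it always fits into
  the parameter interval: to the right of the argument s if s <= pi, to the left otherwise, since r
  <= pi.\<close>

lemma circle_ball_lower:
  assumes "0 \<le> r" "r \<le> pi" "cmod u = 1"
  shows "ennreal r \<le> emeasure circle_measure (ball u r)"
proof -
  define s where "s = Arg2pi u"
  have s: "0 \<le> s" "s < 2*pi" "u = cis s"
    unfolding s_def using Arg2pi[of u] assms by (auto simp: is_Arg_def cis_conv_exp)
  obtain l where l: "0 \<le> l" "l + r \<le> 2*pi" "\<And>t. t \<in> {l<..<l+r} \<Longrightarrow> \<bar>t - s\<bar> < r"
  proof (cases "s \<le> pi")
    case True
    show ?thesis by (rule that[of s]) (use s assms True in auto)
  next
    case False
    show ?thesis by (rule that[of "s - r"]) (use s assms False in auto)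
  qed
  have "{l<..<l+r} \<subseteq> {t \<in> {0..<2*pi}. cis t \<in> ball u r}"
  proof
    fix t assume t: "t \<in> {l<..<l+r}"
    have "dist u (cis t) \<le> \<bar>t - s\<bar>"
      unfolding s(3)
      using norm_cis_diff_1_le[of "s - t"] by (simp add: dist_norm norm_cis_diff)
    then show "t \<in> {t \<in> {0..<2*pi}. cis t \<in> ball u r}" using l t by (fastforce simp: less_imp_le)
  qed
  then have "emeasure lborel {l<..<l+r} \<le> emeasure circle_measure (ball u r)"
    by (subst emeasure_circle_measure, simp, intro emeasure_mono) auto
  then show ?thesis using assms by simp
qed

section \<open>Powers on the extended nonnegative reals\<close>

lemma enn_powr_mono: "x \<le> y \<Longrightarrow> 0 \<le> r \<Longrightarrow> enn_powr x r \<le> enn_powr y r"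
  unfolding enn_powr_def
  by (auto simp: top_unique powr_mono2 enn2real_mono less_top intro!: ennreal_leI)

lemma enn_powr_powr_inverse: "0 < r \<Longrightarrow> enn_powr (enn_powr x r) (1 / r) = x"
  unfolding enn_powr_def by (auto simp: powr_powr less_top[symmetric])

lemma enn_powr_le_iff: "0 < r \<Longrightarrow> enn_powr x r \<le> enn_powr y r \<longleftrightarrow> x \<le> y"
  by (metis enn_powr_mono enn_powr_powr_inverse divide_nonneg_pos less_imp_le zero_le_one divide_pos_pos zero_less_one)

lemma enn_powr_top [simp]: "enn_powr top r = top"
  unfolding enn_powr_def by simp

lemma enn_powr_ennreal: "0 \<le> x \<Longrightarrow> enn_powr (ennreal x) r = ennreal (x powr r)"
  unfolding enn_powr_def by simp

lemma enn_powr_0 [simp]: "enn_powr 0 r = 0"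
  using enn_powr_ennreal[of 0 r] by simp

lemma enn_powr_cmult:
  assumes "0 < k"
  shows "enn_powr (ennreal k * x) r = ennreal (k powr r) * enn_powr x r"
proof (cases x)
  case (real y)
  then show ?thesis using assms
    by (simp add: enn_powr_ennreal powr_mult flip: ennreal_mult)
next
  case top
  then show ?thesis using assms by (simp add: ennreal_mult_top)
qed

lemma enn_powr_less_top_iff: "enn_powr x r < \<infinity> \<longleftrightarrow> x < \<infinity>"
  unfolding enn_powr_def by (auto simp: less_top)

lemma enn_powr_measurable [measurable]:
  assumes [measurable]: "f \<in> borel_measurable M"
  shows "(\<lambda>x. enn_powr (f x) r) \<in> borel_measurable M"
  unfolding enn_powr_def by measurable

text \<open>Bounding the sum by twice the maximum serves convex and concave exponents alike.\<close>

lemma enn_powr_add_le: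
  assumes "0 < r"
  shows "enn_powr (x + y) r \<le> ennreal (2 powr r) * (enn_powr x r + enn_powr y r)"
proof -
  have "x + y \<le> 2 * max x y" 
    by (metis add_mono max.cobounded1 max.cobounded2 mult_2)
  then have "enn_powr (x + y) r \<le> enn_powr (ennreal 2 * max x y) r"
    using assms by (intro enn_powr_mono) auto
  also have "\<dots> = ennreal (2 powr r) * enn_powr (max x y) r" by (rule enn_powr_cmult) simp
  also have "enn_powr (max x y) r \<le> enn_powr x r + enn_powr y r"
    by (cases "x \<le> y") (auto simp: max_def)
  finally show ?thesis by (simp add: mult_left_mono)
qed

text \<open>The inverse power is monotone as well, so a bound for all terms transfers to the
  supremum by applying it and returning.\<close>

lemma enn_powr_SUP:
  assumes "incseq X" "0 < r"
  shows "enn_powr (SUP n. X n) r = (SUP n. enn_powr (X n) r)"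
proof (rule antisym)
  let ?S = "SUP n. enn_powr (X n) r"
  have "(SUP n. X n) \<le> enn_powr ?S (1 / r)"
  proof (rule SUP_least)
    fix n
    have "enn_powr (enn_powr (X n) r) (1 / r) \<le> enn_powr ?S (1 / r)"
      using assms by (intro enn_powr_mono SUP_upper) auto
    then show "X n \<le> enn_powr ?S (1 / r)" using assms by (simp add: enn_powr_powr_inverse)
  qed
  then have "enn_powr (SUP n. X n) r \<le> enn_powr (enn_powr ?S (1 / r)) r"
    using assms by (intro enn_powr_mono) auto
  also have "\<dots> = ?S" using enn_powr_powr_inverse[of "1 / r" ?S] assms by simp
  finally show "enn_powr (SUP n. X n) r \<le> ?S" .
  show "?S \<le> enn_powr (SUP n. X n) r"
    using assms by (intro SUP_least enn_powr_mono SUP_upper) auto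
qed

section \<open>Change of aperture\<close>

text \<open>This estimate and its companion for s <= 1 turn a telescoping sum of s-th powers into a
  sum of increments weighted by the power s - 1 at the upper end; the sign of s - 1 decides the
  direction. The end point 0 is separated because the mean value theorem is applied with derivatives
  on the closed interval.\<close>

lemma powr_diff_le:
  fixes x y s :: real
  assumes "1 \<le> s" "0 \<le> y" "y \<le> x"
  shows "x powr s - y powr s \<le> s * x powr (s - 1) * (x - y)"
proof (cases "y = 0 \<or> y = x")
  case True
  then show ?thesis
  proof
    assume y: "y = 0"
    have "x powr s = x powr (s - 1) * x" 
      using assms by (cases "x = 0") (auto simp: powr_diff)
    moreover have "1 * (x powr (s - 1) * x) \<le> s * (x powr (s - 1) * x)"
      using assms by (intro mult_right_mono) auto
    ultimately show ?thesis using y by simp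
  qed simp
next
  case False
  then have xy: "0 < y" "y < x" using assms by auto
  have "\<exists>z. y < z \<and> z < x \<and> x powr s - y powr s = (x - y) * (s * z powr (s - 1))"
    using xy by (intro MVT2) (auto intro!: derivative_eq_intros)
  then obtain z where z: "y < z" "z < x" "x powr s - y powr s = (x - y) * (s * z powr (s - 1))" by blast
  have "(x - y) * (s * z powr (s - 1)) \<le> (x - y) * (s * x powr (s - 1))"
    using z xy assms by (intro mult_left_mono powr_mono2) auto
  then show ?thesis unfolding z(3) by (simp add: mult_ac)
qed

lemma powr_diff_ge:
  fixes x y s :: real
  assumes "0 < s" "s \<le> 1" "0 \<le> y" "y \<le> x"
  shows "s * x powr (s - 1) * (x - y) \<le> x powr s - y powr s"
proof (cases "y = 0 \<or> y = x")
  case True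
  then show ?thesis
  proof
    assume y: "y = 0"
    have "x powr s = x powr (s - 1) * x" 
      using assms by (cases "x = 0") (auto simp: powr_diff)
    moreover have "s * (x powr (s - 1) * x) \<le> 1 * (x powr (s - 1) * x)"
      using assms by (intro mult_right_mono) auto
    ultimately show ?thesis using y by simp
  qed simp
next
  case False
  then have xy: "0 < y" "y < x" using assms by auto
  have "\<exists>z. y < z \<and> z < x \<and> x powr s - y powr s = (x - y) * (s * z powr (s - 1))"
    using xy by (intro MVT2) (auto intro!: derivative_eq_intros)
  then obtain z where z: "y < z" "z < x" "x powr s - y powr s = (x - y) * (s * z powr (s - 1))" by blast
  have "(x - y) * (s * x powr (s - 1)) \<le> (x - y) * (s * z powr (s - 1))"
    using z xy assms by (intro mult_left_mono powr_mono2') auto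
  then show ?thesis unfolding z(3) by (simp add: mult_ac)
qed

text \<open>A weighted Young inequality by cases: if a <= \<tau> y the second term alone suffices,
  otherwise y <= a/\<tau> and the first one does.\<close>

lemma young_ge_1:
  fixes a y s \<tau> :: real
  assumes "1 \<le> s" "0 \<le> a" "0 \<le> y" "0 < \<tau>"
  shows "a * y powr (s - 1) \<le> \<tau> powr (1 - s) * a powr s + \<tau> * y powr s"
proof (cases "a \<le> \<tau> * y")
  case True
  then have "a * y powr (s - 1) \<le> \<tau> * y * y powr (s - 1)" by (intro mult_right_mono) auto
  also have "\<dots> = \<tau> * y powr s" using assms by (cases "y = 0") (auto simp: powr_diff)
  finally show ?thesis by (simp add: add_increasing)
next
  case False
  then have "y \<le> a / \<tau>" using assms by (simp add: pos_le_divide_eq mult.commute)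
  have "0 \<le> \<tau> * y" using assms by simp
  then have "0 < a" using False by linarith
  have "a * y powr (s - 1) \<le> a * (a / \<tau>) powr (s - 1)"
    using assms \<open>y \<le> a / \<tau>\<close> by (intro mult_left_mono powr_mono2) auto
  also have "\<dots> = \<tau> powr (1 - s) * a powr s" using \<open>0 < a\<close> assms
    by (simp add: powr_divide powr_diff field_simps)
  finally show ?thesis using assms by (simp add: add_increasing2)
qed

text \<open>The counterpart for a negative power s - 1. If x^s exceeds \<tau> y^s, write x^s = x
  y^(s-1) (x/y)^(s-1); since x/y > \<tau>^(1/s), the last factor is at most
  \<tau>^(-(1-s)/s).\<close>

lemma young_le_1:
  fixes x y s \<tau> :: real
  assumes "0 < s" "s < 1" "0 \<le> x" "0 < y" "0 < \<tau>"
  shows "x powr s \<le> \<tau> * y powr s + \<tau> powr (- (1 - s) / s) * (x * y powr (s - 1))"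
proof (cases "x powr s \<le> \<tau> * y powr s")
  case True
  then show ?thesis using assms by (simp add: add_increasing2)
next
  case False
  then have x: "0 < x" using assms by (cases "x = 0") auto
  have "\<tau> < (x / y) powr s" using False assms by (simp add: powr_divide field_simps)
  then have "\<tau> powr (1 / s) \<le> ((x / y) powr s) powr (1 / s)"
    using assms by (intro powr_mono2) auto
  also have "\<dots> = x / y" using assms x by (simp add: powr_powr)
  finally have "(x / y) powr (s - 1) \<le> (\<tau> powr (1 / s)) powr (s - 1)"
    using assms by (intro powr_mono2') auto
  also have "\<dots> = \<tau> powr (- (1 - s) / s)" by (simp add: powr_powr)
  finally have "x * y powr (s - 1) * (x / y) powr (s - 1) \<le> x * y powr (s - 1) * \<tau> powr (- (1 - s) / s)"
    using x by (intro mult_left_mono) auto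
  also have "x * y powr (s - 1) * (x / y) powr (s - 1) = x powr s"
    using x assms by (simp add: powr_divide powr_diff field_simps)
  finally have "x powr s \<le> \<tau> powr (- (1 - s) / s) * (x * y powr (s - 1))" by (simp add: mult_ac)
  then show ?thesis using assms by (simp add: add_increasing)
qed

text \<open>The errors may grow like E^j because each stage gains a factor 1/(2E): unrolled N times
  they sum to at most Q (1 + 1/2 + 1/4 + ...) <= 2Q, and the a priori bound M makes the remainder,
  of size at most |M|/(2E)^N, disappear.\<close>

lemma contraction_iterate:
  fixes n :: "nat \<Rightarrow> real"
  assumes step: "\<And>j. n j \<le> Q * E ^ j + n (Suc j) / (2 * E)" and "1 \<le> E" and bd: "\<And>j. n j \<le> M" and "0 \<le> Q"
  shows "n 0 \<le> 2 * Q"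
proof -
  have *: "n 0 \<le> Q * (\<Sum>i<N. (1/2) ^ i) + n N / (2 * E) ^ N" for N
  proof (induction N)
    case (Suc N)
    have "n N / (2 * E) ^ N \<le> (Q * E ^ N + n (Suc N) / (2 * E)) / (2 * E) ^ N"
      using step[of N] assms by (intro divide_right_mono) auto
    also have "\<dots> = Q * (1/2) ^ N + n (Suc N) / (2 * E) ^ Suc N"
      using assms by (simp add: field_simps)
    finally show ?case using Suc by (simp add: algebra_simps)
  qed simp
  have le: "n 0 \<le> 2 * Q + \<bar>M\<bar> * (1/2) ^ N" for N
  proof -
    have "(\<Sum>i<N. (1/2::real) ^ i) \<le> 2" by (simp add: sum_gp_strict)
    then have 1: "Q * (\<Sum>i<N. (1/2) ^ i) \<le> Q * 2" using assms by (intro mult_left_mono) auto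
    have "n N / (2 * E) ^ N \<le> \<bar>M\<bar> / (2 * E) ^ N"
      using order_trans[OF bd[of N] abs_ge_self] \<open>1 \<le> E\<close> by (intro divide_right_mono) auto
    also have "\<dots> \<le> \<bar>M\<bar> / 2 ^ N"
      using \<open>1 \<le> E\<close> by (intro divide_left_mono power_mono mult_pos_pos) auto
    also have "\<bar>M\<bar> / 2 ^ N = \<bar>M\<bar> * (1/2) ^ N" by (simp add: power_divide)
    finally have "n N / (2 * E) ^ N \<le> \<bar>M\<bar> * (1/2) ^ N" .
    then show ?thesis using 1 *[of N] by linarith
  qed
  have "(\<lambda>N. 2 * Q + \<bar>M\<bar> * (1/2) ^ N) \<longlonglongrightarrow> 2 * Q + \<bar>M\<bar> * 0"
    by (intro tendsto_intros LIMSEQ_power_zero) auto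
  then show ?thesis using le by (intro LIMSEQ_le_const[of _ "2 * Q"]) auto
qed

section \<open>Shadows of points and dyadic layers\<close>

lemma pred_mem_stolz [measurable]:
  assumes [measurable]: "f \<in> borel_measurable M" "g \<in> borel_measurable M"
  shows "Measurable.pred M (\<lambda>x. f x \<in> stolz c (g x))"
  unfolding stolz_def mem_Collect_eq by measurable

lemma nn_integral_circle_mono:
  assumes "\<And>\<xi>. cmod \<xi> = 1 \<Longrightarrow> f \<xi> \<le> g \<xi>"
  shows "(\<integral>\<^sup>+\<xi>. f \<xi> \<partial>circle_measure) \<le> (\<integral>\<^sup>+\<xi>. g \<xi> \<partial>circle_measure)"
  by (rule nn_integral_mono_AE, rule AE_mp[OF AE_circle]) (use assms in auto)

text \<open>The radial projection u of z is at distance exactly 1 - |z| from z. The excess 1/10 of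
  the aperture over 1 leaves room for a ball of radius (1 - |z|)/10 about u.\<close>

lemma shadow_lower:
  assumes "cmod z < 1"
  shows "ennreal ((1 - cmod z) / 10) \<le> emeasure circle_measure {\<eta>. z \<in> stolz (11/10) \<eta>}"
proof -
  obtain u where u: "cmod u = 1" "z = of_real (cmod z) * u"
  proof (cases "z = 0")
    case True then show ?thesis using that[of 1] by simp
  next
    case False then show ?thesis using that[of "z / of_real (cmod z)"] by (simp add: norm_divide)
  qed
  have "z - u = of_real (cmod z - 1) * u" by (subst u(2)) (simp add: algebra_simps)
  then have zu: "cmod (z - u) = 1 - cmod z" using assms u(1) by (simp add: norm_mult del: of_real_diff)
  have "ball u ((1 - cmod z) / 10) \<subseteq> {\<eta>. z \<in> stolz (11/10) \<eta>}"
  proof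
    fix \<eta> assume "\<eta> \<in> ball u ((1 - cmod z) / 10)"
    then have "cmod (u - \<eta>) < (1 - cmod z) / 10" by (simp add: dist_norm)
    moreover have "cmod (z - \<eta>) \<le> cmod (z - u) + cmod (u - \<eta>)" using norm_triangle_ineq[of "z - u" "u - \<eta>"] by simp
    ultimately show "\<eta> \<in> {\<eta>. z \<in> stolz (11/10) \<eta>}" using zu unfolding stolz_def by simp
  qed
  moreover have "{\<eta>. z \<in> stolz (11/10) \<eta>} = ball z (11/10 * (1 - cmod z))"
    by (auto simp: stolz_def dist_norm)
  ultimately have "emeasure circle_measure (ball u ((1 - cmod z) / 10)) \<le> emeasure circle_measure {\<eta>. z \<in> stolz (11/10) \<eta>}"
    by (intro emeasure_mono) auto
  moreover have "ennreal ((1 - cmod z) / 10) \<le> emeasure circle_measure (ball u ((1 - cmod z) / 10))"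
  proof (rule circle_ball_lower)
    have "(1 - cmod z) / 10 \<le> 1 / 10" by (rule divide_right_mono) simp_all
    also have "\<dots> \<le> pi" using pi_gt3 by simp
    finally show "(1 - cmod z) / 10 \<le> pi" .
  qed (use assms u in auto)
  ultimately show ?thesis by (rule order_trans[rotated])
qed

text \<open>The bound 24 c (1 - |z|) is written as a multiple of the lower bound in
  \<open>shadow_lower\<close>, so that a wide shadow can be compared with a narrow one
  directly.\<close>

lemma shadow_upper:
  assumes "cmod z < 1" "0 < c"
  shows "emeasure circle_measure {\<xi>. z \<in> stolz c \<xi>} \<le> ennreal (240 * c) * ennreal ((1 - cmod z) / 10)"
proof -
  have "{\<eta>. z \<in> stolz c \<eta>} = ball z (c * (1 - cmod z))" by (auto simp: stolz_def dist_norm)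
  then show ?thesis
    using circle_ball_upper[of "c * (1 - cmod z)" z] assms by (simp flip: ennreal_mult)
qed

definition annulus :: "nat \<Rightarrow> complex set" where
  "annulus k = {z. 1 / 2 ^ Suc k < 1 - cmod z \<and> 1 - cmod z \<le> 1 / 2 ^ k}"

text \<open>The partial unions of the annuli: \<open>core (Suc k)\<close> is the disjoint union of
  \<open>core k\<close> and \<open>annulus k\<close>, and \<open>core 0\<close> is empty, so the
  telescoping sums have no initial term.\<close>

definition core :: "nat \<Rightarrow> complex set" where
  "core k = {z. 1 / 2 ^ k < 1 - cmod z}"

lemma core_borel [measurable]: "core k \<in> sets borel"
  and annulus_borel [measurable]: "annulus k \<in> sets borel"
  unfolding core_def annulus_def by measurable

lemma core_0: "core 0 = {}" unfolding core_def by (auto simp: not_less)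

lemma core_Suc: "core (Suc k) = core k \<union> annulus k"
proof -
  have "(1::real) / 2 ^ Suc k \<le> 1 / 2 ^ k" by (simp add: field_simps)
  then show ?thesis unfolding core_def annulus_def by auto
qed

lemma core_annulus_disjoint: "core k \<inter> annulus k = {}"
  unfolding core_def annulus_def by auto

lemma annulus_subset_disc: "z \<in> annulus k \<Longrightarrow> cmod z < 1"
proof -
  assume "z \<in> annulus k"
  then have "1 / 2 ^ Suc k < 1 - cmod z" unfolding annulus_def by blast
  moreover have "(0::real) < 1 / 2 ^ Suc k" by simp
  ultimately show ?thesis by linarith
qed

text \<open>For z in \<open>annulus k\<close> and w in \<open>core (Suc k)\<close> the heights
  satisfy 1 - |z| <= 2 (1 - |w|). The vertices of two cones of aperture c through z differ by less
  than 2c (1 - |z|) <= 4c (1 - |w|); adding the c (1 - |w|) of the given cone produces the factor 5.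
  The two conclusions serve s >= 1 and s < 1 respectively.\<close>

lemma stolz_core_shift:
  assumes "z \<in> annulus k" "1 \<le> c" "c' \<le> c" "0 < c'" "z \<in> stolz c \<xi>" "z \<in> stolz c' \<eta>"
  shows "stolz c \<xi> \<inter> core (Suc k) \<subseteq> stolz (5 * c) \<eta> \<inter> core (Suc k)" (is ?A)
    and "stolz c' \<eta> \<inter> core (Suc k) \<subseteq> stolz (5 * c) \<xi> \<inter> core (Suc k)" (is ?B)
proof -
  have z': "z \<in> stolz c \<eta>" using stolz_mono[of c' c \<eta>] assms by auto
  have aux: "stolz c a \<inter> core (Suc k) \<subseteq> stolz (5 * c) b \<inter> core (Suc k)" 
    if ab: "z \<in> stolz c a" "z \<in> stolz c b" for a b
  proof
    fix w assume w: "w \<in> stolz c a \<inter> core (Suc k)"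
    have "1 - cmod z \<le> 2 * (1 - cmod w)"
      using w assms(1) unfolding core_def annulus_def by auto
    then have 1: "c * (1 - cmod z) \<le> c * (2 * (1 - cmod w))" using assms by (intro mult_left_mono) auto
    have eq: "w - b = (w - a) + ((z - b) - (z - a))" by simp
    have "cmod (w - b) \<le> cmod (w - a) + (cmod (z - b) + cmod (z - a))"
      by (subst eq) (intro norm_triangle_le add_left_mono norm_triangle_ineq4)
    also have "\<dots> < 5 * c * (1 - cmod w)" using w ab 1 unfolding stolz_def by (auto simp: algebra_simps)
    finally show "w \<in> stolz (5 * c) b \<inter> core (Suc k)" using w unfolding stolz_def by auto
  qed
  show ?A using aux assms z' by blast
  have "stolz c' \<eta> \<subseteq> stolz c \<eta>" using stolz_mono[of c' c \<eta>] assms by auto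
  then show ?B using aux[of \<eta> \<xi>] assms z' by blast
qed

section \<open>The aperture step for finite measures\<close>

abbreviation stolz_power :: "complex measure \<Rightarrow> real \<Rightarrow> real \<Rightarrow> ennreal" where
  "stolz_power \<mu> s c \<equiv> (\<integral>\<^sup>+\<xi>. ennreal (measure \<mu> (stolz c \<xi>) powr s) \<partial>circle_measure)"

context
  fixes \<mu> :: "complex measure"
  assumes fin: "finite_measure \<mu>" and sets_mu [simp, measurable_cong]: "sets \<mu> = sets borel"
begin

interpretation finite_measure \<mu> by (rule fin)
interpretation circ: finite_measure circle_measure by (rule finite_circle_measure)
interpretation pair_sigma_finite \<mu> circle_measure ..

lemma stolz_emeasure_measurable [measurable]:
  assumes [measurable]: "B \<in> sets borel"
  shows "(\<lambda>\<xi>. emeasure \<mu> (stolz c \<xi> \<inter> B)) \<in> borel_measurable borel"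
proof -
  have "emeasure \<mu> (stolz c \<xi> \<inter> B) = (\<integral>\<^sup>+z. indicator {x. fst x \<in> stolz c (snd x)} (z, \<xi>) * indicator B z \<partial>\<mu>)" for \<xi>
  proof -
    have "(\<integral>\<^sup>+z. indicator {x. fst x \<in> stolz c (snd x)} (z, \<xi>) * indicator B z \<partial>\<mu>) = (\<integral>\<^sup>+z. indicator (stolz c \<xi> \<inter> B) z \<partial>\<mu>)"
      by (intro nn_integral_cong) (auto split: split_indicator)
    then show ?thesis by simp
  qed
  then show ?thesis by simp
qed

lemma stolz_measure_measurable [measurable]:
  assumes [measurable]: "B \<in> sets borel"
  shows "(\<lambda>\<xi>. measure \<mu> (stolz c \<xi> \<inter> B)) \<in> borel_measurable borel"
  unfolding measure_def by measurable

lemma stolz_measure_measurable' [measurable]: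
  "(\<lambda>\<xi>. measure \<mu> (stolz c \<xi>)) \<in> borel_measurable borel"
  using stolz_measure_measurable[of UNIV c] by simp

text \<open>By Fubini the integral over \<xi> becomes an integral over z in B of H over the shadow
  of z. On one shadow H is at most its supremum h, the wide and the narrow shadow have comparable
  length, and \<open>le\<close> makes h a lower bound for H' on the narrow one.\<close>

lemma shadow_comparison:
  assumes [measurable]: "H \<in> borel_measurable borel" "H' \<in> borel_measurable borel"
    and B [measurable]: "B \<in> sets borel" "\<And>z. z \<in> B \<Longrightarrow> cmod z < 1" and c: "0 < c"
    and le: "\<And>z \<xi> \<eta>. z \<in> B \<Longrightarrow> cmod \<xi> = 1 \<Longrightarrow> cmod \<eta> = 1 \<Longrightarrow> z \<in> stolz c \<xi> \<Longrightarrow> z \<in> stolz (11/10) \<eta> \<Longrightarrow> H \<xi> \<le> H' \<eta>"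
  shows "(\<integral>\<^sup>+\<xi>. H \<xi> * emeasure \<mu> (stolz c \<xi> \<inter> B) \<partial>circle_measure)
    \<le> ennreal (240 * c) * (\<integral>\<^sup>+\<eta>. H' \<eta> * emeasure \<mu> (stolz (11/10) \<eta> \<inter> B) \<partial>circle_measure)"
proof -
  have em: "emeasure \<mu> (stolz c \<xi> \<inter> B) = (\<integral>\<^sup>+z. indicator {x. fst x \<in> stolz c (snd x)} (z, \<xi>) * indicator B z \<partial>\<mu>)" for c \<xi>
  proof -
    have "(\<integral>\<^sup>+z. indicator {x. fst x \<in> stolz c (snd x)} (z, \<xi>) * indicator B z \<partial>\<mu>) = (\<integral>\<^sup>+z. indicator (stolz c \<xi> \<inter> B) z \<partial>\<mu>)"
      by (intro nn_integral_cong) (auto split: split_indicator)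
    then show ?thesis by simp
  qed
  have swap: "(\<integral>\<^sup>+\<xi>. G \<xi> * emeasure \<mu> (stolz c \<xi> \<inter> B) \<partial>circle_measure)
      = (\<integral>\<^sup>+z. indicator B z * (\<integral>\<^sup>+\<xi>. G \<xi> * indicator {\<xi>. z \<in> stolz c \<xi>} \<xi> \<partial>circle_measure) \<partial>\<mu>)"
    if [measurable]: "G \<in> borel_measurable borel" for G c
  proof -
    have "(\<integral>\<^sup>+\<xi>. G \<xi> * emeasure \<mu> (stolz c \<xi> \<inter> B) \<partial>circle_measure)
      = (\<integral>\<^sup>+\<xi>. \<integral>\<^sup>+z. G \<xi> * (indicator {x. fst x \<in> stolz c (snd x)} (z, \<xi>) * indicator B z) \<partial>\<mu> \<partial>circle_measure)"
      unfolding em by (intro nn_integral_cong nn_integral_cmult[symmetric]) measurable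
    also have "\<dots> = (\<integral>\<^sup>+z. \<integral>\<^sup>+\<xi>. G \<xi> * (indicator {x. fst x \<in> stolz c (snd x)} (z, \<xi>) * indicator B z) \<partial>circle_measure \<partial>\<mu>)"
      by (rule Fubini') measurable
    also have "\<dots> = (\<integral>\<^sup>+z. \<integral>\<^sup>+\<xi>. indicator B z * (G \<xi> * indicator {\<xi>. z \<in> stolz c \<xi>} \<xi>) \<partial>circle_measure \<partial>\<mu>)"
      by (intro nn_integral_cong) (auto split: split_indicator)
    also have "\<dots> = (\<integral>\<^sup>+z. indicator B z * (\<integral>\<^sup>+\<xi>. G \<xi> * indicator {\<xi>. z \<in> stolz c \<xi>} \<xi> \<partial>circle_measure) \<partial>\<mu>)"
      by (intro nn_integral_cong nn_integral_cmult) measurable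
    finally show ?thesis .
  qed
  have main: "(\<integral>\<^sup>+\<xi>. H \<xi> * indicator {\<xi>. z \<in> stolz c \<xi>} \<xi> \<partial>circle_measure)
      \<le> ennreal (240 * c) * (\<integral>\<^sup>+\<eta>. H' \<eta> * indicator {\<xi>. z \<in> stolz (11/10) \<xi>} \<eta> \<partial>circle_measure)" if z: "z \<in> B" for z
  proof -
    define h where "h = (SUP \<xi>\<in>{\<xi>. z \<in> stolz c \<xi> \<and> cmod \<xi> = 1}. H \<xi>)"
    have "(\<integral>\<^sup>+\<xi>. H \<xi> * indicator {\<xi>. z \<in> stolz c \<xi>} \<xi> \<partial>circle_measure) \<le> (\<integral>\<^sup>+\<xi>. h * indicator {\<xi>. z \<in> stolz c \<xi>} \<xi> \<partial>circle_measure)"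
    proof (rule nn_integral_circle_mono)
      fix \<xi> :: complex assume "cmod \<xi> = 1"
      then have "z \<in> stolz c \<xi> \<Longrightarrow> H \<xi> \<le> h" unfolding h_def by (intro SUP_upper) simp
      then show "H \<xi> * indicator {\<xi>. z \<in> stolz c \<xi>} \<xi> \<le> h * indicator {\<xi>. z \<in> stolz c \<xi>} \<xi>"
        by (cases "z \<in> stolz c \<xi>") auto
    qed
    also have "\<dots> = h * emeasure circle_measure {\<xi>. z \<in> stolz c \<xi>}"
      by (rule nn_integral_cmult_indicator) simp
    also have "\<dots> \<le> h * (ennreal (240 * c) * ennreal ((1 - cmod z) / 10))"
      using B(2)[OF z] c by (intro mult_left_mono shadow_upper) auto
    also have "\<dots> \<le> h * (ennreal (240 * c) * emeasure circle_measure {\<eta>. z \<in> stolz (11/10) \<eta>})"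
      using B(2)[OF z] by (intro mult_left_mono shadow_lower) auto
    also have "\<dots> = ennreal (240 * c) * (h * emeasure circle_measure {\<eta>. z \<in> stolz (11/10) \<eta>})" by (simp add: mult_ac)
    also have "h * emeasure circle_measure {\<eta>. z \<in> stolz (11/10) \<eta>} = (\<integral>\<^sup>+\<eta>. h * indicator {\<xi>. z \<in> stolz (11/10) \<xi>} \<eta> \<partial>circle_measure)"
      by (rule nn_integral_cmult_indicator[symmetric]) simp
    also have "\<dots> \<le> (\<integral>\<^sup>+\<eta>. H' \<eta> * indicator {\<xi>. z \<in> stolz (11/10) \<xi>} \<eta> \<partial>circle_measure)"
    proof (rule nn_integral_circle_mono)
      fix \<eta> :: complex assume "cmod \<eta> = 1"
      then have "z \<in> stolz (11/10) \<eta> \<Longrightarrow> h \<le> H' \<eta>" unfolding h_def using le[OF z] by (intro SUP_least) simp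
      then show "h * indicator {\<xi>. z \<in> stolz (11/10) \<xi>} \<eta> \<le> H' \<eta> * indicator {\<xi>. z \<in> stolz (11/10) \<xi>} \<eta>"
        by (cases "z \<in> stolz (11/10) \<eta>") auto
    qed
    finally show ?thesis by (simp add: mult_left_mono)
  qed
  show ?thesis
    unfolding swap[OF assms(1)] swap[OF assms(2)]
  proof (rule order_trans[OF nn_integral_mono eq_refl[OF nn_integral_cmult]])
    fix z
    show "indicator B z * (\<integral>\<^sup>+\<xi>. H \<xi> * indicator {\<xi>. z \<in> stolz c \<xi>} \<xi> \<partial>circle_measure)
      \<le> ennreal (240 * c) * (indicator B z * (\<integral>\<^sup>+\<eta>. H' \<eta> * indicator {\<xi>. z \<in> stolz (11/10) \<xi>} \<eta> \<partial>circle_measure))"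
      using main[of z] by (cases "z \<in> B") auto
  qed measurable
qed

lemma measure_stolz_core_Suc:
  "measure \<mu> (stolz c \<xi> \<inter> core (Suc k)) = measure \<mu> (stolz c \<xi> \<inter> core k) + measure \<mu> (stolz c \<xi> \<inter> annulus k)"
  unfolding core_Suc Int_Un_distrib
  by (rule finite_measure_Union) (use core_annulus_disjoint in auto)

lemma measure_stolz_core_sum:
  "measure \<mu> (stolz c \<xi> \<inter> core n) = (\<Sum>k<n. measure \<mu> (stolz c \<xi> \<inter> annulus k))"
  by (induction n) (simp_all add: core_0 measure_stolz_core_Suc)

context
  fixes n :: nat
  assumes supp: "emeasure \<mu> (- core n) = 0"
begin

text \<open>The hypothesis \<open>supp\<close> stops the telescoping sums at n; they are finite
  sums.\<close>

lemma measure_stolz_eq_core: "measure \<mu> (stolz c \<xi>) = measure \<mu> (stolz c \<xi> \<inter> core n)"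
proof -
  have "emeasure \<mu> (stolz c \<xi> - (- core n)) = emeasure \<mu> (stolz c \<xi>)"
    by (rule emeasure_Diff_null_set) (use supp in \<open>auto intro!: null_setsI\<close>)
  then show ?thesis unfolding measure_def by (simp add: Diff_eq)
qed

text \<open>Telescoping bounds the s-th power of the measure of the cone by a sum over layers, each
  layer mass weighted by the power s - 1 of a truncated cone. \<open>shadow_comparison\<close>
  trades layer masses at aperture c for those at 11/10, at the price of 240 c and of the aperture 5c
  inside the power. The layers at 11/10 add up again, and Young's inequality separates the two
  apertures.\<close>

lemma aperture_step_ge_1:
  assumes s: "1 \<le> s" and c: "11/10 \<le> c" and \<tau>: "0 < \<tau>"
  shows "(stolz_power \<mu> s c)
    \<le> ennreal (240 * s * c) * (ennreal (\<tau> powr (1 - s)) * (stolz_power \<mu> s (11/10))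
       + ennreal \<tau> * (stolz_power \<mu> s (5 * c)))"
proof -
  let ?F = "\<lambda>c k \<xi>. measure \<mu> (stolz c \<xi> \<inter> core k)"
  let ?L = "\<lambda>c k \<xi>. measure \<mu> (stolz c \<xi> \<inter> annulus k)"
  let ?A = "\<lambda>c \<xi>. measure \<mu> (stolz c \<xi>)"
  have tele: "?A c \<xi> powr s \<le> (\<Sum>k<n. s * (?F c (Suc k) \<xi> powr (s - 1) * ?L c k \<xi>))" for \<xi>
  proof -
    have "?A c \<xi> powr s = (\<Sum>k<n. ?F c (Suc k) \<xi> powr s - ?F c k \<xi> powr s)"
      unfolding measure_stolz_eq_core by (subst sum_lessThan_telescope) (simp add: core_0)
    also have "\<dots> \<le> (\<Sum>k<n. s * ?F c (Suc k) \<xi> powr (s - 1) * (?F c (Suc k) \<xi> - ?F c k \<xi>))"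
      using s by (intro sum_mono powr_diff_le) (auto simp: measure_stolz_core_Suc)
    finally show ?thesis by (simp add: measure_stolz_core_Suc mult_ac)
  qed
  have key: "?F c (Suc k) \<xi> powr (s - 1) \<le> ?F (5 * c) (Suc k) \<eta> powr (s - 1)"
    if "z \<in> annulus k" "z \<in> stolz c \<xi>" "z \<in> stolz (11/10) \<eta>" for k z \<xi> \<eta>
    using s c that by (intro powr_mono2 finite_measure_mono stolz_core_shift(1)[of z k c "11/10"]) auto
  have "(stolz_power \<mu> s c)
     \<le> (\<integral>\<^sup>+\<xi>. (\<Sum>k<n. ennreal s * (ennreal (?F c (Suc k) \<xi> powr (s - 1)) * emeasure \<mu> (stolz c \<xi> \<inter> annulus k))) \<partial>circle_measure)"
    using s by (intro nn_integral_mono order_trans[OF ennreal_leI[OF tele]])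
      (simp add: emeasure_eq_measure sum_nonneg sum_ennreal flip: ennreal_mult)
  also have "\<dots> = (\<Sum>k<n. ennreal s * (\<integral>\<^sup>+\<xi>. ennreal (?F c (Suc k) \<xi> powr (s - 1)) * emeasure \<mu> (stolz c \<xi> \<inter> annulus k) \<partial>circle_measure))"
    by (subst nn_integral_sum, simp, intro sum.cong refl nn_integral_cmult) measurable
  also have "\<dots> \<le> (\<Sum>k<n. ennreal s * (ennreal (240 * c) * (\<integral>\<^sup>+\<xi>. ennreal (?F (5 * c) (Suc k) \<xi> powr (s - 1)) * emeasure \<mu> (stolz (11/10) \<xi> \<inter> annulus k) \<partial>circle_measure)))"
    using s c by (intro sum_mono mult_left_mono shadow_comparison) (auto intro: key annulus_subset_disc)
  also have "\<dots> = ennreal (240 * s * c) * (\<Sum>k<n. (\<integral>\<^sup>+\<xi>. ennreal (?F (5 * c) (Suc k) \<xi> powr (s - 1)) * emeasure \<mu> (stolz (11/10) \<xi> \<inter> annulus k) \<partial>circle_measure))"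
    using s c by (simp add: sum_distrib_left ennreal_mult mult_ac)
  also have "(\<Sum>k<n. (\<integral>\<^sup>+\<xi>. ennreal (?F (5 * c) (Suc k) \<xi> powr (s - 1)) * emeasure \<mu> (stolz (11/10) \<xi> \<inter> annulus k) \<partial>circle_measure))
      = (\<integral>\<^sup>+\<xi>. (\<Sum>k<n. ennreal (?F (5 * c) (Suc k) \<xi> powr (s - 1)) * emeasure \<mu> (stolz (11/10) \<xi> \<inter> annulus k)) \<partial>circle_measure)"
    by (rule nn_integral_sum[symmetric]) measurable
  also have "\<dots> \<le> (\<integral>\<^sup>+\<xi>. ennreal (\<tau> powr (1 - s)) * ennreal (?A (11/10) \<xi> powr s) + ennreal \<tau> * ennreal (?A (5 * c) \<xi> powr s) \<partial>circle_measure)"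
  proof (rule nn_integral_mono)
    fix \<xi>
    have "(\<Sum>k<n. ?F (5 * c) (Suc k) \<xi> powr (s - 1) * ?L (11/10) k \<xi>) \<le> (\<Sum>k<n. ?A (5 * c) \<xi> powr (s - 1) * ?L (11/10) k \<xi>)"
      using s by (intro sum_mono mult_right_mono powr_mono2 finite_measure_mono) auto
    also have "\<dots> = ?A (11/10) \<xi> * ?A (5 * c) \<xi> powr (s - 1)"
      unfolding measure_stolz_eq_core[of "11/10"] measure_stolz_core_sum by (simp add: sum_distrib_left sum_distrib_right mult_ac)
    also have "\<dots> \<le> \<tau> powr (1 - s) * ?A (11/10) \<xi> powr s + \<tau> * ?A (5 * c) \<xi> powr s"
      using s \<tau> by (intro young_ge_1) auto
    finally show "(\<Sum>k<n. ennreal (?F (5 * c) (Suc k) \<xi> powr (s - 1)) * emeasure \<mu> (stolz (11/10) \<xi> \<inter> annulus k))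
      \<le> ennreal (\<tau> powr (1 - s)) * ennreal (?A (11/10) \<xi> powr s) + ennreal \<tau> * ennreal (?A (5 * c) \<xi> powr s)"
      using \<tau> by (simp add: emeasure_eq_measure sum_nonneg ennreal_leI sum_ennreal flip: ennreal_mult ennreal_plus)
  qed
  also have "\<dots> = ennreal (\<tau> powr (1 - s)) * (stolz_power \<mu> s (11/10))
       + ennreal \<tau> * (stolz_power \<mu> s (5 * c))"
    by (simp add: nn_integral_add nn_integral_cmult)
  finally show ?thesis by (simp add: mult_left_mono)
qed

text \<open>For s - 1 < 0 a wider cone makes the power smaller, so the argument runs in the opposite
  order: \<open>young_le_1\<close> produces a mixed term, this is expanded into layers, and the
  shadows turn aperture 5c inside the power into 11/10. There concavity lets the telescoping bound
  the layer sum from above. The hypothesis \<open>pos\<close> makes the bases of the negative powers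
  positive.\<close>

lemma aperture_step_less_1:
  assumes s: "0 < s" "s < 1" and c: "11/10 \<le> c" and \<tau>: "0 < \<tau>"
    and pos: "0 < measure \<mu> (ball 0 (1/25))"
  shows "(stolz_power \<mu> s c)
    \<le> ennreal (\<tau> powr (- (1 - s) / s) * (240 * c / s)) * (stolz_power \<mu> s (11/10))
       + ennreal \<tau> * (stolz_power \<mu> s (5 * c))"
proof -
  let ?F = "\<lambda>c k \<xi>. measure \<mu> (stolz c \<xi> \<inter> core k)"
  let ?L = "\<lambda>c k \<xi>. measure \<mu> (stolz c \<xi> \<inter> annulus k)"
  let ?A = "\<lambda>c \<xi>. measure \<mu> (stolz c \<xi>)"
  let ?t = "\<tau> powr (- (1 - s) / s)"
  have Fpos: "0 < ?F c (Suc k) \<xi>" if "11/10 \<le> c" "cmod \<xi> = 1" for c k \<xi>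
  proof -
    \<comment> \<open>The radius 1/25 satisfies 26/25 < (11/10) (24/25), so this ball lies in every
      cone that occurs, whatever its unimodular vertex.\<close>
    have "ball 0 (1/25) \<subseteq> stolz c \<xi> \<inter> core (Suc k)"
    proof
      fix z :: complex assume "z \<in> ball 0 (1/25)"
      then have z: "cmod z < 1/25" by simp
      have "cmod (z - \<xi>) \<le> cmod z + 1" using norm_triangle_ineq4[of z \<xi>] that by simp
      also have "\<dots> < 11/10 * (1 - cmod z)" using z by simp
      also have "\<dots> \<le> c * (1 - cmod z)" using z that by (intro mult_right_mono) auto
      finally have "z \<in> stolz c \<xi>" unfolding stolz_def by simp
      moreover have "(1::real) / 2 ^ Suc k \<le> 1 / 2" by (simp add: field_simps)
      then have "1 / 2 ^ Suc k < 1 - cmod z" using z by linarith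
      ultimately show "z \<in> stolz c \<xi> \<inter> core (Suc k)" unfolding core_def by blast
    qed
    then have "measure \<mu> (ball 0 (1/25)) \<le> ?F c (Suc k) \<xi>" by (intro finite_measure_mono) auto
    then show ?thesis using pos by simp
  qed
  have key: "?F (5 * c) (Suc k) \<xi> powr (s - 1) \<le> ?F (11/10) (Suc k) \<eta> powr (s - 1)"
    if "z \<in> annulus k" "cmod \<eta> = 1" "z \<in> stolz c \<xi>" "z \<in> stolz (11/10) \<eta>" for k z \<xi> \<eta>
    using s c that by (intro powr_mono2' finite_measure_mono stolz_core_shift(2)[of z k c "11/10"] Fpos) auto
  have "(\<integral>\<^sup>+\<xi>. (\<Sum>k<n. ennreal (?F (5 * c) (Suc k) \<xi> powr (s - 1)) * emeasure \<mu> (stolz c \<xi> \<inter> annulus k)) \<partial>circle_measure)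
     = (\<Sum>k<n. \<integral>\<^sup>+\<xi>. ennreal (?F (5 * c) (Suc k) \<xi> powr (s - 1)) * emeasure \<mu> (stolz c \<xi> \<inter> annulus k) \<partial>circle_measure)"
    by (rule nn_integral_sum) measurable
  also have "\<dots> \<le> (\<Sum>k<n. ennreal (240 * c) * (\<integral>\<^sup>+\<xi>. ennreal (?F (11/10) (Suc k) \<xi> powr (s - 1)) * emeasure \<mu> (stolz (11/10) \<xi> \<inter> annulus k) \<partial>circle_measure))"
    using s c by (intro sum_mono mult_left_mono shadow_comparison) (auto intro: key annulus_subset_disc)
  also have "\<dots> = ennreal (240 * c) * (\<integral>\<^sup>+\<xi>. (\<Sum>k<n. ennreal (?F (11/10) (Suc k) \<xi> powr (s - 1)) * emeasure \<mu> (stolz (11/10) \<xi> \<inter> annulus k)) \<partial>circle_measure)"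
    by (subst nn_integral_sum) (auto simp: sum_distrib_left)
  also have "(\<integral>\<^sup>+\<xi>. (\<Sum>k<n. ennreal (?F (11/10) (Suc k) \<xi> powr (s - 1)) * emeasure \<mu> (stolz (11/10) \<xi> \<inter> annulus k)) \<partial>circle_measure)
      \<le> (\<integral>\<^sup>+\<xi>. ennreal (1 / s) * ennreal (?A (11/10) \<xi> powr s) \<partial>circle_measure)"
  proof (rule nn_integral_mono)
    fix \<xi>
    have "s * (\<Sum>k<n. ?F (11/10) (Suc k) \<xi> powr (s - 1) * ?L (11/10) k \<xi>) = (\<Sum>k<n. s * ?F (11/10) (Suc k) \<xi> powr (s - 1) * (?F (11/10) (Suc k) \<xi> - ?F (11/10) k \<xi>))"
      by (simp add: measure_stolz_core_Suc sum_distrib_left mult_ac)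
    also have "\<dots> \<le> (\<Sum>k<n. ?F (11/10) (Suc k) \<xi> powr s - ?F (11/10) k \<xi> powr s)"
      using s by (intro sum_mono powr_diff_ge) (auto simp: measure_stolz_core_Suc)
    also have "\<dots> = ?A (11/10) \<xi> powr s"
      unfolding measure_stolz_eq_core by (subst sum_lessThan_telescope) (simp add: core_0)
    finally have "(\<Sum>k<n. ?F (11/10) (Suc k) \<xi> powr (s - 1) * ?L (11/10) k \<xi>) \<le> 1 / s * ?A (11/10) \<xi> powr s"
      using s by (simp add: field_simps)
    then show "(\<Sum>k<n. ennreal (?F (11/10) (Suc k) \<xi> powr (s - 1)) * emeasure \<mu> (stolz (11/10) \<xi> \<inter> annulus k)) \<le> ennreal (1 / s) * ennreal (?A (11/10) \<xi> powr s)"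
      using s by (simp add: emeasure_eq_measure sum_nonneg ennreal_leI sum_ennreal flip: ennreal_mult)
  qed
  also have "\<dots> = ennreal (1 / s) * (stolz_power \<mu> s (11/10))"
    by (rule nn_integral_cmult) measurable
  finally have 1: "(\<integral>\<^sup>+\<xi>. (\<Sum>k<n. ennreal (?F (5 * c) (Suc k) \<xi> powr (s - 1)) * emeasure \<mu> (stolz c \<xi> \<inter> annulus k)) \<partial>circle_measure)
     \<le> ennreal (240 * c) * (ennreal (1 / s) * (stolz_power \<mu> s (11/10)))"
    by (simp add: mult_left_mono)
  have "(stolz_power \<mu> s c) \<le>
    (\<integral>\<^sup>+\<xi>. ennreal \<tau> * ennreal (?A (5 * c) \<xi> powr s) + ennreal ?t * (\<Sum>k<n. ennreal (?F (5 * c) (Suc k) \<xi> powr (s - 1)) * emeasure \<mu> (stolz c \<xi> \<inter> annulus k)) \<partial>circle_measure)"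
  proof (rule nn_integral_circle_mono)
    fix \<xi> :: complex assume \<xi>: "cmod \<xi> = 1"
    have Fle: "?F (5 * c) k \<xi> \<le> ?A (5 * c) \<xi>" for k by (intro finite_measure_mono) auto
    then have Apos: "0 < ?A (5 * c) \<xi>" using Fpos[of "5 * c" \<xi> 0] \<xi> c Fle[of "Suc 0"] by linarith
    have "?A c \<xi> * ?A (5 * c) \<xi> powr (s - 1) = (\<Sum>k<n. ?A (5 * c) \<xi> powr (s - 1) * ?L c k \<xi>)"
      unfolding measure_stolz_eq_core[of c] measure_stolz_core_sum by (simp add: sum_distrib_left sum_distrib_right mult_ac)
    also have "\<dots> \<le> (\<Sum>k<n. ?F (5 * c) (Suc k) \<xi> powr (s - 1) * ?L c k \<xi>)"
      using s c \<xi> by (intro sum_mono mult_right_mono powr_mono2' Fpos Fle) auto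
    finally have "?t * (?A c \<xi> * ?A (5 * c) \<xi> powr (s - 1)) \<le> ?t * (\<Sum>k<n. ?F (5 * c) (Suc k) \<xi> powr (s - 1) * ?L c k \<xi>)"
      by (intro mult_left_mono) auto
    moreover have "?A c \<xi> powr s \<le> \<tau> * ?A (5 * c) \<xi> powr s + ?t * (?A c \<xi> * ?A (5 * c) \<xi> powr (s - 1))"
      using s Apos \<tau> by (intro young_le_1) auto
    ultimately have "?A c \<xi> powr s \<le> \<tau> * ?A (5 * c) \<xi> powr s + ?t * (\<Sum>k<n. ?F (5 * c) (Suc k) \<xi> powr (s - 1) * ?L c k \<xi>)"
      by linarith
    then show "ennreal (?A c \<xi> powr s) \<le> ennreal \<tau> * ennreal (?A (5 * c) \<xi> powr s) + ennreal ?t * (\<Sum>k<n. ennreal (?F (5 * c) (Suc k) \<xi> powr (s - 1)) * emeasure \<mu> (stolz c \<xi> \<inter> annulus k))"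
      using \<tau> by (simp add: emeasure_eq_measure sum_nonneg ennreal_leI sum_ennreal flip: ennreal_mult ennreal_plus)
  qed
  also have "\<dots> = ennreal \<tau> * (stolz_power \<mu> s (5 * c))
      + ennreal ?t * (\<integral>\<^sup>+\<xi>. (\<Sum>k<n. ennreal (?F (5 * c) (Suc k) \<xi> powr (s - 1)) * emeasure \<mu> (stolz c \<xi> \<inter> annulus k)) \<partial>circle_measure)"
    by (subst nn_integral_add, measurable, subst (1 2) nn_integral_cmult) auto
  also have "\<dots> \<le> ennreal \<tau> * (stolz_power \<mu> s (5 * c))
      + ennreal ?t * (ennreal (240 * c) * (ennreal (1 / s) * (stolz_power \<mu> s (11/10))))"
    by (intro add_left_mono mult_left_mono 1) auto
  also have "ennreal ?t * (ennreal (240 * c) * (ennreal (1 / s) * (stolz_power \<mu> s (11/10))))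
      = ennreal (?t * (240 * c / s)) * (stolz_power \<mu> s (11/10))"
    using s c by (simp add: mult.assoc[symmetric] flip: ennreal_mult)
  finally show ?thesis by (simp only: add.commute)
qed

end

end

context
  fixes \<mu> :: "complex measure" and n :: nat
  assumes fin: "finite_measure \<mu>" and sets_mu [simp, measurable_cong]: "sets \<mu> = sets borel"
    and supp: "emeasure \<mu> (- core n) = 0"
begin

interpretation finite_measure \<mu> by (rule fin)

text \<open>One inequality for both ranges of s, so that the iteration need not distinguish them: P
  dominates 240 s and 240/s, m dominates s - 1 and (1 - s)/s, and \<tau> <= 1 permits enlarging the
  exponent of 1/\<tau>.\<close>

lemma aperture_step:
  assumes s: "0 < s" and c: "11/10 \<le> c" and \<tau>: "0 < \<tau>" and pos: "0 < measure \<mu> (ball 0 (1/25))"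
    and P: "P = 240 * s + 240 / s" and m: "m = \<bar>s - 1\<bar> + \<bar>s - 1\<bar> / s"
    and \<tau>1: "\<tau> \<le> 1"
  shows "(stolz_power \<mu> s c)
    \<le> ennreal (P * c * \<tau> powr (- m)) * (stolz_power \<mu> s (11/10))
       + ennreal (P * c * \<tau>) * (stolz_power \<mu> s (5 * c))"
proof (cases "1 \<le> s")
  case True
  have a: "240 * s * c \<le> P * c" unfolding P using s c by (intro mult_right_mono) auto
  have "\<tau> powr (1 - s) \<le> \<tau> powr (- m)"
    using \<tau> \<tau>1 True unfolding m by (intro powr_mono') auto
  then have b: "240 * s * c * \<tau> powr (1 - s) \<le> P * c * \<tau> powr (- m)"
    using a s c by (intro mult_mono) auto
  have d: "240 * s * c * \<tau> \<le> P * c * \<tau>" using mult_right_mono[OF a, of \<tau>] \<tau> by simp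
  show ?thesis
    apply (rule order_trans[OF aperture_step_ge_1[OF fin sets_mu supp True c \<tau>]])
    using s c \<tau> unfolding distrib_left mult.assoc[symmetric] 
    by (intro add_mono mult_right_mono) (use b d in \<open>auto simp flip: ennreal_mult intro!: ennreal_leI\<close>)
next
  case False
  then have s1: "s < 1" by simp
  have "- m \<le> - (1 - s) / s" using s s1 unfolding m by (simp add: field_simps)
  then have "\<tau> powr (- (1 - s) / s) \<le> \<tau> powr (- m)"
    using \<tau> \<tau>1 by (intro powr_mono') auto
  moreover have "240 * c / s \<le> P * c" unfolding P using s c by (simp add: field_simps)
  ultimately have b: "\<tau> powr (- (1 - s) / s) * (240 * c / s) \<le> \<tau> powr (- m) * (P * c)"
    using s c by (intro mult_mono) auto
  have "1 \<le> 240 / s" "0 < 240 * s" using s s1 by simp_all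
  then have "1 \<le> P" unfolding P by linarith
  then have "1 * 1 \<le> P * c" using c by (intro mult_mono) auto
  then have d: "\<tau> \<le> P * c * \<tau>" using \<tau> by (simp add: mult_le_cancel_right1)
  show ?thesis
    apply (rule order_trans[OF aperture_step_less_1[OF fin sets_mu supp s s1 c \<tau> pos]])
    by (intro add_mono mult_right_mono) (use b d in \<open>auto simp: mult_ac intro!: ennreal_leI\<close>)
qed

text \<open>The step is applied at the apertures c 5^j. Its parameter has to shrink like 5^(-j) to
  offset the factor c 5^j, and its negative power then grows like 5^(m j). Together with c 5^j this
  is the growth E^j for E = 5^(1+m), and \<kappa> = 1/(2E) is the contraction that
  \<open>contraction_iterate\<close> asks for.\<close>

lemma aperture_change_finite_aux:
  assumes s: "0 < s" and c: "11/10 \<le> c" and pos: "0 < measure \<mu> (ball 0 (1/25))"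
    and P: "P = 240 * s + 240 / s" and m: "m = \<bar>s - 1\<bar> + \<bar>s - 1\<bar> / s" 
    and \<kappa>: "\<kappa> = 1 / (2 * 5 powr (1 + m))"
  shows "(stolz_power \<mu> s c)
    \<le> ennreal (2 * (P * c * (P * c / \<kappa>) powr m)) * (stolz_power \<mu> s (11/10))"
proof -
  define N where "N c = (stolz_power \<mu> s c)" for c
  define Mb where "Mb = measure \<mu> (space \<mu>) powr s * (2 * pi)"
  \<comment> \<open>A bound independent of the aperture, because \<mu> and arc length are finite. It
    serves only as the a priori bound of the iteration and does not enter the final
    constant.\<close>
  have N: "N c \<le> ennreal Mb" for c
  proof -
    have "N c \<le> (\<integral>\<^sup>+\<xi>. ennreal (measure \<mu> (space \<mu>) powr s) \<partial>circle_measure)"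
      unfolding N_def using s by (intro nn_integral_mono ennreal_leI powr_mono2 bounded_measure) auto
    also have "\<dots> = ennreal Mb" unfolding Mb_def by (simp add: emeasure_circle_UNIV ennreal_mult)
    finally show ?thesis .
  qed
  define \<nu> where "\<nu> j = enn2real (N (c * 5 ^ j))" for j
  define a where "a = enn2real (N (11/10))"
  have Nr: "N c = ennreal (enn2real (N c))" for c
    using le_less_trans[OF N[of c] ennreal_less_top] by (simp add: less_top)
  have m0: "0 \<le> m" unfolding m using s by simp
  define E where "E = (5::real) powr (1 + m)"
  have E1: "1 \<le> E" unfolding E_def using m0 by (intro ge_one_powr_ge_zero) auto
  have \<kappa>': "0 < \<kappa>" "\<kappa> \<le> 1" "\<kappa> = 1 / (2 * E)" unfolding \<kappa> using E1 unfolding E_def by auto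
  have Pc1: "1 \<le> P * c"
  proof -
    have "1 \<le> 240 * s + 240 / s"
    proof (cases "1 \<le> s")
      case False
      then have "1 \<le> 240 / s" using s by simp
      moreover have "0 < 240 * s" using s by simp
      ultimately show ?thesis by linarith
    qed (use s in \<open>simp add: add_increasing2\<close>)
    then have "1 * 1 \<le> P * c" unfolding P using s c by (intro mult_mono) auto
    then show ?thesis by simp
  qed
  define Q where "Q = P * c * (P * c / \<kappa>) powr m * a"
  have "\<nu> 0 \<le> 2 * Q"
  proof (rule contraction_iterate)
    fix j
    \<comment> \<open>Chosen so that P (c 5^j) \<tau> = \<kappa> for every j.\<close>
    define \<tau> where "\<tau> = \<kappa> / (P * c) / 5 ^ j"
    have 5: "(1::real) \<le> 5 ^ j" by simp
    have "\<kappa> \<le> P * c" using \<kappa>'(2) Pc1 by linarith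
    then have "\<kappa> / (P * c) \<le> 1" using Pc1 by (subst divide_le_eq_1_pos) auto
    then have "\<tau> \<le> 1 / 5 ^ j" unfolding \<tau>_def by (intro divide_right_mono) simp_all
    also have "1 / 5 ^ j \<le> (1::real)" using 5 by simp
    finally have \<tau>: "0 < \<tau>" "\<tau> \<le> 1" using \<kappa>'(1) Pc1 unfolding \<tau>_def by simp_all
    have "c * 1 \<le> c * 5 ^ j" using c by (intro mult_left_mono) auto
    then have cj: "11/10 \<le> c * 5 ^ j" using c by linarith
    have "N (c * 5 ^ j) \<le> ennreal (P * (c * 5 ^ j) * \<tau> powr (- m)) * N (11/10) + ennreal (P * (c * 5 ^ j) * \<tau>) * N (5 * (c * 5 ^ j))"
      unfolding N_def by (rule aperture_step[OF s cj \<tau>(1) pos P m \<tau>(2)])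
    then have "ennreal (\<nu> j) \<le> ennreal (P * (c * 5 ^ j) * \<tau> powr (- m)) * ennreal a + ennreal (P * (c * 5 ^ j) * \<tau>) * ennreal (\<nu> (Suc j))"
      unfolding \<nu>_def a_def Nr[symmetric] by (simp add: mult_ac)
    also have "\<dots> = ennreal (P * (c * 5 ^ j) * \<tau> powr (- m) * a + P * (c * 5 ^ j) * \<tau> * \<nu> (Suc j))"
      using Pc1 \<tau> unfolding \<nu>_def a_def
      by (subst (1 2) ennreal_mult[symmetric]) (auto simp: mult.assoc[symmetric] simp flip: ennreal_plus)
    finally have "\<nu> j \<le> P * (c * 5 ^ j) * \<tau> powr (- m) * a + P * (c * 5 ^ j) * \<tau> * \<nu> (Suc j)"
      using Pc1 \<tau> by (subst (asm) ennreal_le_iff) (auto simp: \<nu>_def a_def mult.assoc[symmetric])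
    also have "P * (c * 5 ^ j) * \<tau> = \<kappa>" unfolding \<tau>_def using Pc1 by auto
    also have "\<tau> powr (- m) = (P * c / \<kappa>) powr m * 5 powr (m * j)"
    proof -
      have "\<tau> powr (- m) = (1 / \<tau>) powr m" using \<tau> by (simp add: powr_minus_divide powr_divide)
      also have "1 / \<tau> = (P * c / \<kappa>) * 5 ^ j" unfolding \<tau>_def by simp
      also have "\<dots> powr m = (P * c / \<kappa>) powr m * (5 ^ j) powr m"
        by (rule powr_mult)
      also have "(5 ^ j) powr m = (5::real) powr (m * j)" by (simp add: powr_realpow[symmetric] powr_powr mult.commute)
      finally show ?thesis .
    qed
    also have "P * (c * 5 ^ j) * ((P * c / \<kappa>) powr m * 5 powr (m * j)) * a = Q * (5 ^ j * 5 powr (m * j))"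
      unfolding Q_def by (simp add: mult_ac)
    also have "5 ^ j * (5::real) powr (m * j) = E ^ j"
      unfolding E_def by (simp add: powr_realpow[symmetric] powr_powr powr_add[symmetric] algebra_simps)
    finally show "\<nu> j \<le> Q * E ^ j + \<nu> (Suc j) / (2 * E)" unfolding \<kappa>'(3) by simp
  next
    fix j
    show "\<nu> j \<le> Mb" unfolding \<nu>_def using N[of "c * 5 ^ j"] by (intro enn2real_leI) (auto simp: Mb_def)
  qed (use E1 Pc1 in \<open>auto simp: Q_def a_def\<close>)
  then have "N c \<le> ennreal (2 * Q)" by (subst Nr) (auto simp: \<nu>_def intro!: ennreal_leI)
  also have "\<dots> = ennreal (2 * (P * c * (P * c / \<kappa>) powr m)) * N (11/10)"
  proof -
    have "N (11/10) = ennreal a" unfolding a_def by (rule Nr)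
    moreover have "0 \<le> a" unfolding a_def by simp
    moreover have "2 * Q = 2 * (P * c * (P * c / \<kappa>) powr m) * a" unfolding Q_def by simp
    moreover have "0 \<le> 2 * (P * c * (P * c / \<kappa>) powr m)" using Pc1 by simp
    ultimately show ?thesis by (simp only: ennreal_mult)
  qed
  finally show ?thesis unfolding N_def .
qed

end

text \<open>The constant is obtained before \<mu> and the cut-off n: it depends on s and c alone,
  which is what makes the limit over n in \<open>aperture_change\<close> possible.\<close>

lemma aperture_change_finite:
  assumes "0 < s" "11/10 \<le> c"
  obtains C where "0 < C" "\<And>\<mu> n. finite_measure \<mu> \<Longrightarrow> sets \<mu> = sets borel \<Longrightarrow> emeasure \<mu> (- core n) = 0 \<Longrightarrow>
    0 < measure \<mu> (ball 0 (1/25)) \<Longrightarrow>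
    (stolz_power \<mu> s c)
    \<le> ennreal C * (stolz_power \<mu> s (11/10))"
proof -
  define P m where "P = 240 * s + 240 / s" and "m = \<bar>s - 1\<bar> + \<bar>s - 1\<bar> / s"
  define \<kappa> where "\<kappa> = 1 / (2 * 5 powr (1 + m))"
  have "0 < P" unfolding P_def using assms by (simp add: add_pos_pos)
  then have "0 < 2 * (P * c * (P * c / \<kappa>) powr m)" using assms unfolding \<kappa>_def by simp
  then show ?thesis
    using that aperture_change_finite_aux[OF _ _ _ assms _ P_def m_def \<kappa>_def] by blast
qed

section \<open>From finite measures to weights on the disc\<close>

definition cone_int :: "real \<Rightarrow> (complex \<Rightarrow> ennreal) \<Rightarrow> complex \<Rightarrow> ennreal" where
  "cone_int c w \<xi> = (\<integral>\<^sup>+z. w z * indicator (stolz c \<xi>) z \<partial>lborel)"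

abbreviation cone_power :: "real \<Rightarrow> real \<Rightarrow> (complex \<Rightarrow> ennreal) \<Rightarrow> ennreal" where
  "cone_power s c w \<equiv> (\<integral>\<^sup>+\<xi>. enn_powr (cone_int c w \<xi>) s \<partial>circle_measure)"

abbreviation tent_power :: "real \<Rightarrow> (complex \<Rightarrow> complex set) \<Rightarrow> (complex \<Rightarrow> ennreal) \<Rightarrow> ennreal" where
  "tent_power s T w \<equiv> (\<integral>\<^sup>+\<xi>. enn_powr (\<integral>\<^sup>+z. w z * indicator (T \<xi>) z \<partial>lborel) s \<partial>circle_measure)"

lemma cone_int_measurable [measurable]:
  assumes [measurable]: "w \<in> borel_measurable borel"
  shows "cone_int c w \<in> borel_measurable borel"
proof -
  have [measurable]: "(\<lambda>x. w (snd x) * indicator (stolz c (fst x)) (snd x)) \<in> borel_measurable (borel \<Otimes>\<^sub>M lborel)"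
  proof -
    have "(\<lambda>x. w (snd x) * indicator {x. snd x \<in> stolz c (fst x)} x) \<in> borel_measurable (borel \<Otimes>\<^sub>M lborel)"
      by measurable
    then show ?thesis by (simp add: indicator_def)
  qed
  have "(\<lambda>\<xi>. \<integral>\<^sup>+z. w z * indicator (stolz c \<xi>) z \<partial>lborel) \<in> borel_measurable borel"
    by (rule lborel.borel_measurable_nn_integral) (simp add: case_prod_beta)
  then show ?thesis unfolding cone_int_def[abs_def] .
qed

lemma cone_int_mono:
  assumes "\<And>z. z \<in> stolz c \<xi> \<Longrightarrow> w z \<le> w' z" "stolz c \<xi> \<subseteq> stolz c' \<xi>"
  shows "cone_int c w \<xi> \<le> cone_int c' w' \<xi>"
  unfolding cone_int_def using assms
  by (intro nn_integral_mono) (auto split: split_indicator)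

lemma incseq_core: "incseq core"
  by (rule incseq_SucI) (auto simp: core_Suc)

lemma UN_core: "ball 0 1 = (\<Union>n. core n)"
proof (intro set_eqI iffI)
  fix z :: complex assume "z \<in> ball 0 1"
  then have "0 < 1 - cmod z" by simp
  then obtain n where "(1/2) ^ n < 1 - cmod z" using real_arch_pow_inv[of "1 - cmod z" "1/2"] by auto
  then show "z \<in> (\<Union>n. core n)" unfolding core_def by (auto simp: power_divide)
next
  fix z :: complex assume "z \<in> (\<Union>n. core n)"
  then obtain n where "1 / 2 ^ n < 1 - cmod z" unfolding core_def by auto
  moreover have "(0::real) < 1 / 2 ^ n" by simp
  ultimately show "z \<in> ball 0 1" by (simp only: mem_ball_0)
qed

text \<open>The cut-offs start with \<open>core 1\<close>, the disc of radius 1/2, since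
  \<open>core 0\<close> is empty and every cut-off weight has to keep the mass near 0.\<close>

lemma cone_int_SUP_core:
  assumes [measurable]: "w \<in> borel_measurable borel" and c: "0 < c"
  shows "cone_int c w \<xi> = (SUP n. cone_int c (\<lambda>z. w z * indicator (core (Suc n)) z) \<xi>)"
proof -
  let ?f = "\<lambda>n z. w z * indicator (core (Suc n)) z * indicator (stolz c \<xi>) z"
  have inc: "incseq ?f"
    by (rule incseq_SucI) (auto simp: le_fun_def core_Suc[of "Suc _"] split: split_indicator)
  have sup: "w z * indicator (stolz c \<xi>) z = (SUP n. ?f n z)" for z
  proof (rule antisym)
    show "w z * indicator (stolz c \<xi>) z \<le> (SUP n. ?f n z)"
    proof (cases "z \<in> stolz c \<xi>")
      case True
      then obtain n where "z \<in> core n" using stolz_subset_disc[OF c] UN_core by blast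
      then have "z \<in> core (Suc n)" using incseq_core by (auto simp: core_Suc)
      then show ?thesis using True by (intro SUP_upper2[of n]) auto
    qed simp
    show "(SUP n. ?f n z) \<le> w z * indicator (stolz c \<xi>) z"
      by (intro SUP_least) (auto split: split_indicator)
  qed
  show ?thesis unfolding cone_int_def sup
    by (rule nn_integral_monotone_convergence_SUP[OF inc]) simp
qed

text \<open>The finite case is applied to the measures with density w cut off to
  \<open>core (Suc n)\<close>, which are finite by the hypothesis on w; the uniform constant
  survives the monotone limit on both levels of integration.\<close>

lemma aperture_change:
  assumes s: "0 < s" and c: "11/10 \<le> c"
  obtains C :: real where "0 < C" "\<And>w. w \<in> borel_measurable borel \<Longrightarrow>
    (\<And>n. (\<integral>\<^sup>+z. w z * indicator (core n) z \<partial>lborel) < \<infinity>) \<Longrightarrow>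
    0 < (\<integral>\<^sup>+z. w z * indicator (ball 0 (1/25)) z \<partial>lborel) \<Longrightarrow>
    (cone_power s c w)
    \<le> ennreal C * (cone_power s (11/10) w)"
proof -
  obtain C where C: "0 < C" "\<And>\<mu> n. finite_measure \<mu> \<Longrightarrow> sets \<mu> = sets borel \<Longrightarrow> emeasure \<mu> (- core n) = 0 \<Longrightarrow>
    0 < measure \<mu> (ball 0 (1/25)) \<Longrightarrow>
    (stolz_power \<mu> s c)
    \<le> ennreal C * (stolz_power \<mu> s (11/10))"
    using aperture_change_finite[OF s c] by blast
  show ?thesis
  proof (rule that[OF C(1)])
    fix w :: "complex \<Rightarrow> ennreal"
    assume [measurable]: "w \<in> borel_measurable borel"
      and finw: "\<And>n. (\<integral>\<^sup>+z. w z * indicator (core n) z \<partial>lborel) < \<infinity>"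
      and pos: "0 < (\<integral>\<^sup>+z. w z * indicator (ball 0 (1/25)) z \<partial>lborel)"
    define wn where "wn n = (\<lambda>z. w z * indicator (core (Suc n)) z)" for n
    have [measurable]: "wn n \<in> borel_measurable borel" for n unfolding wn_def by measurable
    have step: "(cone_power s c (wn n))
      \<le> ennreal C * (cone_power s (11/10) (wn n))" for n
    proof -
      define \<mu> where "\<mu> = density lborel (wn n)"
      have em: "emeasure \<mu> A = (\<integral>\<^sup>+z. wn n z * indicator A z \<partial>lborel)" if "A \<in> sets borel" for A
        unfolding \<mu>_def using that by (subst emeasure_density) auto
      have fin: "finite_measure \<mu>"
      proof (rule finite_measureI)
        have "emeasure \<mu> (space \<mu>) = (\<integral>\<^sup>+z. wn n z * indicator UNIV z \<partial>lborel)"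
          by (subst em[symmetric]) (simp_all add: \<mu>_def)
        also have "\<dots> < \<infinity>" unfolding wn_def using finw[of "Suc n"] by simp
        finally show "emeasure \<mu> (space \<mu>) \<noteq> \<infinity>" by simp
      qed
      interpret finite_measure \<mu> by (rule fin)
      have sets: "sets \<mu> = sets borel" unfolding \<mu>_def by simp
      have "emeasure \<mu> (- core (Suc n)) = (\<integral>\<^sup>+z. wn n z * indicator (- core (Suc n)) z \<partial>lborel)"
        by (rule em) simp
      also have "\<dots> = (\<integral>\<^sup>+z. 0 \<partial>(lborel :: complex measure))"
        by (intro nn_integral_cong) (auto simp: wn_def split: split_indicator)
      finally have supp: "emeasure \<mu> (- core (Suc n)) = 0" by simp
      have "emeasure \<mu> (ball 0 (1/25)) = (\<integral>\<^sup>+z. w z * indicator (ball 0 (1/25)) z \<partial>lborel)"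
      proof (rule trans[OF em nn_integral_cong])
        fix z :: complex
        have "(1::real) / 2 ^ Suc n \<le> 1 / 2" by (simp add: field_simps)
        then have "z \<in> core (Suc n)" if "z \<in> ball 0 (1/25)" using that unfolding core_def mem_ball_0 mem_Collect_eq by linarith
        then show "wn n z * indicator (ball 0 (1/25)) z = w z * indicator (ball 0 (1/25)) z"
          unfolding wn_def by (auto split: split_indicator)
      qed simp
      then have "0 < ennreal (measure \<mu> (ball 0 (1/25)))" using pos by (simp only: emeasure_eq_measure)
      then have "0 < measure \<mu> (ball 0 (1/25))" by simp
      then have "(stolz_power \<mu> s c)
        \<le> ennreal C * (stolz_power \<mu> s (11/10))"
        by (rule C(2)[OF fin sets supp])
      moreover have "enn_powr (cone_int c (wn n) \<xi>) s = ennreal (measure \<mu> (stolz c \<xi>) powr s)" for c \<xi>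
        unfolding cone_int_def by (subst em[symmetric]) (simp_all add: emeasure_eq_measure enn_powr_ennreal)
      ultimately show ?thesis by simp
    qed
    have mono: "cone_int c (wn n) \<xi> \<le> cone_int c w \<xi>" for c n \<xi>
      by (rule cone_int_mono) (auto simp: wn_def split: split_indicator)
    have inc: "incseq (\<lambda>n. cone_int c (wn n) \<xi>)" for \<xi>
      by (rule incseq_SucI, rule cone_int_mono) (auto simp: wn_def core_Suc split: split_indicator)
    have "(cone_power s c w) = (\<integral>\<^sup>+\<xi>. (SUP n. enn_powr (cone_int c (wn n) \<xi>) s) \<partial>circle_measure)"
      using c cone_int_SUP_core[of w c] enn_powr_SUP[OF inc s] unfolding wn_def by simp
    also have "\<dots> = (SUP n. \<integral>\<^sup>+\<xi>. enn_powr (cone_int c (wn n) \<xi>) s \<partial>circle_measure)"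
    proof (rule nn_integral_monotone_convergence_SUP)
      show "incseq (\<lambda>n \<xi>. enn_powr (cone_int c (wn n) \<xi>) s)"
        using inc s by (auto simp: incseq_def le_fun_def intro!: enn_powr_mono)
    qed measurable
    also have "\<dots> \<le> ennreal C * (cone_power s (11/10) w)"
      using s by (intro SUP_least order_trans[OF step] mult_left_mono nn_integral_mono enn_powr_mono mono) auto
    finally show "(cone_power s c w)
      \<le> ennreal C * (cone_power s (11/10) w)" .
  qed
qed

section \<open>A compactness estimate for holomorphic functions\<close>

lemma emeasure_ball_complex: "0 \<le> r \<Longrightarrow> emeasure lborel (ball (z::complex) r) = ennreal (pi * r\<^sup>2)"
  by (subst emeasure_ball) (simp_all add: unit_ball_vol_2)

lemma nn_integral_lborel_translate:
  fixes a :: "'a :: euclidean_space"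
  assumes [measurable]: "F \<in> borel_measurable borel"
  shows "(\<integral>\<^sup>+x. F (a + x) \<partial>lborel) = (\<integral>\<^sup>+x. F x \<partial>lborel)"
proof -
  have "(\<integral>\<^sup>+x. F x \<partial>lborel) = (\<integral>\<^sup>+x. F x \<partial>distr lborel borel ((+) a))" by (simp add: lborel_distr_plus)
  also have "\<dots> = (\<integral>\<^sup>+x. F (a + x) \<partial>lborel)" by (rule nn_integral_distr) measurable
  finally show ?thesis by simp
qed

lemma continuous_on_indicator_measurable:
  fixes f :: "complex \<Rightarrow> complex"
  assumes "continuous_on S f" "open S"
  shows "(\<lambda>z. f z * indicator S z) \<in> borel_measurable borel"
  using borel_measurable_continuous_on_indicator[of S f] assms
  by (simp add: indicator_scaleR_eq_if indicator_times_eq_if(2) if_distrib cong: if_cong)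

text \<open>Cauchy's formula for the value at z is used on a circle whose centre a is only near z:
  the circle of radius \<rho>/2 about a stays at distance at least \<rho>/4 from z, which bounds the
  kernel by 2. Moving the centre takes the place of polar coordinates in the area mean.\<close>

lemma circle_mean_bound:
  assumes f: "f holomorphic_on ball z \<rho>" and \<rho>: "0 < \<rho>" and a: "a \<in> ball z (\<rho>/4)"
  shows "ennreal (pi * cmod (f z)) \<le> (\<integral>\<^sup>+t. ennreal (cmod (f (a + of_real (\<rho>/2) * cis t))) * indicator {0..2*pi} t \<partial>lborel)"
proof -
  have az: "cmod (z - a) < \<rho>/4" using a by (simp add: dist_norm)
  have sub: "cball a (\<rho>/2) \<subseteq> ball z \<rho>"
  proof
    fix w assume "w \<in> cball a (\<rho>/2)"
    then have "dist a w \<le> \<rho>/2" by simp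
    then have "dist z w < \<rho>" using dist_triangle[of z w a] a \<rho> by simp
    then show "w \<in> ball z \<rho>" by simp
  qed
  define c where "c t = a + of_real (\<rho>/2) * cis t" for t
  have c_in: "c t \<in> cball a (\<rho>/2)" for t unfolding c_def using \<rho> by (simp add: dist_norm norm_mult)
  define g where "g t = f (c t) / (c t - z) * of_real (\<rho>/2) * \<i> * cis t" for t
  have "((\<lambda>u. f u / (u - z)) has_contour_integral (2 * of_real pi * \<i> * f z)) (circlepath a (\<rho>/2))"
    using holomorphic_on_subset[OF f sub] az \<rho> by (intro Cauchy_integral_circlepath_simple) auto
  then have "(g has_integral (2 * of_real pi * \<i> * f z)) {0..2*pi}"
    unfolding circlepath_def using has_contour_integral_part_circlepath_iff[of 0 "2*pi" "\<lambda>u. f u / (u - z)" "2 * of_real pi * \<i> * f z" a "\<rho>/2"]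
    by (simp add: g_def[abs_def] c_def)
  moreover have cont: "continuous_on {0..2*pi} (\<lambda>t. cmod (f (c t)))"
    using c_in sub unfolding c_def
    by (intro continuous_intros continuous_on_compose2[OF holomorphic_on_imp_continuous_on[OF f]]) auto
  then have int: "(\<lambda>t. 2 * cmod (f (c t))) integrable_on {0..2*pi}" 
    by (intro integrable_continuous_real continuous_on_mult continuous_on_const cont)
  moreover have "cmod (g t) \<le> 2 * cmod (f (c t))" for t
  proof -
    have "\<rho>/2 = cmod (c t - a)" unfolding c_def using \<rho> by (simp add: norm_mult)
    also have "\<dots> \<le> cmod (c t - z) + cmod (z - a)" using norm_triangle_ineq[of "c t - z" "z - a"] by simp
    finally have "\<rho>/4 \<le> cmod (c t - z)" using az by simp
    then have "(\<rho>/2) / cmod (c t - z) \<le> (\<rho>/2) / (\<rho>/4)" using \<rho> by (intro divide_left_mono mult_pos_pos) auto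
    then have "cmod (f (c t)) * ((\<rho>/2) / cmod (c t - z)) \<le> cmod (f (c t)) * 2" using \<rho> by (intro mult_left_mono) auto
    moreover have "cmod (g t) = cmod (f (c t)) * ((\<rho>/2) / cmod (c t - z))"
      unfolding g_def norm_mult norm_divide norm_of_real norm_cis norm_ii using \<rho> by simp
    ultimately show ?thesis by (simp add: mult.commute)
  qed
  ultimately have "cmod (2 * of_real pi * \<i> * f z) \<le> integral {0..2*pi} (\<lambda>t. 2 * cmod (f (c t)))"
    by (intro order_trans[OF eq_refl integral_norm_bound_integral[of g]]) (auto simp: integral_unique has_integral_integrable)
  also have "\<dots> = 2 * integral {0..2*pi} (\<lambda>t. cmod (f (c t)))" by simp
  finally have "pi * cmod (f z) \<le> integral {0..2*pi} (\<lambda>t. cmod (f (c t)))" by (simp add: norm_mult)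
  moreover have "(\<integral>\<^sup>+t. ennreal (cmod (f (c t))) * indicator {0..2*pi} t \<partial>lborel) = ennreal (integral {0..2*pi} (\<lambda>t. cmod (f (c t))))"
    by (intro nn_integral_has_integral_lebesgue' integrable_integral integrable_continuous_real cont) simp
  ultimately show ?thesis unfolding c_def by (simp add: ennreal_leI)
qed

text \<open>The circle bound is integrated over the centres a. For a fixed angle t the point a +
  (\<rho>/2) cis t is a translate of a, so after Fubini the integral over all a is the full area
  integral, whatever t is.\<close>

lemma norm_le_area_mean:
  assumes f: "f holomorphic_on ball z \<rho>" and \<rho>: "0 < \<rho>"
  shows "ennreal (pi * (\<rho>/4)\<^sup>2 * cmod (f z)) \<le> 2 * (\<integral>\<^sup>+w. ennreal (cmod (f w)) * indicator (ball z \<rho>) w \<partial>lborel)"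
proof -
  define F where "F w = ennreal (cmod (f w * indicator (ball z \<rho>) w))" for w
  have [measurable]: "F \<in> borel_measurable borel"
    unfolding F_def using continuous_on_indicator_measurable[OF holomorphic_on_imp_continuous_on[OF f]]
    by measurable
  have F: "F w = ennreal (cmod (f w)) * indicator (ball z \<rho>) w" for w unfolding F_def by (simp split: split_indicator)
  let ?B = "ball z (\<rho>/4)"
  have le: "ennreal (pi * cmod (f z)) * indicator ?B a \<le> (\<integral>\<^sup>+t. F (a + of_real (\<rho>/2) * cis t) * indicator {0..2*pi} t \<partial>lborel)" for a
  proof (cases "a \<in> ?B")
    case True
    have "a + of_real (\<rho>/2) * cis t \<in> ball z \<rho>" for t
    proof -
      have "dist a (a + of_real (\<rho>/2) * cis t) = \<rho>/2" using \<rho> by (simp add: dist_norm norm_mult)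
      then show ?thesis using True \<rho> dist_triangle[of z "a + of_real (\<rho>/2) * cis t" a] by simp
    qed
    then show ?thesis using circle_mean_bound[OF f \<rho> True] True unfolding F by simp
  qed simp
  have "ennreal (pi * cmod (f z)) * ennreal (pi * (\<rho>/4)\<^sup>2) = (\<integral>\<^sup>+a. ennreal (pi * cmod (f z)) * indicator ?B a \<partial>lborel)"
    using \<rho> by (subst nn_integral_cmult_indicator) (simp_all add: emeasure_ball_complex)
  also have "\<dots> \<le> (\<integral>\<^sup>+a. \<integral>\<^sup>+t. F (a + of_real (\<rho>/2) * cis t) * indicator {0..2*pi} t \<partial>lborel \<partial>lborel)"
    by (intro nn_integral_mono le)
  also have "\<dots> = (\<integral>\<^sup>+t. \<integral>\<^sup>+a. F (a + of_real (\<rho>/2) * cis t) * indicator {0..2*pi} t \<partial>lborel \<partial>lborel)"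
    by (rule lborel_pair.Fubini') measurable
  also have "\<dots> = (\<integral>\<^sup>+t. (\<integral>\<^sup>+a. F a \<partial>lborel) * indicator {0..2*pi} t \<partial>lborel)"
  proof (intro nn_integral_cong)
    fix t :: real
    have "(\<integral>\<^sup>+a. F (a + of_real (\<rho>/2) * cis t) * indicator {0..2*pi} t \<partial>lborel) = (\<integral>\<^sup>+a. F (of_real (\<rho>/2) * cis t + a) \<partial>lborel) * indicator {0..2*pi} t"
      by (subst nn_integral_multc[symmetric]) (simp_all add: add.commute)
    then show "(\<integral>\<^sup>+a. F (a + of_real (\<rho>/2) * cis t) * indicator {0..2*pi} t \<partial>lborel) = (\<integral>\<^sup>+a. F a \<partial>lborel) * indicator {0..2*pi} t"
      by (simp add: nn_integral_lborel_translate)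
  qed
  also have "\<dots> = (\<integral>\<^sup>+a. F a \<partial>lborel) * ennreal (2 * pi)"
    by (subst nn_integral_cmult_indicator) simp_all
  finally have "ennreal pi * ennreal (pi * (\<rho>/4)\<^sup>2 * cmod (f z)) \<le> ennreal pi * (2 * (\<integral>\<^sup>+a. F a \<partial>lborel))"
    by (simp add: ennreal_mult mult_ac)
  then show ?thesis unfolding F[symmetric] by (subst (asm) ennreal_mult_le_mult_iff) simp_all
qed

section \<open>Local mass of p-th powers and a normal family\<close>

definition pmass :: "real \<Rightarrow> complex set \<Rightarrow> (complex \<Rightarrow> complex) \<Rightarrow> ennreal" where
  "pmass p E f = (\<integral>\<^sup>+z. ennreal (cmod (f z) powr p) * indicator E z \<partial>lborel)"

lemma pmass_integrand_measurable:
  assumes "f holomorphic_on ball 0 1" "E \<in> sets borel" "E \<subseteq> ball 0 1"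
  shows "(\<lambda>z. ennreal (cmod (f z) powr p) * indicator E z) \<in> borel_measurable borel"
proof -
  note [measurable] = continuous_on_indicator_measurable[OF holomorphic_on_imp_continuous_on[OF assms(1)] open_ball] assms(2)
  have "(\<lambda>z. ennreal (cmod (f z) powr p) * indicator E z) = (\<lambda>z. ennreal (cmod (f z * indicator (ball 0 1) z) powr p) * indicator E z)"
    using assms(3) by (intro ext) (auto split: split_indicator)
  also have "\<dots> \<in> borel_measurable borel" by measurable
  finally show ?thesis .
qed

text \<open>For p >= 1 the inequality |h| <= 1 + |h|^p reduces the bound to first powers, where
  \<open>norm_le_area_mean\<close> applies. The conclusion is the local boundedness that Montel's
  theorem asks for.\<close>

lemma pmass_bounded_imp_locally_bounded:
  assumes "1 \<le> p" "compact K" "K \<subseteq> ball 0 1"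
  shows "\<exists>B. \<forall>h. h holomorphic_on ball 0 1 \<and> pmass p (ball 0 1) h \<le> ennreal M \<longrightarrow> (\<forall>z\<in>K. cmod (h z) \<le> B)"
proof -
  obtain \<rho> where \<rho>: "0 < \<rho>" "(\<Union>z\<in>K. ball z \<rho>) \<subseteq> ball 0 1"
    using compact_subset_open_imp_ball_epsilon_subset[OF assms(2) open_ball assms(3)] by auto
  define B where "B = 2 * (pi + \<bar>M\<bar>) / (pi * (\<rho>/4)\<^sup>2)"
  show ?thesis
  proof (intro exI[of _ B] allI impI ballI)
    fix h z assume h: "h holomorphic_on ball 0 1 \<and> pmass p (ball 0 1) h \<le> ennreal M" and z: "z \<in> K"
    have bz: "ball z \<rho> \<subseteq> ball 0 1" using \<rho> z by auto
    have "ennreal (pi * (\<rho>/4)\<^sup>2 * cmod (h z)) \<le> 2 * (\<integral>\<^sup>+w. ennreal (cmod (h w)) * indicator (ball z \<rho>) w \<partial>lborel)"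
      using h \<rho> bz by (intro norm_le_area_mean) (auto intro: holomorphic_on_subset)
    also have "(\<integral>\<^sup>+w. ennreal (cmod (h w)) * indicator (ball z \<rho>) w \<partial>lborel)
       \<le> (\<integral>\<^sup>+w. indicator (ball 0 1) w + ennreal (cmod (h w) powr p) * indicator (ball 0 1) w \<partial>lborel)"
    proof (rule nn_integral_mono)
      fix w
      have "cmod (h w) \<le> 1 + cmod (h w) powr p"
      proof (cases "cmod (h w) \<le> 1")
        case False
        then have "cmod (h w) powr 1 \<le> cmod (h w) powr p" using assms(1) by (intro powr_mono) auto
        then show ?thesis using False by simp
      qed (simp add: add_increasing2)
      then have "ennreal (cmod (h w)) \<le> 1 + ennreal (cmod (h w) powr p)"
        by (metis ennreal_1 ennreal_leI ennreal_plus powr_ge_zero zero_le_one)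
      then show "ennreal (cmod (h w)) * indicator (ball z \<rho>) w \<le> indicator (ball 0 1) w + ennreal (cmod (h w) powr p) * indicator (ball 0 1) w"
        using bz by (cases "w \<in> ball z \<rho>"; cases "w \<in> ball 0 1") (auto simp del: mem_ball mem_ball_0)
    qed
    also have "\<dots> = ennreal pi + pmass p (ball 0 1) h"
      unfolding pmass_def using h pmass_integrand_measurable[of h "ball 0 1" p]
      by (subst nn_integral_add) (auto simp: emeasure_ball_complex intro!: borel_measurable_indicator)
    also have "\<dots> \<le> ennreal pi + ennreal \<bar>M\<bar>" using h by (intro add_left_mono) (metis abs_ge_self ennreal_leI order_trans)
    finally have "ennreal (pi * (\<rho>/4)\<^sup>2 * cmod (h z)) \<le> 2 * (ennreal pi + ennreal \<bar>M\<bar>)"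
      by (simp add: mult_left_mono)
    then have "ennreal (pi * (\<rho>/4)\<^sup>2 * cmod (h z)) \<le> ennreal (2 * (pi + \<bar>M\<bar>))"
    proof (rule ord_le_eq_trans)
      have "2 * (ennreal pi + ennreal \<bar>M\<bar>) = ennreal 2 * ennreal (pi + \<bar>M\<bar>)" by (simp add: ennreal_plus)
      also have "\<dots> = ennreal (2 * (pi + \<bar>M\<bar>))" by (rule ennreal_mult[symmetric]) auto
      finally show "2 * (ennreal pi + ennreal \<bar>M\<bar>) = ennreal (2 * (pi + \<bar>M\<bar>))" .
    qed
    then have "pi * (\<rho>/4)\<^sup>2 * cmod (h z) \<le> 2 * (pi + \<bar>M\<bar>)" by (subst (asm) ennreal_le_iff) auto
    then show "cmod (h z) \<le> B" unfolding B_def using \<rho> by (simp add: field_simps)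
  qed
qed

lemma zero_set_borel:
  assumes g: "g holomorphic_on ball 0 1"
  shows "{z \<in> ball 0 1. g z = 0} \<in> sets borel"
proof -
  have "(\<lambda>z. g z * indicator (ball 0 1) z) \<in> borel_measurable borel"
    by (rule continuous_on_indicator_measurable[OF holomorphic_on_imp_continuous_on[OF g] open_ball])
  then have "{z. g z * indicator (ball 0 1) z = 0} \<inter> ball 0 1 \<in> sets borel" by measurable
  also have "{z. g z * indicator (ball 0 1) z = 0} \<inter> ball 0 1 = {z \<in> ball 0 1. g z = 0}" by auto
  finally show ?thesis .
qed

text \<open>A nonconstant holomorphic function on the disc has countably many zeros, and a constant
  one that is nonzero at a has none.\<close>

lemma zero_set_null:
  assumes g: "g holomorphic_on ball 0 1" and a: "a \<in> ball 0 1" "g a \<noteq> 0"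
  shows "emeasure lborel {z \<in> ball 0 1. g z = 0} = 0"
proof (cases "g constant_on ball 0 1")
  case True
  then obtain c where c: "\<And>z. z \<in> ball 0 1 \<Longrightarrow> g z = c" unfolding constant_on_def by blast
  then have "g z \<noteq> 0" if "z \<in> ball 0 1" for z using c[OF that] c[OF a(1)] a(2) by simp
  then have "{z \<in> ball 0 1. g z = 0} = {}" by blast
  then show ?thesis by (simp only: emeasure_empty)
next
  case False
  then have "countable {z \<in> ball 0 1. g z = 0}"
  proof (intro holomorphic_countable_zeros g)
    obtain C :: "nat \<Rightarrow> complex set" where "\<And>n. compact (C n)" "\<Union>(range C) = ball 0 1"
      by (rule open_Union_compact_subsets[OF open_ball[of "0::complex" 1]]) blast
    then show "fsigma (ball (0::complex) 1)" unfolding fsigma_Union_compact by (intro exI[of _ C]) auto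
  qed auto
  then show ?thesis by (rule emeasure_lborel_countable)
qed

text \<open>Continuity from above along the thresholds 1/(n+1): the sublevel sets are closed, of
  finite measure inside a fixed closed disc, and decrease to zeros of g, hence to a null
  set.\<close>

lemma sublevel_measure_small:
  assumes g: "g holomorphic_on ball 0 1" "g 0 \<noteq> 0" and r: "r < 1" and e: "0 < e"
  obtains t where "0 < t" "{z \<in> cball 0 r. cmod (g z) \<le> t} \<in> sets borel"
    "emeasure lborel {z \<in> cball 0 r. cmod (g z) \<le> t} < ennreal e"
proof -
  define Z where "Z n = {z \<in> cball 0 r. cmod (g z) \<le> 1 / Suc n}" for n
  have sub: "cball 0 r \<subseteq> ball (0::complex) 1" using r by auto
  have cont: "continuous_on (cball 0 r) (\<lambda>z. cmod (g z))"
    using holomorphic_on_imp_continuous_on[OF holomorphic_on_subset[OF g(1) sub]] by (intro continuous_intros)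
  have cl: "closed (Z n)" for n
    using continuous_closed_preimage[OF cont closed_cball, of "{..1 / Suc n}"] 
    by (simp add: Z_def vimage_def Int_def)
  then have bor: "Z n \<in> sets borel" for n by (rule borel_closed)
  have dec: "decseq Z"
  proof (unfold decseq_def, intro allI impI subsetI)
    fix m n z assume "m \<le> n" "z \<in> Z n"
    moreover from \<open>m \<le> n\<close> have "1 / real (Suc n) \<le> 1 / real (Suc m)" by (intro divide_left_mono) auto
    ultimately show "z \<in> Z m" unfolding Z_def by auto
  qed
  have fin: "emeasure lborel (Z n) \<noteq> \<infinity>" for n
  proof -
    have "emeasure lborel (Z n) \<le> emeasure lborel (cball (0::complex) r)"
      by (intro emeasure_mono) (auto simp: Z_def)
    then show ?thesis using emeasure_lborel_cball_finite[of "0::complex" r] by (auto simp: top_unique)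
  qed
  have "(\<lambda>n. emeasure lborel (Z n)) \<longlonglongrightarrow> emeasure lborel (\<Inter>n. Z n)"
    using bor dec fin by (intro Lim_emeasure_decseq) auto
  also have "emeasure lborel (\<Inter>n. Z n) = 0"
  proof -
    have "(\<Inter>n. Z n) \<subseteq> {z \<in> ball 0 1. g z = 0}"
    proof
      fix z assume z: "z \<in> (\<Inter>n. Z n)"
      then have "cmod (g z) \<le> 1 / Suc n" for n unfolding Z_def by auto
      then have "cmod (g z) \<le> 0"
        by (metis nat_approx_posE not_le)
      then show "z \<in> {z \<in> ball 0 1. g z = 0}" using z sub unfolding Z_def by auto
    qed
    moreover have "{z \<in> ball 0 1. g z = 0} \<in> sets borel" by (rule zero_set_borel[OF g(1)])
    ultimately have "emeasure lborel (\<Inter>n. Z n) \<le> 0"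
      unfolding zero_set_null[of g 0, OF g(1) _ g(2), simplified, symmetric] by (intro emeasure_mono) auto
    then show ?thesis by simp
  qed
  finally have "\<forall>\<^sub>F n in sequentially. emeasure lborel (Z n) < ennreal e"
    using e by (intro order_tendstoD(2)[where y=0]) auto
  then obtain n where "emeasure lborel (Z n) < ennreal e" by (auto simp: eventually_sequentially)
  with bor[of n] show ?thesis by (intro that[of "1 / Suc n"]) (simp_all only: Z_def, simp)
qed

text \<open>Normalising \<open>f 0 = 1\<close>, a sequence of counterexamples has a locally uniform limit that is
  small on sets of measure at least \<open>\<delta>\<close>, although its zeros form a null set.\<close>
lemma luecking_local:
  assumes p: "1 \<le> p" and r: "r < 1" and \<delta>: "0 < \<delta>" and \<epsilon>: "0 < \<epsilon>"
  obtains C :: real where "0 < C"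
    "\<And>f E. f holomorphic_on ball 0 1 \<Longrightarrow> E \<in> sets borel \<Longrightarrow> E \<subseteq> ball 0 r \<Longrightarrow> ennreal \<delta> \<le> emeasure lborel E \<Longrightarrow>
      ennreal (cmod (f 0) powr p) \<le> ennreal C * pmass p E f + ennreal \<epsilon> * pmass p (ball 0 1) f"
proof (rule ccontr)
  assume "\<not> thesis"
  \<comment> \<open>The negation is used with the constants C = n + 1, giving one counterexample for
    each n.\<close>
  then have "\<exists>f E. f holomorphic_on ball 0 1 \<and> E \<in> sets borel \<and> E \<subseteq> ball 0 r \<and> ennreal \<delta> \<le> emeasure lborel E \<and>
      ennreal (Suc n) * pmass p E f + ennreal \<epsilon> * pmass p (ball 0 1) f < ennreal (cmod (f 0) powr p)" for n :: nat
    using that[of "real (Suc n)"] by (force simp: not_le)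
  then obtain f E where fE: "\<And>n. f n holomorphic_on ball 0 1" "\<And>n. E n \<in> sets borel" "\<And>n. E n \<subseteq> ball 0 r"
      "\<And>n. ennreal \<delta> \<le> emeasure lborel (E n)"
      "\<And>n. ennreal (Suc n) * pmass p (E n) (f n) + ennreal \<epsilon> * pmass p (ball 0 1) (f n) < ennreal (cmod (f n 0) powr p)"
    by metis
  have f0: "f n 0 \<noteq> 0" for n using fE(5)[of n] by (cases "f n 0 = 0") auto
  define g where "g n z = f n z / f n 0" for n z
  have g_hol: "g n holomorphic_on ball 0 1" for n unfolding g_def[abs_def] using f0 by (intro holomorphic_intros fE(1)) auto
  have scale: "pmass p A (g n) = ennreal (1 / cmod (f n 0) powr p) * pmass p A (f n)" if "A \<in> sets borel" "A \<subseteq> ball 0 1" for A n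
  proof -
    have "pmass p A (g n) = (\<integral>\<^sup>+z. ennreal (1 / cmod (f n 0) powr p) * (ennreal (cmod (f n z) powr p) * indicator A z) \<partial>lborel)"
      unfolding pmass_def g_def by (intro nn_integral_cong) (simp add: norm_divide powr_divide ennreal_mult[symmetric] mult.assoc[symmetric])
    also have "\<dots> = ennreal (1 / cmod (f n 0) powr p) * pmass p A (f n)"
      unfolding pmass_def using pmass_integrand_measurable[OF fE(1) that] by (intro nn_integral_cmult) auto
    finally show ?thesis .
  qed
  have r1: "ball 0 r \<subseteq> ball (0::complex) 1" using r by auto
  have g_le: "ennreal (Suc n) * pmass p (E n) (g n) + ennreal \<epsilon> * pmass p (ball 0 1) (g n) \<le> 1" for n
  proof -
    let ?k = "cmod (f n 0) powr p"
    have k: "0 < ?k" using f0[of n] by simp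
    have "ennreal (Suc n) * pmass p (E n) (g n) + ennreal \<epsilon> * pmass p (ball 0 1) (g n)
      = ennreal (1 / ?k) * (ennreal (Suc n) * pmass p (E n) (f n) + ennreal \<epsilon> * pmass p (ball 0 1) (f n))"
    proof -
      have "E n \<subseteq> ball 0 1" using fE(3)[of n] r1 by (rule subset_trans)
      then have s1: "pmass p (E n) (g n) = ennreal (1 / ?k) * pmass p (E n) (f n)" by (rule scale[OF fE(2)])
      have s2: "pmass p (ball 0 1) (g n) = ennreal (1 / ?k) * pmass p (ball 0 1) (f n)" by (rule scale) auto
      show ?thesis unfolding s1 s2 by (simp only: distrib_left mult_ac)
    qed
    also have "\<dots> \<le> ennreal (1 / ?k) * ennreal ?k" using fE(5)[of n] by (intro mult_left_mono) auto
    also have "\<dots> = 1" using k by (subst ennreal_mult[symmetric]) auto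
    finally show ?thesis .
  qed
  \<comment> \<open>The term with \<epsilon> supplies compactness: it bounds the masses of the
    normalised functions over the whole disc by 1/\<epsilon>.\<close>
  have g_ball: "pmass p (ball 0 1) (g n) \<le> ennreal (1 / \<epsilon>)" for n
  proof -
    have "ennreal \<epsilon> * pmass p (ball 0 1) (g n) \<le> 1" using g_le[of n] by (rule order_trans[rotated]) simp
    then have "ennreal (1 / \<epsilon>) * (ennreal \<epsilon> * pmass p (ball 0 1) (g n)) \<le> ennreal (1 / \<epsilon>) * 1" by (intro mult_left_mono) auto
    then show ?thesis using \<epsilon> by (simp add: mult.assoc[symmetric] ennreal_mult[symmetric])
  qed
  obtain h s where h: "h holomorphic_on ball 0 1" "strict_mono (s :: nat \<Rightarrow> nat)"
      "\<And>x. x \<in> ball 0 1 \<Longrightarrow> (\<lambda>n. g (s n) x) \<longlonglongrightarrow> h x"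
      "\<And>K. compact K \<Longrightarrow> K \<subseteq> ball 0 1 \<Longrightarrow> uniform_limit K (g \<circ> s) h sequentially"
  proof (rule Montel[of "ball 0 1" "{h. h holomorphic_on ball 0 1 \<and> pmass p (ball 0 1) h \<le> ennreal (1 / \<epsilon>)}" g])
    show "\<exists>B. \<forall>h\<in>{h. h holomorphic_on ball 0 1 \<and> pmass p (ball 0 1) h \<le> ennreal (1 / \<epsilon>)}. \<forall>z\<in>K. cmod (h z) \<le> B"
      if "compact K" "K \<subseteq> ball 0 1" for K
      using pmass_bounded_imp_locally_bounded[OF p that, of "1 / \<epsilon>"] by blast
  qed (use g_hol g_ball in auto)
  have "(\<lambda>n. g (s n) 0) = (\<lambda>n. 1)" unfolding g_def using f0 by auto
  then have h0: "h 0 = 1" using h(3)[of 0] LIMSEQ_unique[OF tendsto_const] by fastforce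
  obtain t where t: "0 < t" "{z \<in> cball 0 r. cmod (h z) \<le> t} \<in> sets borel"
    "emeasure lborel {z \<in> cball 0 r. cmod (h z) \<le> t} < ennreal (\<delta> / 2)"
  proof (rule sublevel_measure_small[OF h(1) _ r, of "\<delta>/2"])
    show "h 0 \<noteq> 0" "0 < \<delta> / 2" using h0 \<delta> by simp_all
  qed blast
  \<comment> \<open>Removing Z from a set of measure at least \<delta> leaves measure at least
    \<delta>/2. There |h| > t, hence |g| >= t/2 for large indices, so the masses over the sets E
    stay above \<theta>; the growing factor in \<open>g_le\<close> contradicts this.\<close>
  define Z where "Z = {z \<in> cball 0 r. cmod (h z) \<le> t}"
  have Zb: "Z \<in> sets lborel" and Zm: "emeasure lborel Z < ennreal (\<delta> / 2)" using t(2,3) unfolding Z_def by simp_all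
  have "uniform_limit (cball 0 r) (g \<circ> s) h sequentially" using r by (intro h(4)) auto
  then have "\<forall>\<^sub>F n in sequentially. \<forall>z\<in>cball 0 r. dist (g (s n) z) (h z) < t / 2"
    using t(1) half_gt_zero[of t] unfolding uniform_limit_iff comp_def by blast
  then obtain N where N: "\<And>n z. N \<le> n \<Longrightarrow> z \<in> cball 0 r \<Longrightarrow> dist (g (s n) z) (h z) < t / 2"
    unfolding eventually_sequentially by blast
  define \<theta> where "\<theta> = (t / 2) powr p * (\<delta> / 2)"
  have \<theta>: "0 < \<theta>" unfolding \<theta>_def using t \<delta> by simp
  have lower: "ennreal \<theta> \<le> pmass p (E (s n)) (g (s n))" if n: "N \<le> n" for n
  proof -
    have Eb: "E (s n) \<in> sets lborel" using fE(2) by simp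
    have "ennreal \<delta> \<le> emeasure lborel (E (s n))" by (rule fE(4))
    also have "\<dots> \<le> emeasure lborel ((E (s n) - Z) \<union> Z)"
      using Eb Zb by (intro emeasure_mono sets.Un sets.Diff) blast+
    also have "\<dots> \<le> emeasure lborel (E (s n) - Z) + emeasure lborel Z"
      using Eb Zb by (intro emeasure_subadditive sets.Diff)
    also have "\<dots> \<le> emeasure lborel (E (s n) - Z) + ennreal (\<delta> / 2)" using Zm by (intro add_left_mono less_imp_le)
    finally have "ennreal (\<delta>/2) + ennreal (\<delta>/2) \<le> ennreal (\<delta>/2) + emeasure lborel (E (s n) - Z)"
      using \<delta> by (simp add: add.commute flip: ennreal_plus)
    then have "ennreal (\<delta>/2) \<le> emeasure lborel (E (s n) - Z)"
      by (simp add: ennreal_add_left_cancel_le)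
    then have "ennreal ((t / 2) powr p) * ennreal (\<delta> / 2) \<le> ennreal ((t / 2) powr p) * emeasure lborel (E (s n) - Z)"
      by (rule mult_left_mono) simp
    then have "ennreal \<theta> \<le> ennreal ((t / 2) powr p) * emeasure lborel (E (s n) - Z)"
      unfolding \<theta>_def using \<delta> by (subst ennreal_mult) simp_all
    also have "\<dots> = (\<integral>\<^sup>+z. ennreal ((t / 2) powr p) * indicator (E (s n) - Z) z \<partial>lborel)"
      using Eb Zb by (subst nn_integral_cmult_indicator) (rule sets.Diff, assumption+, simp)
    also have "\<dots> \<le> pmass p (E (s n)) (g (s n))" unfolding pmass_def
    proof (rule nn_integral_mono)
      fix z
      show "ennreal ((t / 2) powr p) * indicator (E (s n) - Z) z \<le> ennreal (cmod (g (s n) z) powr p) * indicator (E (s n)) z"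
      proof (cases "z \<in> E (s n) - Z")
        case True
        then have z: "z \<in> cball 0 r" using fE(3)[of "s n"] by auto
        then have "t < cmod (h z)" using True unfolding Z_def by auto
        moreover have "cmod (h z) \<le> cmod (g (s n) z) + dist (g (s n) z) (h z)"
          unfolding dist_norm by (metis norm_minus_commute norm_triangle_sub)
        ultimately have "t / 2 \<le> cmod (g (s n) z)" using N[OF n z] by simp
        then have "(t / 2) powr p \<le> cmod (g (s n) z) powr p" using t p by (intro powr_mono2) auto
        then show ?thesis using True by (simp add: ennreal_leI)
      qed simp
    qed
    finally show ?thesis .
  qed
  obtain n where n: "1 / \<theta> < real n" using reals_Archimedean2 by blast
  define m where "m = max n N"
  have "ennreal (Suc (s m)) * ennreal \<theta> \<le> ennreal (Suc (s m)) * pmass p (E (s m)) (g (s m))"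
    using lower[of m] unfolding m_def by (intro mult_left_mono) auto
  also have "\<dots> \<le> 1" using g_le[of "s m"] by (rule order_trans[rotated]) simp
  finally have "Suc (s m) * \<theta> \<le> 1" using \<theta> by (simp flip: ennreal_mult ennreal_1 del: of_nat_Suc)
  moreover have "m \<le> s m" using h(2) by (rule strict_mono_imp_increasing)
  then have "real n \<le> Suc (s m)" unfolding m_def by linarith
  then have "1 / \<theta> < Suc (s m)" using n by linarith
  ultimately show False using \<theta> by (simp add: field_simps del: of_nat_Suc)
qed

section \<open>Sampling on cones\<close>

lemma nn_integral_lborel_affine:
  fixes a :: complex
  assumes [measurable]: "F \<in> borel_measurable borel" and R: "0 < R"
  shows "(\<integral>\<^sup>+w. F (a + of_real R * w) \<partial>lborel) = ennreal (1 / R\<^sup>2) * (\<integral>\<^sup>+z. F z \<partial>lborel)"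
proof -
  have "(\<integral>\<^sup>+z. F z \<partial>lborel) = (\<integral>\<^sup>+z. F z \<partial>density (distr lborel borel (\<lambda>x. a + R *\<^sub>R x)) (\<lambda>_. ennreal (\<bar>R\<bar> ^ DIM(complex))))"
    using R by (subst lborel_affine[of R a]) simp_all
  also have "\<dots> = (\<integral>\<^sup>+z. ennreal (R\<^sup>2) * F z \<partial>distr lborel borel (\<lambda>x. a + R *\<^sub>R x))"
    using R by (subst nn_integral_density) simp_all
  also have "\<dots> = (\<integral>\<^sup>+w. ennreal (R\<^sup>2) * F (a + R *\<^sub>R w) \<partial>lborel)"
    by (rule nn_integral_distr) measurable
  also have "\<dots> = ennreal (R\<^sup>2) * (\<integral>\<^sup>+w. F (a + of_real R * w) \<partial>lborel)"
    by (subst nn_integral_cmult[symmetric]) (simp_all add: scaleR_conv_of_real)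
  finally have "ennreal (1 / R\<^sup>2) * (\<integral>\<^sup>+z. F z \<partial>lborel) = ennreal (1 / R\<^sup>2) * ennreal (R\<^sup>2) * (\<integral>\<^sup>+w. F (a + of_real R * w) \<partial>lborel)"
    by (simp add: mult.assoc)
  also have "ennreal (1 / R\<^sup>2) * ennreal (R\<^sup>2) = 1" using R by (subst ennreal_mult[symmetric]) simp_all
  finally show ?thesis by simp
qed

text \<open>The integrand of the tent norm, cut off to the disc so that for holomorphic f it is
  Borel on the whole plane, whatever values f takes outside.\<close>

definition hweight :: "real \<Rightarrow> (complex \<Rightarrow> complex) \<Rightarrow> complex \<Rightarrow> ennreal" where
  "hweight p f z = ennreal (cmod (f z) powr p / (1 - cmod z)) * indicator (ball 0 1) z"

lemma hweight_measurable:
  assumes "f holomorphic_on ball 0 1"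
  shows "hweight p f \<in> borel_measurable borel"
proof -
  have [measurable]: "ball (0::complex) 1 \<in> sets borel" by simp
  define g where "g z = f z * indicator (ball 0 1) z" for z
  have [measurable]: "g \<in> borel_measurable borel" unfolding g_def
    by (rule continuous_on_indicator_measurable[OF holomorphic_on_imp_continuous_on[OF assms] open_ball])
  have "hweight p f = (\<lambda>z. ennreal (cmod (g z) powr p / (1 - cmod z)) * indicator (ball 0 1) z)"
    unfolding hweight_def g_def by (intro ext) (auto split: split_indicator)
  also have "\<dots> \<in> borel_measurable borel" by measurable
  finally show ?thesis .
qed

text \<open>The dilation w -> \<alpha> + R w with R = \<eta>' (1 - |\<alpha>|) carries
  \<open>luecking_local\<close> to a disc about \<alpha>. The larger radius \<eta>' keeps the dense
  set inside the smaller disc of radius \<eta>/\<eta>', and the parameters \<delta>/\<eta>'^2 and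
  \<epsilon> \<eta>'^2 absorb the Jacobian.\<close>

lemma norm_le_local_mass:
  assumes p: "1 \<le> p" and \<eta>: "0 < \<eta>" "\<eta> < \<eta>'" "\<eta>' < 1" and \<delta>: "0 < \<delta>" and \<epsilon>: "0 < \<epsilon>"
  obtains C :: real where "0 < C"
    "\<And>f G \<alpha>. f holomorphic_on ball 0 1 \<Longrightarrow> G \<in> sets borel \<Longrightarrow> \<alpha> \<in> ball 0 1 \<Longrightarrow> 
      ennreal (\<delta> * (1 - cmod \<alpha>)\<^sup>2) \<le> emeasure lborel (G \<inter> ball \<alpha> (\<eta> * (1 - cmod \<alpha>))) \<Longrightarrow>
      ennreal (cmod (f \<alpha>) powr p) \<le> ennreal (1 / (1 - cmod \<alpha>)\<^sup>2) *
        (ennreal C * pmass p (G \<inter> ball \<alpha> (\<eta>' * (1 - cmod \<alpha>))) f + ennreal \<epsilon> * pmass p (ball \<alpha> (\<eta>' * (1 - cmod \<alpha>))) f)"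
proof -
  have \<eta>'0: "0 < \<eta>'" using \<eta> by simp
  have "\<eta> / \<eta>' < 1" "0 < \<delta> / \<eta>'\<^sup>2" "0 < \<epsilon> * \<eta>'\<^sup>2" using \<eta> \<delta> \<epsilon> by simp_all
  then obtain C where C: "0 < C" 
    "\<And>f E. f holomorphic_on ball 0 1 \<Longrightarrow> E \<in> sets borel \<Longrightarrow> E \<subseteq> ball 0 (\<eta> / \<eta>') \<Longrightarrow> ennreal (\<delta> / \<eta>'\<^sup>2) \<le> emeasure lborel E \<Longrightarrow>
      ennreal (cmod (f 0) powr p) \<le> ennreal C * pmass p E f + ennreal (\<epsilon> * \<eta>'\<^sup>2) * pmass p (ball 0 1) f"
    using luecking_local[OF p, of "\<eta> / \<eta>'" "\<delta> / \<eta>'\<^sup>2" "\<epsilon> * \<eta>'\<^sup>2"] by metis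
  show ?thesis
  proof (rule that[of "C / \<eta>'\<^sup>2"])
    fix f G \<alpha> assume f: "f holomorphic_on ball 0 1" and G: "G \<in> sets borel" and \<alpha>: "\<alpha> \<in> ball 0 (1::real)"
      and dens: "ennreal (\<delta> * (1 - cmod \<alpha>)\<^sup>2) \<le> emeasure lborel (G \<inter> ball \<alpha> (\<eta> * (1 - cmod \<alpha>)))"
    define d where "d = 1 - cmod \<alpha>"
    have d: "0 < d" unfolding d_def using \<alpha> by simp
    define R where "R = \<eta>' * d"
    have R: "0 < R" "R < d" unfolding R_def using \<eta> d by auto
    define F where "F w = f (\<alpha> + of_real R * w)" for w
    have in_disc: "ball \<alpha> R \<subseteq> ball 0 1"
    proof
      fix z assume "z \<in> ball \<alpha> R"
      then have "cmod (z - \<alpha>) < d" using R by (simp add: dist_norm norm_minus_commute)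
      moreover have "cmod z \<le> cmod (z - \<alpha>) + cmod \<alpha>" using norm_triangle_ineq[of "z - \<alpha>" \<alpha>] by simp
      ultimately show "z \<in> ball 0 1" unfolding d_def mem_ball_0 by simp
    qed
    have ball_iff: "\<alpha> + of_real R * w \<in> ball \<alpha> (R * t) \<longleftrightarrow> w \<in> ball 0 t" for w t
      using R by (simp add: dist_norm norm_mult)
    have "F holomorphic_on ball 0 1" unfolding F_def
      using in_disc ball_iff[of _ 1] by (intro holomorphic_on_compose_gen[OF _ f, unfolded o_def] holomorphic_intros) auto
    define B where "B = G \<inter> ball \<alpha> (\<eta> * d)"
    have B: "B \<in> sets borel" unfolding B_def using G by simp
    define E where "E = (\<lambda>w. \<alpha> + of_real R * w) -` B"
    have [measurable]: "(\<lambda>w. \<alpha> + of_real R * w) \<in> borel_measurable borel" by measurable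
    have E: "E \<in> sets borel" unfolding E_def using measurable_sets_borel[OF _ B] by measurable
    have \<eta>d: "\<eta> * d = R * (\<eta> / \<eta>')" unfolding R_def using \<eta>'0 by simp
    have "E \<subseteq> ball 0 (\<eta> / \<eta>')"
      unfolding E_def B_def \<eta>d using ball_iff by blast
    have indE: "indicator E w = (indicator B (\<alpha> + of_real R * w) :: ennreal)" for w unfolding E_def by (simp add: indicator_def)
    have "emeasure lborel E = (\<integral>\<^sup>+w. indicator B (\<alpha> + of_real R * w) \<partial>lborel)"
      using E unfolding indE[symmetric] by simp
    also have "\<dots> = ennreal (1 / R\<^sup>2) * emeasure lborel B"
      using B R by (subst nn_integral_lborel_affine) simp_all
    also have "\<dots> \<ge> ennreal (1 / R\<^sup>2) * ennreal (\<delta> * d\<^sup>2)"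
      using dens unfolding B_def d_def by (intro mult_left_mono) auto
    also have "ennreal (1 / R\<^sup>2) * ennreal (\<delta> * d\<^sup>2) = ennreal (\<delta> / \<eta>'\<^sup>2)"
      using \<delta> d unfolding R_def by (subst ennreal_mult[symmetric]) (simp_all add: power_mult_distrib)
    finally have "ennreal (\<delta> / \<eta>'\<^sup>2) \<le> emeasure lborel E" .
    then have main: "ennreal (cmod (F 0) powr p) \<le> ennreal C * pmass p E F + ennreal (\<epsilon> * \<eta>'\<^sup>2) * pmass p (ball 0 1) F"
      by (rule C(2)[OF \<open>F holomorphic_on ball 0 1\<close> E \<open>E \<subseteq> ball 0 (\<eta> / \<eta>')\<close>])
    have pm: "pmass p A' F = ennreal (1 / R\<^sup>2) * pmass p A f"
      if A: "A \<in> sets borel" "A \<subseteq> ball \<alpha> R" and A': "\<And>w. w \<in> A' \<longleftrightarrow> \<alpha> + of_real R * w \<in> A" for A A'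
    proof -
      have "indicator A' w = (indicator A (\<alpha> + of_real R * w) :: ennreal)" for w using A' by (simp add: indicator_def)
      then show ?thesis unfolding pmass_def F_def 
        using A R in_disc f by (subst nn_integral_lborel_affine[symmetric]) (auto intro!: pmass_integrand_measurable)
    qed
    have "\<eta> * d \<le> R" unfolding R_def using \<eta> d by simp
    then have "B \<subseteq> ball \<alpha> R" unfolding B_def by auto
    then have "pmass p E F = ennreal (1 / R\<^sup>2) * pmass p B f" by (intro pm B) (simp_all add: E_def)
    also have "pmass p B f \<le> pmass p (G \<inter> ball \<alpha> R) f"
      using \<open>B \<subseteq> ball \<alpha> R\<close> unfolding pmass_def B_def by (intro nn_integral_mono) (auto split: split_indicator)
    finally have 1: "pmass p E F \<le> ennreal (1 / R\<^sup>2) * pmass p (G \<inter> ball \<alpha> R) f" by (simp add: mult_left_mono)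
    have 2: "pmass p (ball 0 1) F = ennreal (1 / R\<^sup>2) * pmass p (ball \<alpha> R) f"
      using ball_iff[of _ 1] by (intro pm) simp_all
    have "ennreal (cmod (f \<alpha>) powr p) \<le> ennreal C * (ennreal (1 / R\<^sup>2) * pmass p (G \<inter> ball \<alpha> R) f) + ennreal (\<epsilon> * \<eta>'\<^sup>2) * (ennreal (1 / R\<^sup>2) * pmass p (ball \<alpha> R) f)"
      using main order_trans[OF main add_right_mono[OF mult_left_mono[OF 1]]] unfolding 2 by (simp add: F_def)
    also have "ennreal C * (ennreal (1 / R\<^sup>2) * pmass p (G \<inter> ball \<alpha> R) f) = ennreal (1 / d\<^sup>2) * (ennreal (C / \<eta>'\<^sup>2) * pmass p (G \<inter> ball \<alpha> R) f)"
    proof -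
      have "ennreal C * ennreal (1 / R\<^sup>2) = ennreal (1 / d\<^sup>2) * ennreal (C / \<eta>'\<^sup>2)"
        using C d unfolding R_def by (subst (1 2) ennreal_mult[symmetric]) (simp_all add: power_mult_distrib)
      then show ?thesis by (simp only: mult.assoc[symmetric])
    qed
    also have "ennreal (\<epsilon> * \<eta>'\<^sup>2) * (ennreal (1 / R\<^sup>2) * pmass p (ball \<alpha> R) f) = ennreal (1 / d\<^sup>2) * (ennreal \<epsilon> * pmass p (ball \<alpha> R) f)"
    proof -
      have "ennreal (\<epsilon> * \<eta>'\<^sup>2) * ennreal (1 / R\<^sup>2) = ennreal (1 / d\<^sup>2) * ennreal \<epsilon>"
        using \<epsilon> d \<eta>'0 unfolding R_def by (subst (1 2) ennreal_mult[symmetric]) (simp_all add: power_mult_distrib)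
      then show ?thesis by (simp only: mult.assoc[symmetric])
    qed
    finally show "ennreal (cmod (f \<alpha>) powr p) \<le> ennreal (1 / (1 - cmod \<alpha>)\<^sup>2) *
        (ennreal (C / \<eta>'\<^sup>2) * pmass p (G \<inter> ball \<alpha> (\<eta>' * (1 - cmod \<alpha>))) f + ennreal \<epsilon> * pmass p (ball \<alpha> (\<eta>' * (1 - cmod \<alpha>))) f)"
      unfolding R_def d_def by (simp only: distrib_left)
  qed (use C \<eta>'0 in simp)
qed

lemma ball_in_cone:
  assumes \<eta>: "0 < \<eta>" "\<eta> < 1" and a: "a \<in> stolz c \<xi>" and c: "0 < c" and z: "cmod (z - a) < \<eta> * (1 - cmod a)"
  shows "z \<in> stolz ((c + 1) / (1 - \<eta>)) \<xi>" "1 - cmod z \<le> 2 * (1 - cmod a)" "1 - cmod a \<le> (1 - cmod z) / (1 - \<eta>)"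
proof -
  define d where "d = 1 - cmod a"
  have d: "0 < d" unfolding d_def using stolz_subset_disc[OF c, of \<xi>] a by auto
  have \<eta>d: "\<eta> * d < d" using \<eta> d by simp
  have "cmod z \<le> cmod (z - a) + cmod a" using norm_triangle_ineq[of "z - a" a] by simp
  then have 1: "(1 - \<eta>) * d \<le> 1 - cmod z" using z unfolding d_def by (simp add: algebra_simps)
  have "cmod a \<le> cmod (z - a) + cmod z" using norm_triangle_ineq3[of a z] by (simp add: norm_minus_commute)
  then show "1 - cmod z \<le> 2 * (1 - cmod a)" using z \<eta>d unfolding d_def by simp
  show 3: "1 - cmod a \<le> (1 - cmod z) / (1 - \<eta>)" using 1 \<eta> unfolding d_def by (simp add: field_simps)
  have "cmod (z - \<xi>) \<le> cmod (z - a) + cmod (a - \<xi>)" using norm_triangle_ineq[of "z - a" "a - \<xi>"] by simp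
  also have "\<dots> < (c + 1) * d" using z a \<eta>d unfolding stolz_def d_def by (simp add: algebra_simps)
  also have "\<dots> \<le> (c + 1) * ((1 - cmod z) / (1 - \<eta>))" using 3 c unfolding d_def by (intro mult_left_mono) auto
  finally show "z \<in> stolz ((c + 1) / (1 - \<eta>)) \<xi>" unfolding stolz_def by simp
qed

text \<open>After Fubini a given z is reached only from centres a with 1 - |a| comparable to 1 - |z|
  and within a multiple of 1 - |z|. The cubic weight times the area of these centres leaves the
  density 1/(1 - |z|) of the area function.\<close>

lemma cone_average_le:
  assumes v [measurable]: "v \<in> borel_measurable borel" and \<eta>: "0 < \<eta>" "\<eta> < 1" and c: "0 < c"
  shows "(\<integral>\<^sup>+a. ennreal (1 / (1 - cmod a) ^ 3) * (\<integral>\<^sup>+z. v z * indicator (ball a (\<eta> * (1 - cmod a))) z \<partial>lborel) * indicator (stolz c \<xi>) a \<partial>lborel)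
    \<le> ennreal (8 * pi / (1 - \<eta>)\<^sup>2) * cone_int ((c + 1) / (1 - \<eta>)) (\<lambda>z. v z * ennreal (1 / (1 - cmod z))) \<xi>"
proof -
  define S where "S = {x :: complex \<times> complex. cmod (snd x - fst x) < \<eta> * (1 - cmod (fst x))}"
  have [measurable]: "S \<in> sets (borel \<Otimes>\<^sub>M borel)"
  proof -
    have "open S" unfolding S_def by (intro open_Collect_less continuous_intros)
    then show ?thesis unfolding borel_prod by simp
  qed
  have ind: "indicator (ball a (\<eta> * (1 - cmod a))) z = (indicator S (a, z) :: ennreal)" for a z
    unfolding S_def by (simp add: indicator_def dist_norm norm_minus_commute)
  let ?c' = "(c + 1) / (1 - \<eta>)"
  have "(\<integral>\<^sup>+a. ennreal (1 / (1 - cmod a) ^ 3) * (\<integral>\<^sup>+z. v z * indicator (ball a (\<eta> * (1 - cmod a))) z \<partial>lborel) * indicator (stolz c \<xi>) a \<partial>lborel)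
    = (\<integral>\<^sup>+a. (\<integral>\<^sup>+z. v z * (ennreal (1 / (1 - cmod a) ^ 3) * indicator (stolz c \<xi>) a * indicator S (a, z)) \<partial>lborel) \<partial>lborel)"
    unfolding ind
    by (intro nn_integral_cong, subst nn_integral_cmult[symmetric], measurable, subst nn_integral_multc[symmetric], measurable)
       (simp add: mult_ac)
  also have "\<dots> = (\<integral>\<^sup>+z. (\<integral>\<^sup>+a. v z * (ennreal (1 / (1 - cmod a) ^ 3) * indicator (stolz c \<xi>) a * indicator S (a, z)) \<partial>lborel) \<partial>lborel)"
    by (rule lborel_pair.Fubini'[symmetric]) measurable
  also have "\<dots> \<le> (\<integral>\<^sup>+z. v z * (ennreal (8 * pi / (1 - \<eta>)\<^sup>2) * ennreal (1 / (1 - cmod z)) * indicator (stolz ?c' \<xi>) z) \<partial>lborel)"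
  proof (rule nn_integral_mono)
    fix z :: complex
    define k where "k = 1 - cmod z"
    have pt: "ennreal (1 / (1 - cmod a) ^ 3) * indicator (stolz c \<xi>) a * indicator S (a, z)
       \<le> ennreal (8 / k ^ 3) * indicator (stolz ?c' \<xi>) z * indicator (ball z (k / (1 - \<eta>))) a" for a
    proof (cases "a \<in> stolz c \<xi> \<and> (a, z) \<in> S")
      case True
      then have "cmod (z - a) < \<eta> * (1 - cmod a)" unfolding S_def by simp
      note b = ball_in_cone[OF \<eta> _ c this, of \<xi>]
      have a: "a \<in> stolz c \<xi>" using True by simp
      have "0 < 1 - cmod a" using stolz_subset_disc[OF c, of \<xi>] a by auto
      have k: "0 < k" unfolding k_def using b(1)[OF a] stolz_subset_disc[of ?c' \<xi>] c \<eta> by auto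
      have "(k / 2) ^ 3 \<le> (1 - cmod a) ^ 3" using b(2)[OF a] k unfolding k_def by (intro power_mono) auto
      then have "1 / (1 - cmod a) ^ 3 \<le> 1 / (k / 2) ^ 3" 
        using k \<open>0 < 1 - cmod a\<close> by (intro divide_left_mono mult_pos_pos) simp_all
      also have "\<dots> = 8 / k ^ 3" by (simp add: power_divide)
      finally have 1: "1 / (1 - cmod a) ^ 3 \<le> 8 / k ^ 3" .
      have "dist z a < 1 * (1 - cmod a)"
        using \<open>cmod (z - a) < \<eta> * (1 - cmod a)\<close> mult_strict_right_mono[OF \<eta>(2) \<open>0 < 1 - cmod a\<close>] by (simp add: dist_norm)
      then have "a \<in> ball z (k / (1 - \<eta>))" using b(3)[OF a] unfolding k_def by simp
      then show ?thesis using True b(1)[OF a] 1 by (simp add: ennreal_leI)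
    qed auto
    have "(\<integral>\<^sup>+a. v z * (ennreal (1 / (1 - cmod a) ^ 3) * indicator (stolz c \<xi>) a * indicator S (a, z)) \<partial>lborel)
      = v z * (\<integral>\<^sup>+a. ennreal (1 / (1 - cmod a) ^ 3) * indicator (stolz c \<xi>) a * indicator S (a, z) \<partial>lborel)"
      by (rule nn_integral_cmult) measurable
    also have "\<dots> \<le> v z * (\<integral>\<^sup>+a. ennreal (8 / k ^ 3) * indicator (stolz ?c' \<xi>) z * indicator (ball z (k / (1 - \<eta>))) a \<partial>lborel)"
      by (intro mult_left_mono nn_integral_mono pt) auto
    also have "(\<integral>\<^sup>+a. ennreal (8 / k ^ 3) * indicator (stolz ?c' \<xi>) z * indicator (ball z (k / (1 - \<eta>))) a \<partial>lborel)
       = ennreal (8 / k ^ 3) * indicator (stolz ?c' \<xi>) z * emeasure lborel (ball z (k / (1 - \<eta>)))"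
      by (rule nn_integral_cmult_indicator) simp
    also have "\<dots> = ennreal (8 * pi / (1 - \<eta>)\<^sup>2) * ennreal (1 / (1 - cmod z)) * indicator (stolz ?c' \<xi>) z"
    proof (cases "z \<in> stolz ?c' \<xi>")
      case True
      then have k: "0 < k" unfolding k_def using stolz_subset_disc[of ?c' \<xi>] c \<eta> by auto
      have "ennreal (8 / k ^ 3) * ennreal (pi * (k / (1 - \<eta>))\<^sup>2) = ennreal (8 * pi / (1 - \<eta>)\<^sup>2) * ennreal (1 / k)"
        using k by (subst (1 2) ennreal_mult[symmetric]) (simp_all add: power_divide power2_eq_square power3_eq_cube)
      then show ?thesis using True k \<eta> unfolding k_def by (subst emeasure_ball_complex) simp_all
    qed simp
    finally show "(\<integral>\<^sup>+a. v z * (ennreal (1 / (1 - cmod a) ^ 3) * indicator (stolz c \<xi>) a * indicator S (a, z)) \<partial>lborel)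
      \<le> v z * (ennreal (8 * pi / (1 - \<eta>)\<^sup>2) * ennreal (1 / (1 - cmod z)) * indicator (stolz ?c' \<xi>) z)" .
  qed
  also have "\<dots> = ennreal (8 * pi / (1 - \<eta>)\<^sup>2) * cone_int ?c' (\<lambda>z. v z * ennreal (1 / (1 - cmod z))) \<xi>"
    unfolding cone_int_def by (subst nn_integral_cmult[symmetric]) (auto simp: mult_ac)
  finally show ?thesis .
qed

text \<open>The local estimate at a costs (1 - |a|)^(-2) and the density of the area function
  another (1 - |a|)^(-1); this is the cubic weight of \<open>cone_average_le\<close>. The constant D
  of that lemma is anticipated by using \<epsilon>/D in the local estimate.\<close>

lemma cone_int_sampling:
  assumes p: "1 \<le> p" and \<eta>: "0 < \<eta>" "\<eta> < \<eta>'" "\<eta>' < 1" and \<delta>: "0 < \<delta>" and \<epsilon>: "0 < \<epsilon>" and c: "0 < c"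
  obtains C :: real where "0 < C"
    "\<And>f G \<xi>. f holomorphic_on ball 0 1 \<Longrightarrow> G \<in> sets borel \<Longrightarrow>
      (\<And>\<alpha>. \<alpha> \<in> ball 0 1 \<Longrightarrow> ennreal (\<delta> * (1 - cmod \<alpha>)\<^sup>2) \<le> emeasure lborel (G \<inter> ball \<alpha> (\<eta> * (1 - cmod \<alpha>)))) \<Longrightarrow>
      cone_int c (hweight p f) \<xi> \<le> ennreal C * cone_int ((c + 1) / (1 - \<eta>')) (\<lambda>z. hweight p f z * indicator G z) \<xi>
        + ennreal \<epsilon> * cone_int ((c + 1) / (1 - \<eta>')) (hweight p f) \<xi>"
proof -
  define D where "D = 8 * pi / (1 - \<eta>')\<^sup>2"
  have D: "0 < D" unfolding D_def using \<eta> by simp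
  have "0 < \<epsilon> / D" using \<epsilon> D by simp
  then obtain C where C: "0 < C"
    "\<And>f G \<alpha>. f holomorphic_on ball 0 1 \<Longrightarrow> G \<in> sets borel \<Longrightarrow> \<alpha> \<in> ball 0 1 \<Longrightarrow> 
      ennreal (\<delta> * (1 - cmod \<alpha>)\<^sup>2) \<le> emeasure lborel (G \<inter> ball \<alpha> (\<eta> * (1 - cmod \<alpha>))) \<Longrightarrow>
      ennreal (cmod (f \<alpha>) powr p) \<le> ennreal (1 / (1 - cmod \<alpha>)\<^sup>2) *
        (ennreal C * pmass p (G \<inter> ball \<alpha> (\<eta>' * (1 - cmod \<alpha>))) f + ennreal (\<epsilon> / D) * pmass p (ball \<alpha> (\<eta>' * (1 - cmod \<alpha>))) f)"
    using norm_le_local_mass[OF p \<eta> \<delta>, of "\<epsilon> / D"] by metis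
  show ?thesis
  proof (rule that[of "C * D"])
    fix f G \<xi> assume f: "f holomorphic_on ball 0 1" and G [measurable]: "G \<in> sets borel"
      and dens: "\<And>\<alpha>. \<alpha> \<in> ball 0 1 \<Longrightarrow> ennreal (\<delta> * (1 - cmod \<alpha>)\<^sup>2) \<le> emeasure lborel (G \<inter> ball \<alpha> (\<eta> * (1 - cmod \<alpha>)))"
    define u where "u z = ennreal (cmod (f z) powr p) * indicator (ball 0 1) z" for z
    have [measurable]: "u \<in> borel_measurable borel" unfolding u_def using pmass_integrand_measurable[OF f, of "ball 0 1"] by simp
    define v where "v z = ennreal C * (u z * indicator G z) + ennreal (\<epsilon> / D) * u z" for z
    have [measurable]: "v \<in> borel_measurable borel" unfolding v_def by measurable
    note [measurable] = hweight_measurable[OF f]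
    let ?c' = "(c + 1) / (1 - \<eta>')"
    have le: "hweight p f a * indicator (stolz c \<xi>) a \<le>
       ennreal (1 / (1 - cmod a) ^ 3) * (\<integral>\<^sup>+z. v z * indicator (ball a (\<eta>' * (1 - cmod a))) z \<partial>lborel) * indicator (stolz c \<xi>) a" for a
    proof (cases "a \<in> stolz c \<xi>")
      case True
      then have a: "a \<in> ball 0 1" using stolz_subset_disc[OF c] by blast
      define d where "d = 1 - cmod a"
      have d: "0 < d" unfolding d_def using a by simp
      let ?B = "ball a (\<eta>' * d)"
      have B1: "?B \<subseteq> ball 0 1"
      proof
        fix z assume "z \<in> ?B"
        then have "cmod (z - a) < \<eta>' * d" by (simp add: dist_norm norm_minus_commute)
        also have "\<dots> \<le> d" using \<eta> d by simp
        finally have "cmod (z - a) < d" .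
        moreover have "cmod z \<le> cmod (z - a) + cmod a" using norm_triangle_ineq[of "z - a" a] by simp
        ultimately show "z \<in> ball 0 1" unfolding d_def mem_ball_0 by simp
      qed
      have pm: "pmass p A f = (\<integral>\<^sup>+z. u z * indicator A z \<partial>lborel)" if "A \<subseteq> ?B" for A
        unfolding pmass_def u_def using that B1 by (intro nn_integral_cong) (auto split: split_indicator)
      have "(\<integral>\<^sup>+z. v z * indicator ?B z \<partial>lborel) = (\<integral>\<^sup>+z. ennreal C * (u z * indicator (G \<inter> ?B) z) + ennreal (\<epsilon> / D) * (u z * indicator ?B z) \<partial>lborel)"
        unfolding v_def by (intro nn_integral_cong) (auto split: split_indicator simp: distrib_right)
      also have "\<dots> = ennreal C * pmass p (G \<inter> ?B) f + ennreal (\<epsilon> / D) * pmass p ?B f"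
      proof -
        have [measurable]: "?B \<in> sets borel" by simp
        show ?thesis using pm[of "G \<inter> ?B"] pm[of ?B] by (simp add: nn_integral_add nn_integral_cmult)
      qed
      finally have eq: "ennreal C * pmass p (G \<inter> ?B) f + ennreal (\<epsilon> / D) * pmass p ?B f = (\<integral>\<^sup>+z. v z * indicator ?B z \<partial>lborel)" ..
      have "hweight p f a = ennreal (1 / d) * ennreal (cmod (f a) powr p)"
        unfolding hweight_def using a d unfolding d_def by (simp flip: ennreal_mult)
      also have "\<dots> \<le> ennreal (1 / d) * (ennreal (1 / d\<^sup>2) * (\<integral>\<^sup>+z. v z * indicator ?B z \<partial>lborel))"
        using C(2)[OF f G a dens[OF a]] eq unfolding d_def by (intro mult_left_mono) simp_all
      also have "\<dots> = ennreal (1 / d ^ 3) * (\<integral>\<^sup>+z. v z * indicator ?B z \<partial>lborel)"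
      proof -
        have "ennreal (1 / d) * ennreal (1 / d\<^sup>2) = ennreal (1 / d ^ 3)"
          using d by (subst ennreal_mult[symmetric]) (simp_all add: power2_eq_square power3_eq_cube)
        then show ?thesis by (simp only: mult.assoc[symmetric])
      qed
      finally show ?thesis using True unfolding d_def by simp
    qed simp
    have "cone_int c (hweight p f) \<xi> \<le> ennreal D * cone_int ?c' (\<lambda>z. v z * ennreal (1 / (1 - cmod z))) \<xi>"
      unfolding cone_int_def[of c] D_def
      using \<eta> c by (intro order_trans[OF nn_integral_mono[OF le]] cone_average_le) auto
    also have "cone_int ?c' (\<lambda>z. v z * ennreal (1 / (1 - cmod z))) \<xi> =
      cone_int ?c' (\<lambda>z. ennreal C * (hweight p f z * indicator G z) + ennreal (\<epsilon> / D) * hweight p f z) \<xi>"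
    proof -
      have "u z * ennreal (1 / (1 - cmod z)) = hweight p f z" for z
        unfolding u_def hweight_def by (cases "z \<in> ball 0 1") (simp_all flip: ennreal_mult)
      moreover have "v z * k = ennreal C * (u z * k * indicator G z) + ennreal (\<epsilon> / D) * (u z * k)" for z k
        unfolding v_def distrib_right by (simp only: mult_ac)
      ultimately have "v z * ennreal (1 / (1 - cmod z)) = ennreal C * (hweight p f z * indicator G z) + ennreal (\<epsilon> / D) * hweight p f z" for z
        by (simp only:)
      then show ?thesis by simp
    qed
    also have "\<dots> = ennreal C * cone_int ?c' (\<lambda>z. hweight p f z * indicator G z) \<xi> + ennreal (\<epsilon> / D) * cone_int ?c' (hweight p f) \<xi>"
      unfolding cone_int_def distrib_right mult.assoc[of "ennreal _"]
      by (subst nn_integral_add, measurable, subst (1 2) nn_integral_cmult) auto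
    also have "ennreal D * \<dots> = ennreal (C * D) * cone_int ?c' (\<lambda>z. hweight p f z * indicator G z) \<xi> + ennreal \<epsilon> * cone_int ?c' (hweight p f) \<xi>"
    proof -
      have "ennreal D * ennreal C = ennreal (C * D)" "ennreal D * ennreal (\<epsilon> / D) = ennreal \<epsilon>"
        using C D \<epsilon> by (simp_all add: mult.commute flip: ennreal_mult)
      then show ?thesis by (simp only: distrib_left mult.assoc[symmetric])
    qed
    finally show "cone_int c (hweight p f) \<xi> \<le> ennreal (C * D) * cone_int ?c' (\<lambda>z. hweight p f z * indicator G z) \<xi>
        + ennreal \<epsilon> * cone_int ?c' (hweight p f) \<xi>" .
  qed (use C D in simp)
qed

lemma hweight_core_finite:
  assumes f: "f holomorphic_on ball 0 1" and p: "0 < p"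
  shows "(\<integral>\<^sup>+z. hweight p f z * indicator (core n) z \<partial>lborel) < \<infinity>"
proof -
  have sub: "cball (0::complex) (1 - 1 / 2 ^ n) \<subseteq> ball 0 1"
  proof
    fix z :: complex assume "z \<in> cball 0 (1 - 1 / 2 ^ n)"
    moreover have "(0::real) < 1 / 2 ^ n" by simp
    ultimately show "z \<in> ball 0 1" unfolding mem_ball_0 mem_cball_0 by linarith
  qed
  have "bounded (f ` cball 0 (1 - 1 / 2 ^ n))"
    using holomorphic_on_imp_continuous_on[OF holomorphic_on_subset[OF f sub]]
    by (intro compact_imp_bounded compact_continuous_image) auto
  then obtain M where M: "\<And>z. z \<in> cball 0 (1 - 1 / 2 ^ n) \<Longrightarrow> cmod (f z) \<le> M"
    unfolding bounded_iff by blast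
  define K where "K = \<bar>M\<bar> powr p * 2 ^ n"
  have "(\<integral>\<^sup>+z. hweight p f z * indicator (core n) z \<partial>lborel) \<le> (\<integral>\<^sup>+z. ennreal K * indicator (ball 0 1) z \<partial>(lborel :: complex measure))"
  proof (rule nn_integral_mono)
    fix z
    show "hweight p f z * indicator (core n) z \<le> ennreal K * indicator (ball 0 1) z"
    proof (cases "z \<in> core n \<and> z \<in> ball 0 1")
      case True
      then have z: "1 / 2 ^ n < 1 - cmod z" unfolding core_def by simp
      then have "z \<in> cball 0 (1 - 1 / 2 ^ n)" unfolding mem_cball_0 by linarith
      then have "cmod (f z) powr p \<le> \<bar>M\<bar> powr p" using M p by (intro powr_mono2) (auto intro: order_trans[OF _ abs_ge_self])
      moreover have "1 / (1 - cmod z) \<le> 1 / (1 / 2 ^ n)" using z True by (intro divide_left_mono mult_pos_pos) auto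
      ultimately have "cmod (f z) powr p * (1 / (1 - cmod z)) \<le> K" unfolding K_def using True by (intro mult_mono) auto
      then show ?thesis using True unfolding hweight_def by (simp add: ennreal_leI)
    qed (auto simp: hweight_def)
  qed
  also have "\<dots> = ennreal K * ennreal pi" by (subst nn_integral_cmult_indicator) (simp_all add: emeasure_ball_complex)
  also have "\<dots> < \<infinity>" by (simp add: ennreal_mult_less_top)
  finally show ?thesis .
qed

text \<open>\<open>aperture_change\<close> demands mass in a fixed ball about 0. A function that is
  not identically zero provides it even if it vanishes at 0, because its zeros form a null
  set.\<close>

lemma hweight_mass_pos:
  assumes f: "f holomorphic_on ball 0 1" and a: "a \<in> ball 0 1" "f a \<noteq> 0"
  shows "0 < (\<integral>\<^sup>+z. hweight p f z * indicator (ball 0 (1/25)) z \<partial>lborel)"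
proof (rule ccontr)
  note [measurable] = hweight_measurable[OF f]
  have [measurable]: "ball (0::complex) (1/25) \<in> sets borel" by simp
  assume "\<not> 0 < (\<integral>\<^sup>+z. hweight p f z * indicator (ball 0 (1/25)) z \<partial>lborel)"
  then have "AE z in lborel. hweight p f z * indicator (ball 0 (1/25)) z = 0"
    by (subst (asm) not_gr_zero, subst (asm) nn_integral_0_iff_AE) measurable
  moreover have "AE z in lborel. z \<notin> {z \<in> ball 0 1. f z = 0}"
  proof (rule AE_not_in)
    show "{z \<in> ball 0 1. f z = 0} \<in> null_sets lborel"
      using zero_set_null[OF f a] zero_set_borel[OF f] by (intro null_setsI) auto
  qed
  ultimately have "AE z in lborel. z \<notin> ball (0::complex) (1/25)"
    by eventually_elim (auto simp: hweight_def split: split_indicator)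
  then have "emeasure lborel (ball (0::complex) (1/25)) = 0"
    by (subst (asm) AE_iff_measurable[of "ball 0 (1/25)"]) auto
  then show False by (subst (asm) emeasure_ball_complex) auto
qed

text \<open>The cones \<open>stolz (11/10)\<close> and \<open>stolz 3\<close> sandwich the tent regions of aperture 1/2.\<close>
lemma sampling_inequality:
  assumes p: "1 \<le> p" and s: "0 < s" and \<eta>: "0 < \<eta>" "\<eta> < 1" and \<delta>: "0 < \<delta>"
    and T: "\<And>\<xi>. cmod \<xi> = 1 \<Longrightarrow> stolz (11/10) \<xi> \<subseteq> T \<xi>" "\<And>\<xi>. cmod \<xi> = 1 \<Longrightarrow> T \<xi> \<subseteq> stolz 3 \<xi>"
  obtains C c' :: real where "0 < C" "1 < c'" 
    "\<And>f G. f holomorphic_on ball 0 1 \<Longrightarrow> G \<in> sets borel \<Longrightarrow>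
      (\<And>\<alpha>. \<alpha> \<in> ball 0 1 \<Longrightarrow> ennreal (\<delta> * (1 - cmod \<alpha>)\<^sup>2) \<le> emeasure lborel (G \<inter> ball \<alpha> (\<eta> * (1 - cmod \<alpha>)))) \<Longrightarrow>
      (tent_power s T (hweight p f)) < \<infinity> \<Longrightarrow>
      (tent_power s T (hweight p f))
        \<le> ennreal C * (cone_power s c' (\<lambda>z. hweight p f z * indicator G z))"
proof -
  define \<eta>' where "\<eta>' = (1 + \<eta>) / 2"
  have \<eta>': "\<eta> < \<eta>'" "\<eta>' < 1" "0 < \<eta>'" unfolding \<eta>'_def using \<eta> by auto
  define c' where "c' = (3 + 1) / (1 - \<eta>')"
  have "4 * 1 \<le> 4 * (1 / (1 - \<eta>'))" using \<eta>' by (intro mult_left_mono) auto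
  then have c': "4 \<le> c'" unfolding c'_def by simp
  obtain A where A: "0 < A" "\<And>w. w \<in> borel_measurable borel \<Longrightarrow>
    (\<And>n. (\<integral>\<^sup>+z. w z * indicator (core n) z \<partial>lborel) < \<infinity>) \<Longrightarrow>
    0 < (\<integral>\<^sup>+z. w z * indicator (ball 0 (1/25)) z \<partial>lborel) \<Longrightarrow>
    (cone_power s c' w)
    \<le> ennreal A * (cone_power s (11/10) w)"
    using aperture_change[OF s, of c'] c' by auto
  \<comment> \<open>With this choice 2^s \<epsilon>^s A = 1/2, so the error term becomes at most
    half of the tent power I.\<close>
  define \<epsilon> where "\<epsilon> = (1 / (2 * 2 powr s * A)) powr (1 / s)"
  have \<epsilon>: "0 < \<epsilon>" "\<epsilon> powr s = 1 / (2 * 2 powr s * A)" unfolding \<epsilon>_def using A s by (auto simp: powr_powr)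
  obtain C where C: "0 < C"
    "\<And>f G \<xi>. f holomorphic_on ball 0 1 \<Longrightarrow> G \<in> sets borel \<Longrightarrow>
      (\<And>\<alpha>. \<alpha> \<in> ball 0 1 \<Longrightarrow> ennreal (\<delta> * (1 - cmod \<alpha>)\<^sup>2) \<le> emeasure lborel (G \<inter> ball \<alpha> (\<eta> * (1 - cmod \<alpha>)))) \<Longrightarrow>
      cone_int 3 (hweight p f) \<xi> \<le> ennreal C * cone_int c' (\<lambda>z. hweight p f z * indicator G z) \<xi>
        + ennreal \<epsilon> * cone_int c' (hweight p f) \<xi>"
    using cone_int_sampling[OF p \<eta>(1) \<eta>'(1,2) \<delta> \<epsilon>(1), of 3] unfolding c'_def by auto
  show ?thesis
  proof (rule that[of "2 * (2 powr s * C powr s)" c'])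
    fix f G assume f: "f holomorphic_on ball 0 1" and G [measurable]: "G \<in> sets borel"
      and dens: "\<And>\<alpha>. \<alpha> \<in> ball 0 1 \<Longrightarrow> ennreal (\<delta> * (1 - cmod \<alpha>)\<^sup>2) \<le> emeasure lborel (G \<inter> ball \<alpha> (\<eta> * (1 - cmod \<alpha>)))"
      and fin: "(tent_power s T (hweight p f)) < \<infinity>"
    note [measurable] = hweight_measurable[OF f]
    define I where "I = (tent_power s T (hweight p f))"
    define X where "X = (cone_power s c' (\<lambda>z. hweight p f z * indicator G z))"
    have "I \<le> ennreal (2 * (2 powr s * C powr s)) * X"
    proof (cases "\<exists>a\<in>ball 0 1. f a \<noteq> 0")
      case False
      then have "hweight p f z = 0" for z unfolding hweight_def by (cases "z \<in> ball 0 1") auto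
      then show ?thesis unfolding I_def by simp
    next
      case True
      then obtain a where a: "a \<in> ball 0 1" "f a \<noteq> 0" by blast
      have ap: "(cone_power s c' (hweight p f))
        \<le> ennreal A * (cone_power s (11/10) (hweight p f))"
        using p by (intro A(2) hweight_measurable[OF f] hweight_core_finite[OF f] hweight_mass_pos[OF f a]) auto
      have lo: "(cone_power s (11/10) (hweight p f)) \<le> I"
        unfolding I_def cone_int_def using T(1) s
        by (intro nn_integral_circle_mono enn_powr_mono nn_integral_mono) (auto split: split_indicator)
      have "I \<le> (cone_power s 3 (hweight p f))"
        unfolding I_def cone_int_def using T(2) s
        by (intro nn_integral_circle_mono enn_powr_mono nn_integral_mono) (auto split: split_indicator)
      also have "\<dots> \<le> (\<integral>\<^sup>+\<xi>. ennreal (2 powr s) * (ennreal (C powr s) * enn_powr (cone_int c' (\<lambda>z. hweight p f z * indicator G z) \<xi>) s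
          + ennreal (\<epsilon> powr s) * enn_powr (cone_int c' (hweight p f) \<xi>) s) \<partial>circle_measure)"
      proof (rule nn_integral_mono)
        fix \<xi>
        have "enn_powr (cone_int 3 (hweight p f) \<xi>) s \<le> enn_powr (ennreal C * cone_int c' (\<lambda>z. hweight p f z * indicator G z) \<xi>
          + ennreal \<epsilon> * cone_int c' (hweight p f) \<xi>) s"
          using s by (intro enn_powr_mono C(2)[OF f G dens]) auto
        also note enn_powr_add_le[OF s]
        finally show "enn_powr (cone_int 3 (hweight p f) \<xi>) s \<le> ennreal (2 powr s) * (ennreal (C powr s) * enn_powr (cone_int c' (\<lambda>z. hweight p f z * indicator G z) \<xi>) s
          + ennreal (\<epsilon> powr s) * enn_powr (cone_int c' (hweight p f) \<xi>) s)"
          by (simp only: enn_powr_cmult[OF C(1)] enn_powr_cmult[OF \<epsilon>(1)])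
      qed
      also have "\<dots> = ennreal (2 powr s) * (ennreal (C powr s) * X
          + ennreal (\<epsilon> powr s) * (cone_power s c' (hweight p f)))"
        unfolding X_def by (simp add: nn_integral_cmult nn_integral_add)
      also have "\<dots> \<le> ennreal (2 powr s) * (ennreal (C powr s) * X + ennreal (\<epsilon> powr s) * (ennreal A * I))"
        by (intro mult_left_mono add_left_mono order_trans[OF ap] lo) auto
      also have "\<dots> = ennreal (2 powr s * C powr s) * X + ennreal (2 powr s) * (ennreal (\<epsilon> powr s) * ennreal A) * I"
        by (simp add: distrib_left mult.assoc ennreal_mult)
      also have "ennreal (2 powr s) * (ennreal (\<epsilon> powr s) * ennreal A) = ennreal (1/2)"
        unfolding \<epsilon>(2) using A by (simp flip: ennreal_mult)
      finally have main: "I \<le> ennreal (2 powr s * C powr s) * X + ennreal (1/2) * I" .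
      \<comment> \<open>Half of I can be subtracted on both sides only because I is finite.\<close>
      obtain i where i: "0 \<le> i" "I = ennreal i" using fin unfolding I_def[symmetric] by (cases I) auto
      show ?thesis
      proof (cases X)
        case (real x)
        define k where "k = 2 powr s * C powr s"
        have "0 \<le> k" unfolding k_def by simp
        then have "ennreal i \<le> ennreal (k * x + i / 2)"
        proof -
          have e: "ennreal (1/2) * ennreal i = ennreal (i / 2)" using i by (subst ennreal_mult[symmetric]) simp_all
          have "ennreal i \<le> ennreal k * ennreal x + ennreal (i / 2)"
            using main unfolding k_def[symmetric] real(2) i(2) e .
          then show ?thesis using \<open>0 \<le> k\<close> real(1) i(1) by (simp flip: ennreal_mult ennreal_plus)
        qed
        then have "i \<le> k * x + i / 2" using \<open>0 \<le> k\<close> real i by (subst (asm) ennreal_le_iff) auto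
        then have "i \<le> 2 * k * x" by linarith
        then show ?thesis using \<open>0 \<le> k\<close> real i unfolding k_def[symmetric] by (simp add: ennreal_leI flip: ennreal_mult)
      next
        case top
        then show ?thesis using C by (simp add: ennreal_mult_top)
      qed
    qed
    then show "(tent_power s T (hweight p f))
        \<le> ennreal (2 * (2 powr s * C powr s)) * (cone_power s c' (\<lambda>z. hweight p f z * indicator G z))"
      unfolding I_def X_def .
  qed (use C c' in auto)
qed

section \<open>Kernel estimates\<close>

text \<open>Each point is charged to one k at which the bound holds; the sets S k may overlap, since
  further terms only increase the sum.\<close>

lemma nn_integral_le_suminf_cover:
  assumes S: "\<And>k::nat. S k \<in> sets M" and m: "\<And>k. emeasure M (S k) \<le> ennreal (m k)"
    and nn: "\<And>k. 0 \<le> c k" "\<And>k. 0 \<le> m k" and sm: "summable (\<lambda>k. c k * m k)"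
    and cover: "\<And>x. f x \<noteq> 0 \<Longrightarrow> \<exists>k. x \<in> S k \<and> f x \<le> ennreal (c k)"
  shows "(\<integral>\<^sup>+x. f x \<partial>M) \<le> ennreal (\<Sum>k. c k * m k)"
proof -
  have "f x \<le> (\<Sum>k. ennreal (c k) * indicator (S k) x)" for x
  proof (cases "f x = 0")
    case False
    then obtain k where k: "x \<in> S k" "f x \<le> ennreal (c k)" using cover by blast
    have "f x \<le> (\<Sum>j\<in>{k}. ennreal (c j) * indicator (S j) x)" using k by simp
    also have "\<dots> \<le> (\<Sum>k. ennreal (c k) * indicator (S k) x)" by (intro sum_le_suminf) auto
    finally show ?thesis .
  qed simp
  then have "(\<integral>\<^sup>+x. f x \<partial>M) \<le> (\<integral>\<^sup>+x. (\<Sum>k. ennreal (c k) * indicator (S k) x) \<partial>M)" by (rule nn_integral_mono)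
  also have "\<dots> = (\<Sum>k. ennreal (c k) * emeasure M (S k))"
    using S by (simp add: nn_integral_suminf nn_integral_cmult_indicator)
  also have "\<dots> \<le> (\<Sum>k. ennreal (c k * m k))"
    using nn m by (intro suminf_le) (auto simp: ennreal_mult mult_left_mono)
  also have "\<dots> = ennreal (\<Sum>k. c k * m k)" using nn sm by (intro suminf_ennreal2) auto
  finally show ?thesis .
qed

lemma dyadic_above:
  assumes "0 < d" "d \<le> (x::real)"
  obtains k where "2 ^ k * d \<le> x" "x < 2 ^ Suc k * d"
proof -
  define P where "P n \<longleftrightarrow> x < 2 ^ n * d" for n
  obtain n where "x / d < 2 ^ n" using real_arch_pow[of 2 "x / d"] by auto
  then have "P n" unfolding P_def using assms by (simp add: field_simps)
  then have L: "P (LEAST n. P n)" by (rule LeastI)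
  have "\<not> P 0" unfolding P_def using assms by simp
  then obtain k where k: "(LEAST n. P n) = Suc k" using L by (cases "LEAST n. P n") auto
  then have "\<not> P k" using not_less_Least[of k P] by simp
  then show ?thesis using that[of k] L k unfolding P_def by auto
qed

text \<open>Passing to 1/x exchanges the open and the closed ends of the dyadic intervals; if x is
  itself a power of 1/2, the index is lowered by one.\<close>

lemma dyadic_below:
  assumes "0 < (x::real)" "x < 1"
  obtains k where "1 / 2 ^ Suc k \<le> x" "x < 1 / 2 ^ k"
proof -
  obtain k where "2 ^ k * 1 \<le> 1 / x" "1 / x < 2 ^ Suc k * 1" using dyadic_above[of 1 "1 / x"] assms by auto
  then have "2 ^ k * x \<le> 1" "1 < 2 ^ Suc k * x" using assms by (auto simp: field_simps)
  show ?thesis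
  proof (cases "2 ^ k * x = 1")
    case False
    then show ?thesis using that[of k] \<open>2 ^ k * x \<le> 1\<close> \<open>1 < 2 ^ Suc k * x\<close> by (simp add: field_simps)
  next
    case True
    then obtain j where "k = Suc j" using assms by (cases k) auto
    then show ?thesis using that[of j] True by (simp add: field_simps)
  qed
qed

text \<open>In the plane |w|^(-3/2) is integrable at 0, where the dyadic discs contribute multiples
  of 2^(-k/2). At infinity the decay of order L >= 4 gives contributions of order 4^(-k).\<close>

lemma plane_integral_finite:
  assumes L: "4 \<le> L"
  shows "(\<integral>\<^sup>+w. ennreal ((1 + cmod w) powr (- L) * cmod w powr (-3/2)) \<partial>lborel) < \<infinity>"
proof -
  let ?f = "\<lambda>w. ennreal ((1 + cmod w) powr (- L) * cmod w powr (-3/2))"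
  have "(\<integral>\<^sup>+w. ?f w * indicator (ball 0 1) w \<partial>lborel) \<le> ennreal (\<Sum>k. 2 powr (3/2 * Suc k) * (pi * (1 / 2 ^ k)\<^sup>2))"
  proof (rule nn_integral_le_suminf_cover[where S = "\<lambda>k. ball 0 (1 / 2 ^ k)"])
    show "summable (\<lambda>k. 2 powr (3/2 * Suc k) * (pi * (1 / 2 ^ k)\<^sup>2))"
    proof -
      have eq: "2 powr (3/2 * Suc k) * (pi * (1 / 2 ^ k)\<^sup>2) = (2 powr (3/2) * pi) * (2 powr (-1/2)) ^ k" for k :: nat
      proof -
        have "(1 / 2 ^ k)\<^sup>2 = (2::real) powr (-2 * k)"
          by (simp add: powr_minus powr_realpow[symmetric] power_divide power2_eq_square powr_add[symmetric] field_simps)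
        moreover have "(2 powr (-1/2)) ^ k = (2::real) powr (-1/2 * k)" by (simp add: powr_powr flip: powr_realpow)
        moreover have "(2::real) powr (3/2 * Suc k) * 2 powr (-2 * k) = 2 powr (3/2) * 2 powr (-1/2 * k)"
          by (simp add: powr_add[symmetric] field_simps)
        ultimately show ?thesis by (simp add: mult_ac)
      qed
      show ?thesis unfolding eq
        by (intro summable_mult summable_geometric) (simp add: powr_less_one)
    qed
    fix w :: complex assume nz: "?f w * indicator (ball 0 1) w \<noteq> 0"
    then have w: "w \<in> ball 0 1" "w \<noteq> 0" by (auto split: split_indicator_asm)
    then obtain k where k: "1 / 2 ^ Suc k \<le> cmod w" "cmod w < 1 / 2 ^ k" using dyadic_below[of "cmod w"] by auto
    have "(1 + cmod w) powr (- L) \<le> (1 + cmod w) powr 0" using L by (intro powr_mono) auto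
    then have "(1 + cmod w) powr (- L) \<le> 1" by (simp split: if_splits)
    moreover have "cmod w powr (-3/2) \<le> (1 / 2 ^ Suc k) powr (-3/2)" using k by (intro powr_mono2') auto
    moreover have "(1 / 2 ^ Suc k) powr (-3/2) = (2::real) powr (3/2 * Suc k)"
    proof -
      have "(1 / 2 ^ Suc k) = (2::real) powr (- real (Suc k))" by (simp add: powr_minus powr_realpow divide_inverse del: of_nat_Suc power_Suc)
      moreover have "- real (Suc k) * (-3/2) = 3/2 * Suc k" by (simp add: field_simps)
      ultimately show ?thesis by (simp only: powr_powr)
    qed
    ultimately have "(1 + cmod w) powr (- L) * cmod w powr (-3/2) \<le> 1 * 2 powr (3/2 * Suc k)"
      by (intro mult_mono) auto
    then show "\<exists>k. w \<in> ball 0 (1 / 2 ^ k) \<and> ?f w * indicator (ball 0 1) w \<le> ennreal (2 powr (3/2 * Suc k))"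
      using k w by (intro exI[of _ k]) (simp add: ennreal_leI)
  qed (auto simp: emeasure_ball_complex)
  moreover have "(\<integral>\<^sup>+w. ?f w * indicator (- ball 0 1) w \<partial>lborel) \<le> ennreal (\<Sum>k. (1 / 16) ^ k * (pi * (2 ^ Suc k)\<^sup>2))"
  proof (rule nn_integral_le_suminf_cover[where S = "\<lambda>k. ball 0 (2 ^ Suc k)"])
    have eq: "(1 / 16) ^ k * (pi * (2 ^ Suc k)\<^sup>2) = (4 * pi) * (1/4) ^ k" for k :: nat
    proof -
      have "((2::real) ^ Suc k)\<^sup>2 = 4 * 4 ^ k" by (simp add: power2_eq_square power_mult_distrib[symmetric])
      moreover have "(1 / 16) ^ k * 4 ^ k = (1/4::real) ^ k" by (simp add: power_mult_distrib[symmetric])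
      ultimately show ?thesis by simp
    qed
    show "summable (\<lambda>k. (1 / 16) ^ k * (pi * (2 ^ Suc k)\<^sup>2))"
      unfolding eq by (intro summable_mult summable_geometric) simp
    fix w :: complex assume "?f w * indicator (- ball 0 1) w \<noteq> 0"
    then have w: "1 \<le> cmod w" by (auto split: split_indicator_asm)
    then obtain k where k: "2 ^ k * 1 \<le> cmod w" "cmod w < 2 ^ Suc k * 1" using dyadic_above[of 1 "cmod w"] by auto
    have "(1 + cmod w) powr (- L) \<le> (1 + cmod w) powr (- 4)" using L by (intro powr_mono) auto
    also have "\<dots> \<le> (2 ^ k) powr (- 4)" using k by (intro powr_mono2') auto
    also have "\<dots> = (1 / 16) ^ k"
    proof -
      have "(2 ^ k) powr (- 4) = 1 / ((2::real) ^ k) ^ 4" by (simp add: powr_minus_divide)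
      also have "((2::real) ^ k) ^ 4 = 16 ^ k" by (simp add: power_mult[symmetric] mult.commute[of k]) (simp add: power_mult)
      finally show ?thesis by (simp add: power_divide)
    qed
    finally have 1: "(1 + cmod w) powr (- L) \<le> (1 / 16) ^ k" .
    have "cmod w powr (-3/2) \<le> cmod w powr 0" using w by (intro powr_mono) auto
    then have "cmod w powr (-3/2) \<le> 1" using w by (simp split: if_splits)
    with 1 have "(1 + cmod w) powr (- L) * cmod w powr (-3/2) \<le> (1 / 16) ^ k * 1" by (intro mult_mono) auto
    then show "\<exists>k. w \<in> ball 0 (2 ^ Suc k) \<and> ?f w * indicator (- ball 0 1) w \<le> ennreal ((1 / 16) ^ k)"
      using k w by (intro exI[of _ k]) (simp add: ennreal_leI)
  qed (auto simp: emeasure_ball_complex)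
  moreover have "(\<integral>\<^sup>+w. ?f w \<partial>lborel) = (\<integral>\<^sup>+w. ?f w * indicator (ball 0 1) w \<partial>lborel) + (\<integral>\<^sup>+w. ?f w * indicator (- ball 0 1) w \<partial>lborel)"
  proof -
    have [measurable]: "ball (0::complex) 1 \<in> sets borel" by simp
    show ?thesis by (subst nn_integral_add[symmetric]) (auto intro!: nn_integral_cong split: split_indicator)
  qed
  ultimately show ?thesis by (simp add: le_less_trans)
qed

section \<open>The kernel |1 - cnj a z| on cones and on the circle\<close>

abbreviation kden :: "complex \<Rightarrow> complex \<Rightarrow> real" where
  "kden a z \<equiv> cmod (1 - cnj a * z)"

text \<open>Divided by the square of \<open>kden\<close>, the left side is 1 minus the squared
  pseudohyperbolic distance. The bounds for the kernel inside and outside a pseudohyperbolic disc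
  both come from this identity.\<close>

lemma kden_identity: "(kden a z)\<^sup>2 - (cmod (a - z))\<^sup>2 = (1 - (cmod a)\<^sup>2) * (1 - (cmod z)\<^sup>2)"
  unfolding cmod_power2 by (simp add: power2_eq_square algebra_simps)

lemma kden_ge_compl:
  assumes "cmod a < 1"
  shows "1 - cmod z \<le> kden a z"
proof -
  have "cmod (cnj a * z) \<le> 1 * cmod z" unfolding norm_mult using assms by (intro mult_right_mono) auto
  then show ?thesis using norm_triangle_ineq2[of 1 "cnj a * z"] by simp
qed

lemma kden_ge:
  assumes "cmod a < 1" "cmod z \<le> 1"
  shows "1 - cmod a \<le> kden a z"
proof -
  have "cmod (cnj a * z) \<le> cmod a * 1" unfolding norm_mult using assms by (intro mult_mono) auto
  then show ?thesis using norm_triangle_ineq2[of 1 "cnj a * z"] by simp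
qed

lemma kden_lipschitz:
  assumes "cmod a < 1"
  shows "kden a z \<le> kden a w + cmod (z - w)"
proof -
  have eq: "1 - cnj a * z = (1 - cnj a * w) - cnj a * (z - w)" by (simp add: algebra_simps)
  have "kden a z \<le> kden a w + cmod (cnj a * (z - w))" unfolding eq by (rule norm_triangle_ineq4)
  also have "cmod (cnj a * (z - w)) \<le> 1 * cmod (z - w)" unfolding norm_mult using assms by (intro mult_right_mono) auto
  finally show ?thesis by simp
qed

text \<open>In a cone |z - \<xi>| <= c (1 - |z|) and 1 - |z| is at most the kernel at z, so that
  kernel controls both the distance to the vertex and, by the Lipschitz bound, the kernel at the
  vertex.\<close>

lemma kden_cone:
  assumes a: "cmod a < 1" and c: "0 < c" and z: "z \<in> stolz c \<xi>"
  shows "kden a \<xi> + cmod (z - \<xi>) \<le> (1 + 2 * c) * kden a z"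
proof -
  have "cmod (z - \<xi>) \<le> c * (1 - cmod z)" using z unfolding stolz_def by simp
  also have "\<dots> \<le> c * kden a z" using kden_ge_compl[OF a] c by (intro mult_left_mono) auto
  finally have 1: "cmod (z - \<xi>) \<le> c * kden a z" .
  have "kden a \<xi> \<le> kden a z + cmod (z - \<xi>)" using kden_lipschitz[OF a, of \<xi> z] by (simp add: norm_minus_commute)
  then show ?thesis using 1 by (simp add: algebra_simps)
qed

text \<open>Substituting \<open>z = \<xi> + kden a \<xi> * w\<close> reduces this to a single integral over the plane.\<close>
lemma cone_kernel_bound:
  assumes M: "5 \<le> M" and c: "0 < c"
  obtains A :: real where "0 < A" "\<And>a \<xi>. cmod a < 1 \<Longrightarrow> cmod \<xi> = 1 \<Longrightarrow>
    (\<integral>\<^sup>+z. ennreal (kden a z powr (1 - M) * (1 - cmod z) powr (-3/2)) * indicator (stolz c \<xi>) z \<partial>lborel)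
      \<le> ennreal (A * kden a \<xi> powr (3/2 - M))"
proof -
  define J where "J = (\<integral>\<^sup>+w. ennreal ((1 + cmod w) powr (- (M - 1)) * cmod w powr (-3/2)) \<partial>lborel)"
  have "J < \<infinity>" unfolding J_def using M by (intro plane_integral_finite) auto
  then obtain j where j: "0 \<le> j" "J = ennreal j" by (cases J) auto
  define B where "B = (1 + 2 * c) powr (M - 1) * c powr (3/2)"
  have B: "0 < B" unfolding B_def using c by simp
  show ?thesis
  proof (rule that[of "B * (j + 1)"])
    fix a \<xi> :: complex assume a: "cmod a < 1" and \<xi>: "cmod \<xi> = 1"
    define R where "R = kden a \<xi>"
    have "1 - cmod a \<le> R" unfolding R_def using a \<xi> by (intro kden_ge) simp_all
    then have R: "0 < R" using a by linarith
    define F where "F z = ennreal ((R + cmod (z - \<xi>)) powr (1 - M) * cmod (z - \<xi>) powr (-3/2))" for z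
    have [measurable]: "F \<in> borel_measurable borel" unfolding F_def by measurable
    have "(\<integral>\<^sup>+z. ennreal (kden a z powr (1 - M) * (1 - cmod z) powr (-3/2)) * indicator (stolz c \<xi>) z \<partial>lborel)
       \<le> (\<integral>\<^sup>+z. ennreal B * F z \<partial>lborel)"
    proof (rule nn_integral_mono)
      fix z
      show "ennreal (kden a z powr (1 - M) * (1 - cmod z) powr (-3/2)) * indicator (stolz c \<xi>) z \<le> ennreal B * F z"
      proof (cases "z \<in> stolz c \<xi>")
        case True
        then have z1: "cmod z < 1" using stolz_subset_disc[OF c, of \<xi>] by auto
        have "z \<noteq> \<xi>" using z1 \<xi> by auto
        have "(R + cmod (z - \<xi>)) / (1 + 2 * c) \<le> kden a z"
          using kden_cone[OF a c True] c unfolding R_def by (simp add: pos_divide_le_eq mult.commute)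
        then have "kden a z powr (1 - M) \<le> ((R + cmod (z - \<xi>)) / (1 + 2 * c)) powr (1 - M)"
          using R c M by (intro powr_mono2') (auto intro!: divide_pos_pos add_pos_nonneg)
        also have "\<dots> = (1 + 2 * c) powr (M - 1) * (R + cmod (z - \<xi>)) powr (1 - M)"
          using R c by (simp add: powr_divide powr_minus_divide[of _ "M - 1", simplified])
        finally have 1: "kden a z powr (1 - M) \<le> (1 + 2 * c) powr (M - 1) * (R + cmod (z - \<xi>)) powr (1 - M)" .
        have "cmod (z - \<xi>) / c \<le> 1 - cmod z" using True c unfolding stolz_def by (simp add: pos_divide_le_eq mult.commute)
        then have "(1 - cmod z) powr (-3/2) \<le> (cmod (z - \<xi>) / c) powr (-3/2)"
          using \<open>z \<noteq> \<xi>\<close> c by (intro powr_mono2') auto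
        also have "\<dots> = c powr (3/2) * cmod (z - \<xi>) powr (-3/2)"
          using c by (simp add: powr_divide powr_minus_divide[of _ "3/2", simplified])
        finally have "kden a z powr (1 - M) * (1 - cmod z) powr (-3/2) \<le>
          ((1 + 2 * c) powr (M - 1) * (R + cmod (z - \<xi>)) powr (1 - M)) * (c powr (3/2) * cmod (z - \<xi>) powr (-3/2))"
          using 1 by (intro mult_mono) auto
        also have "\<dots> = B * ((R + cmod (z - \<xi>)) powr (1 - M) * cmod (z - \<xi>) powr (-3/2))" unfolding B_def by simp
        finally show ?thesis using True B unfolding F_def by (simp add: ennreal_leI flip: ennreal_mult)
      qed simp
    qed
    also have "\<dots> = ennreal B * (\<integral>\<^sup>+z. F z \<partial>lborel)" by (rule nn_integral_cmult) measurable
    also have "(\<integral>\<^sup>+z. F z \<partial>lborel) = ennreal (R powr (3/2 - M)) * J"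
    proof -
      \<comment> \<open>Powers of R: 1 - M from the kernel, -3/2 from the height, and 2 from the
        Jacobian restored below, in total 3/2 - M.\<close>
      have "F (\<xi> + of_real R * w) = ennreal (R powr (1 - M - 3/2)) * ennreal ((1 + cmod w) powr (- (M - 1)) * cmod w powr (-3/2))" for w
      proof -
        have "F (\<xi> + of_real R * w) = ennreal ((R * (1 + cmod w)) powr (1 - M) * (R * cmod w) powr (-3/2))"
          unfolding F_def using R by (simp add: norm_mult algebra_simps)
        also have "(R * (1 + cmod w)) powr (1 - M) * (R * cmod w) powr (-3/2)
          = (R powr (1 - M) * R powr (-3/2)) * ((1 + cmod w) powr (1 - M) * cmod w powr (-3/2))"
          by (simp only: powr_mult mult_ac)
        also have "R powr (1 - M) * R powr (-3/2) = R powr (1 - M - 3/2)" by (simp only: powr_add[symmetric]) simp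
        finally show ?thesis by (simp add: ennreal_mult)
      qed
      then have "ennreal (R powr (1 - M - 3/2)) * J = ennreal (1 / R\<^sup>2) * (\<integral>\<^sup>+z. F z \<partial>lborel)"
        unfolding J_def using R by (subst nn_integral_lborel_affine[symmetric, of F R \<xi>]) (simp_all add: nn_integral_cmult)
      then have "ennreal (R\<^sup>2) * (ennreal (R powr (1 - M - 3/2)) * J) = ennreal (R\<^sup>2) * (ennreal (1 / R\<^sup>2) * (\<integral>\<^sup>+z. F z \<partial>lborel))" by simp
      moreover have "ennreal (R\<^sup>2) * ennreal (1 / R\<^sup>2) = 1" using R by (simp flip: ennreal_mult)
      moreover have "ennreal (R\<^sup>2) * ennreal (R powr (1 - M - 3/2)) = ennreal (R powr (3/2 - M))"
      proof -
        have "R\<^sup>2 = R powr 2" using R by simp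
        then have "R\<^sup>2 * R powr (1 - M - 3/2) = R powr (3/2 - M)" by (simp only: powr_add[symmetric]) simp
        then show ?thesis by (simp flip: ennreal_mult)
      qed
      ultimately show ?thesis by (simp add: mult.assoc[symmetric])
    qed
    also have "ennreal B * (ennreal (R powr (3/2 - M)) * J) \<le> ennreal (B * (j + 1) * R powr (3/2 - M))"
    proof -
      have "ennreal B * (ennreal (R powr (3/2 - M)) * J) = ennreal (B * (R powr (3/2 - M) * j))"
        unfolding j(2) using j(1) B by (simp add: ennreal_mult[symmetric])
      moreover have "B * (R powr (3/2 - M) * j) \<le> B * (j + 1) * R powr (3/2 - M)" using B by (simp add: algebra_simps)
      ultimately show ?thesis by (simp only: ennreal_leI)
    qed
    finally show "(\<integral>\<^sup>+z. ennreal (kden a z powr (1 - M) * (1 - cmod z) powr (-3/2)) * indicator (stolz c \<xi>) z \<partial>lborel)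
      \<le> ennreal (B * (j + 1) * kden a \<xi> powr (3/2 - M))" unfolding R_def .
  qed (use B j in simp)
qed

lemma unit_direction:
  obtains u where "cmod u = 1" "a = of_real (cmod a) * u"
proof (cases "a = 0")
  case True then show ?thesis using that[of 1] by simp
next
  case False then show ?thesis using that[of "a / of_real (cmod a)"] by (simp add: norm_divide)
qed

text \<open>On the circle the distance to the projection u of a is at most twice the kernel, so the
  set where the kernel is below 2^(k+1) d lies in a ball of radius 4 (2^k d) about u and has measure
  O(2^k d). Weighted with (2^k d)^(-(2+\<gamma>)) these measures sum geometrically.\<close>

lemma circle_kernel_bound:
  assumes a: "cmod a < 1" and \<gamma>: "0 \<le> \<gamma>"
  shows "(\<integral>\<^sup>+\<xi>. ennreal (kden a \<xi> powr (- (2 + \<gamma>))) \<partial>circle_measure) \<le> ennreal (192 * (1 - cmod a) powr (- (1 + \<gamma>)))"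
proof -
  define d where "d = 1 - cmod a"
  have d: "0 < d" unfolding d_def using a by simp
  obtain u where u: "cmod u = 1" "a = of_real (cmod a) * u" by (rule unit_direction)
  have near: "cmod (u - \<xi>) \<le> 2 * kden a \<xi>" if \<xi>: "cmod \<xi> = 1" for \<xi>
  proof -
    have uu: "u * cnj u = 1" using u(1) by (simp add: complex_norm_square[symmetric])
    have "cnj a = of_real (cmod a) * cnj u" using arg_cong[OF u(2), of cnj] by simp
    then have "u * (1 - cnj a * \<xi>) = u - of_real (cmod a) * (u * cnj u) * \<xi>"
      by (simp only: right_diff_distrib mult_1_left mult_1_right mult_ac)
    then have "u - of_real (cmod a) * \<xi> = u * (1 - cnj a * \<xi>)" unfolding uu by simp
    then have "cmod (u - of_real (cmod a) * \<xi>) = kden a \<xi>" using u(1) by (simp add: norm_mult)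
    moreover have "cmod (of_real (cmod a) * \<xi> - \<xi>) = d"
    proof -
      have "of_real (cmod a) * \<xi> - \<xi> = of_real (cmod a - 1) * \<xi>" by (simp add: algebra_simps)
      then have "cmod (of_real (cmod a) * \<xi> - \<xi>) = \<bar>cmod a - 1\<bar>" by (simp only: norm_mult norm_of_real \<xi>) simp
      then show ?thesis unfolding d_def using a by simp
    qed
    moreover have "cmod (u - \<xi>) \<le> cmod (u - of_real (cmod a) * \<xi>) + cmod (of_real (cmod a) * \<xi> - \<xi>)"
      using norm_triangle_ineq[of "u - of_real (cmod a) * \<xi>" "of_real (cmod a) * \<xi> - \<xi>"] by simp
    ultimately show ?thesis using kden_ge[OF a, of \<xi>] \<xi> unfolding d_def by simp
  qed
  define S where "S k = {\<xi>. kden a \<xi> < 2 ^ Suc k * d}" for k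
  have S_open: "open (S k)" for k unfolding S_def by (intro open_Collect_less continuous_intros)
  have eq: "((1/4) ^ k * d powr (- (2 + \<gamma>))) * (24 * (2 * (2 ^ Suc k * d))) = (96 * d powr (- (1 + \<gamma>))) * (1/2) ^ k" for k
  proof -
    have "(1/4) ^ k * 2 ^ k = (1/2::real) ^ k" by (simp add: power_mult_distrib[symmetric])
    moreover have "d powr (- (2 + \<gamma>)) * d = d powr (- (1 + \<gamma>))"
    proof -
      have "d powr (- (2 + \<gamma>)) * d powr 1 = d powr (- (1 + \<gamma>))" by (simp only: powr_add[symmetric]) simp
      then show ?thesis using d by simp
    qed
    moreover have "((1/4) ^ k * d powr (- (2 + \<gamma>))) * (24 * (2 * (2 ^ Suc k * d))) = 96 * ((1/4) ^ k * 2 ^ k) * (d powr (- (2 + \<gamma>)) * d)"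
      by simp
    ultimately show ?thesis by simp
  qed
  have "(\<integral>\<^sup>+\<xi>. ennreal (kden a \<xi> powr (- (2 + \<gamma>))) \<partial>circle_measure)
    \<le> (\<integral>\<^sup>+\<xi>. ennreal (kden a \<xi> powr (- (2 + \<gamma>))) * indicator (sphere 0 1) \<xi> \<partial>circle_measure)"
    by (rule nn_integral_circle_mono) simp
  also have "\<dots> \<le> ennreal (\<Sum>k. ((1/4) ^ k * d powr (- (2 + \<gamma>))) * (24 * (2 * (2 ^ Suc k * d))))"
  proof (rule nn_integral_le_suminf_cover[where S = S])
    show "S k \<in> sets circle_measure" for k using S_open by simp
    show "emeasure circle_measure (S k) \<le> ennreal (24 * (2 * (2 ^ Suc k * d)))" for k
    proof -
      have "emeasure circle_measure (S k) \<le> emeasure circle_measure (ball u (2 * (2 ^ Suc k * d)))"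
      proof (rule emeasure_mono_AE)
        show "AE \<xi> in circle_measure. \<xi> \<in> S k \<longrightarrow> \<xi> \<in> ball u (2 * (2 ^ Suc k * d))"
          using AE_circle by eventually_elim (use near in \<open>fastforce simp: S_def dist_norm\<close>)
      qed simp
      also have "\<dots> \<le> ennreal (24 * (2 * (2 ^ Suc k * d)))" using d by (intro circle_ball_upper) simp
      finally show ?thesis .
    qed
    show "summable (\<lambda>k. ((1/4) ^ k * d powr (- (2 + \<gamma>))) * (24 * (2 * (2 ^ Suc k * d))))"
      unfolding eq by (intro summable_mult summable_geometric) simp
    fix \<xi> assume "ennreal (kden a \<xi> powr (- (2 + \<gamma>))) * indicator (sphere 0 1) \<xi> \<noteq> 0"
    then have \<xi>: "cmod \<xi> = 1" by (auto split: split_indicator_asm)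
    then obtain k where k: "2 ^ k * d \<le> kden a \<xi>" "kden a \<xi> < 2 ^ Suc k * d"
      using dyadic_above[OF d, of "kden a \<xi>"] kden_ge[OF a, of \<xi>] unfolding d_def by auto
    have "kden a \<xi> powr (- (2 + \<gamma>)) \<le> (2 ^ k * d) powr (- (2 + \<gamma>))" using k d \<gamma> by (intro powr_mono2') auto
    also have "\<dots> = (2 ^ k) powr (- (2 + \<gamma>)) * d powr (- (2 + \<gamma>))" by (rule powr_mult)
    also have "\<dots> \<le> (2 ^ k) powr (- 2) * d powr (- (2 + \<gamma>))" using \<gamma> by (intro mult_right_mono powr_mono) auto
    also have "(2 ^ k) powr (- 2) = (1/4::real) ^ k"
    proof -
      have "(2 ^ k) powr (- 2) = 1 / ((2::real) ^ k) ^ 2" by (simp add: powr_minus_divide)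
      also have "((2::real) ^ k) ^ 2 = 4 ^ k" by (simp add: power_mult[symmetric] mult.commute[of k]) (simp add: power_mult)
      finally show ?thesis by (simp add: power_divide)
    qed
    finally show "\<exists>k. \<xi> \<in> S k \<and> ennreal (kden a \<xi> powr (- (2 + \<gamma>))) * indicator (sphere 0 1) \<xi> \<le> ennreal ((1/4) ^ k * d powr (- (2 + \<gamma>)))"
      using k \<xi> unfolding S_def by (intro exI[of _ k]) (simp add: ennreal_leI)
  qed (use d in auto)
  also have "(\<Sum>k. ((1/4) ^ k * d powr (- (2 + \<gamma>))) * (24 * (2 * (2 ^ Suc k * d)))) = 192 * d powr (- (1 + \<gamma>))"
    unfolding eq by (simp add: suminf_mult suminf_geometric)
  finally show ?thesis unfolding d_def .
qed

section \<open>Test functions and necessity of the density condition\<close>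

lemma kden_pos: "cmod a < 1 \<Longrightarrow> cmod z \<le> 1 \<Longrightarrow> 0 < kden a z"
  using kden_ge[of a z] by linarith

lemma mem_pseudo_disc_iff:
  assumes "cmod a < 1"
  shows "z \<in> pseudo_disc a \<eta> \<longleftrightarrow> cmod z < 1 \<and> cmod (a - z) < \<eta> * kden a z"
  unfolding pseudo_disc_def using kden_pos[OF assms, of z]
  by (auto simp: norm_divide pos_divide_less_eq)

text \<open>The kernel identity read inside the disc. Combined with the lower bounds 1 - |a| and 1 -
  |z| for the kernel it yields the height bound and the enclosing Euclidean ball.\<close>

lemma pseudo_disc_kden_le:
  assumes a: "cmod a < 1" and \<eta>: "0 < \<eta>" and z: "z \<in> pseudo_disc a \<eta>"
  shows "(1 - \<eta>\<^sup>2) * (kden a z)\<^sup>2 \<le> 4 * (1 - cmod a) * (1 - cmod z)"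
proof -
  have z': "cmod z < 1" "cmod (a - z) < \<eta> * kden a z" using z mem_pseudo_disc_iff[OF a] by auto
  have "(cmod (a - z))\<^sup>2 \<le> (\<eta> * kden a z)\<^sup>2" using z' by (intro power_mono) auto
  then have "(1 - \<eta>\<^sup>2) * (kden a z)\<^sup>2 \<le> (1 - (cmod a)\<^sup>2) * (1 - (cmod z)\<^sup>2)"
    unfolding kden_identity[symmetric] by (simp add: power_mult_distrib algebra_simps)
  also have "\<dots> = ((1 - cmod a) * (1 - cmod z)) * ((1 + cmod a) * (1 + cmod z))" by (simp add: power2_eq_square algebra_simps)
  also have "\<dots> \<le> ((1 - cmod a) * (1 - cmod z)) * (2 * 2)" using a z' by (intro mult_left_mono mult_mono) auto
  also have "\<dots> = 4 * (1 - cmod a) * (1 - cmod z)" by simp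
  finally show ?thesis .
qed

text \<open>The kernel identity read outside the disc: the factor 1 - \<eta>^2, small for a large
  disc, is the \<theta> of \<open>testfun_cone_outer\<close>.\<close>

lemma pseudo_disc_compl_kden_ge:
  assumes a: "cmod a < 1" and \<eta>: "0 < \<eta>" and z: "cmod z < 1" "z \<notin> pseudo_disc a \<eta>"
  shows "(1 - cmod a) * (1 - cmod z) \<le> (1 - \<eta>\<^sup>2) * (kden a z)\<^sup>2"
proof -
  have "\<eta> * kden a z \<le> cmod (a - z)" using z mem_pseudo_disc_iff[OF a] by auto
  then have "(\<eta> * kden a z)\<^sup>2 \<le> (cmod (a - z))\<^sup>2" using \<eta> by (intro power_mono) auto
  moreover have "((1 - cmod a) * (1 - cmod z)) * (1 * 1) \<le> ((1 - cmod a) * (1 - cmod z)) * ((1 + cmod a) * (1 + cmod z))"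
    using a z by (intro mult_left_mono mult_mono) auto
  moreover have "((1 - cmod a) * (1 - cmod z)) * ((1 + cmod a) * (1 + cmod z)) = (kden a z)\<^sup>2 - (cmod (a - z))\<^sup>2"
    unfolding kden_identity by (simp add: power2_eq_square algebra_simps)
  ultimately show ?thesis by (simp add: power_mult_distrib algebra_simps)
qed

lemma pseudo_disc_height:
  assumes a: "cmod a < 1" and \<eta>: "0 < \<eta>" "\<eta> < 1" and z: "z \<in> pseudo_disc a \<eta>"
  shows "(1 - \<eta>\<^sup>2) * (1 - cmod a) / 4 \<le> 1 - cmod z"
proof -
  have z1: "cmod z < 1" using z mem_pseudo_disc_iff[OF a] by auto
  have \<eta>2: "\<eta>\<^sup>2 < 1" using \<eta> by (simp add: abs_square_less_1)
  have "(1 - cmod a)\<^sup>2 \<le> (kden a z)\<^sup>2" using a z1 by (intro power_mono kden_ge) auto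
  then have "(1 - \<eta>\<^sup>2) * (1 - cmod a)\<^sup>2 \<le> (1 - \<eta>\<^sup>2) * (kden a z)\<^sup>2" using \<eta>2 by (intro mult_left_mono) auto
  also have "\<dots> \<le> 4 * (1 - cmod a) * (1 - cmod z)" by (rule pseudo_disc_kden_le[OF a \<eta>(1) z])
  finally have "(1 - cmod a) * ((1 - \<eta>\<^sup>2) * (1 - cmod a)) \<le> (1 - cmod a) * (4 * (1 - cmod z))"
    by (simp only: power2_eq_square mult_ac)
  then show ?thesis using a by (simp add: mult_le_cancel_left_pos)
qed

lemma pseudo_disc_subset_ball:
  assumes a: "cmod a < 1" and \<eta>: "0 < \<eta>" "\<eta> < 1"
  shows "pseudo_disc a \<eta> \<subseteq> ball a (4 * (1 - cmod a) / (1 - \<eta>\<^sup>2))"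
proof
  fix z assume z: "z \<in> pseudo_disc a \<eta>"
  have z1: "cmod z < 1" "cmod (a - z) < \<eta> * kden a z" using z mem_pseudo_disc_iff[OF a] by auto
  have \<eta>2: "\<eta>\<^sup>2 < 1" using \<eta> by (simp add: abs_square_less_1)
  have k: "0 < kden a z" using kden_pos[OF a] z1 by simp
  have "(1 - \<eta>\<^sup>2) * (kden a z)\<^sup>2 \<le> 4 * (1 - cmod a) * (1 - cmod z)" by (rule pseudo_disc_kden_le[OF a \<eta>(1) z])
  also have "\<dots> \<le> 4 * (1 - cmod a) * kden a z" using a by (intro mult_left_mono kden_ge_compl) auto
  finally have "kden a z * ((1 - \<eta>\<^sup>2) * kden a z) \<le> kden a z * (4 * (1 - cmod a))"
    by (simp only: power2_eq_square mult_ac)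
  then have "(1 - \<eta>\<^sup>2) * kden a z \<le> 4 * (1 - cmod a)" using k by (simp only: mult_le_cancel_left_pos)
  then have "kden a z \<le> 4 * (1 - cmod a) / (1 - \<eta>\<^sup>2)" using \<eta>2 by (simp add: pos_le_divide_eq mult.commute)
  moreover have "\<eta> * kden a z \<le> 1 * kden a z" using \<eta> by (intro mult_right_mono) auto
  ultimately show "z \<in> ball a (4 * (1 - cmod a) / (1 - \<eta>\<^sup>2))" using z1 by (simp add: dist_norm)
qed

text \<open>A branch of the power for which the p-th power of the modulus is the kernel to the power
  -M; the principal branch is holomorphic on the disc because the base has positive real part when
  |a| < 1.\<close>

definition testfun :: "real \<Rightarrow> real \<Rightarrow> complex \<Rightarrow> complex \<Rightarrow> complex" where
  "testfun p M a z = (1 - cnj a * z) powr of_real (- M / p)"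

lemma testfun_holomorphic:
  assumes a: "cmod a < 1"
  shows "testfun p M a holomorphic_on ball 0 1"
proof -
  have "1 - cnj a * z \<notin> \<real>\<^sub>\<le>\<^sub>0" if "z \<in> ball 0 1" for z
  proof
    have "cmod (cnj a * z) \<le> 1 * cmod z" unfolding norm_mult using a by (intro mult_right_mono) auto
    then have "Re (cnj a * z) < 1" using that complex_Re_le_cmod[of "cnj a * z"] by simp
    moreover assume "1 - cnj a * z \<in> \<real>\<^sub>\<le>\<^sub>0"
    ultimately show False by (auto simp: complex_nonpos_Reals_iff)
  qed
  then show ?thesis unfolding testfun_def[abs_def] by (intro holomorphic_intros) auto
qed

lemma norm_testfun_powr:
  assumes a: "cmod a < 1" and z: "cmod z < 1" and p: "0 < p"
  shows "cmod (testfun p M a z) powr p = kden a z powr (- M)"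
proof -
  have k: "0 < kden a z" using kden_pos[OF a] z by simp
  then have nz: "1 - cnj a * z \<noteq> 0" by auto
  have "cmod (testfun p M a z) = exp (- M / p * ln (kden a z))"
    unfolding testfun_def powr_def using nz by (simp add: norm_exp_eq_Re)
  also have "\<dots> powr p = kden a z powr (- M)" using k p by (simp add: powr_def)
  finally show ?thesis .
qed

lemma hweight_testfun:
  assumes a: "cmod a < 1" and p: "0 < p"
  shows "hweight p (testfun p M a) z = ennreal (kden a z powr (- M) / (1 - cmod z)) * indicator (ball 0 1) z"
  unfolding hweight_def using norm_testfun_powr[OF a _ p] by (auto split: split_indicator)

text \<open>Half a power of the height is traded for the small factor: sqrt (1 - |z|) is at most
  sqrt (\<theta>/(1 - |a|)) times the kernel. This leaves (1 - |z|)^(-3/2), still integrable over a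
  cone, whereas a full power would leave (1 - |z|)^(-2), which is not. Small \<theta> serves the
  complement of a disc, \<theta> = 1 the whole tent norm.\<close>

lemma testfun_cone_outer:
  assumes p: "0 < p" and M: "5 \<le> M" and c: "0 < c"
  shows "\<exists>A>0. \<forall>a \<xi> \<theta> Z. cmod a < 1 \<longrightarrow> cmod \<xi> = 1 \<longrightarrow> 0 \<le> \<theta> \<longrightarrow>
    (\<forall>z\<in>Z. cmod z < 1 \<longrightarrow> (1 - cmod a) * (1 - cmod z) \<le> \<theta> * (kden a z)\<^sup>2) \<longrightarrow>
    cone_int c (\<lambda>z. hweight p (testfun p M a) z * indicator Z z) \<xi>
      \<le> ennreal (A * sqrt \<theta> / sqrt (1 - cmod a) * kden a \<xi> powr (3/2 - M))"
proof -
  obtain A where A: "0 < A" "\<And>a \<xi>. cmod a < 1 \<Longrightarrow> cmod \<xi> = 1 \<Longrightarrow>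
    (\<integral>\<^sup>+z. ennreal (kden a z powr (1 - M) * (1 - cmod z) powr (-3/2)) * indicator (stolz c \<xi>) z \<partial>lborel)
      \<le> ennreal (A * kden a \<xi> powr (3/2 - M))"
    by (rule cone_kernel_bound[OF M c]) (rule that)
  show ?thesis
  proof (intro exI[of _ A] conjI A(1) allI impI)
    fix a \<xi> \<theta> Z assume a: "cmod a < 1" and \<xi>: "cmod \<xi> = 1" and \<theta>: "0 \<le> (\<theta>::real)"
      and Z: "\<forall>z\<in>Z. cmod z < 1 \<longrightarrow> (1 - cmod a) * (1 - cmod z) \<le> \<theta> * (kden a z)\<^sup>2"
    define d where "d = 1 - cmod a"
    have d: "0 < d" unfolding d_def using a by simp
    have "cone_int c (\<lambda>z. hweight p (testfun p M a) z * indicator Z z) \<xi>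
      \<le> (\<integral>\<^sup>+z. ennreal (sqrt \<theta> / sqrt d) * (ennreal (kden a z powr (1 - M) * (1 - cmod z) powr (-3/2)) * indicator (stolz c \<xi>) z) \<partial>lborel)"
      unfolding cone_int_def
    proof (rule nn_integral_mono)
      fix z
      show "hweight p (testfun p M a) z * indicator Z z * indicator (stolz c \<xi>) z
         \<le> ennreal (sqrt \<theta> / sqrt d) * (ennreal (kden a z powr (1 - M) * (1 - cmod z) powr (-3/2)) * indicator (stolz c \<xi>) z)"
      proof (cases "z \<in> stolz c \<xi> \<and> z \<in> Z")
        case True
        then have z: "cmod z < 1" using stolz_subset_disc[OF c, of \<xi>] by auto
        define h where "h = 1 - cmod z"
        define k where "k = kden a z"
        have h: "0 < h" unfolding h_def using z by simp
        have k: "0 < k" unfolding k_def using kden_pos[OF a] z by simp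
        have "sqrt (d * h) \<le> sqrt (\<theta> * k\<^sup>2)" using Z True z unfolding d_def h_def k_def by simp
        then have "sqrt d * sqrt h \<le> sqrt \<theta> * k" using k by (simp add: real_sqrt_mult)
        then have sq: "sqrt h \<le> sqrt \<theta> / sqrt d * k" using d by (simp add: field_simps)
        have "k powr (- M) / h = (k powr (- M) * h powr (-3/2)) * sqrt h"
        proof -
          have "h powr (-3/2) * h powr (1/2) = h powr (- 1)" by (simp only: powr_add[symmetric]) simp
          then have "h powr (-3/2) * sqrt h = 1 / h" using h by (simp add: powr_half_sqrt powr_minus_divide)
          then show ?thesis by (simp add: mult.assoc)
        qed
        also have "\<dots> \<le> (k powr (- M) * h powr (-3/2)) * (sqrt \<theta> / sqrt d * k)" using sq by (intro mult_left_mono) auto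
        also have "\<dots> = sqrt \<theta> / sqrt d * ((k powr (- M) * k powr 1) * h powr (-3/2))" using k by simp
        also have "k powr (- M) * k powr 1 = k powr (1 - M)" by (simp only: powr_add[symmetric]) simp
        finally have "k powr (- M) / h \<le> sqrt \<theta> / sqrt d * (k powr (1 - M) * h powr (-3/2))" .
        then have "ennreal (k powr (- M) / h) \<le> ennreal (sqrt \<theta> / sqrt d) * ennreal (k powr (1 - M) * h powr (-3/2))"
          using \<theta> d by (subst ennreal_mult[symmetric]) (auto intro: ennreal_leI)
        then show ?thesis using True z unfolding hweight_testfun[OF a p] h_def k_def by simp
      qed auto
    qed
    also have "\<dots> = ennreal (sqrt \<theta> / sqrt d) * (\<integral>\<^sup>+z. ennreal (kden a z powr (1 - M) * (1 - cmod z) powr (-3/2)) * indicator (stolz c \<xi>) z \<partial>lborel)"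
      by (rule nn_integral_cmult) measurable
    also have "\<dots> \<le> ennreal (sqrt \<theta> / sqrt d) * ennreal (A * kden a \<xi> powr (3/2 - M))"
      by (intro mult_left_mono A(2) a \<xi>) auto
    also have "\<dots> = ennreal (A * sqrt \<theta> / sqrt d * kden a \<xi> powr (3/2 - M))"
      using A \<theta> d by (subst ennreal_mult[symmetric]) (auto simp: mult_ac)
    finally show "cone_int c (\<lambda>z. hweight p (testfun p M a) z * indicator Z z) \<xi>
      \<le> ennreal (A * sqrt \<theta> / sqrt (1 - cmod a) * kden a \<xi> powr (3/2 - M))" unfolding d_def .
  qed
qed

text \<open>On B within the cone the integrand is bounded by the constant Q: heights in the disc are
  at least a multiple of 1 - |a|, and the kernel is at least a multiple of its value at the vertex.
  The bound is given the shape of \<open>testfun_cone_outer\<close> so that the two parts can be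
  added.\<close>

lemma testfun_cone_inner:
  assumes p: "0 < p" and M: "0 < M" and c: "0 < c" and a: "cmod a < 1" and \<xi>: "cmod \<xi> = 1"
    and \<eta>: "0 < \<eta>" "\<eta> < 1" and \<delta>: "0 < \<delta>" and B [measurable]: "B \<in> sets borel" and BP: "B \<subseteq> pseudo_disc a \<eta>"
    and small: "emeasure lborel B \<le> ennreal (\<delta> * (1 - cmod a)\<^sup>2)"
  shows "cone_int c (\<lambda>z. hweight p (testfun p M a) z * indicator B z) \<xi>
    \<le> ennreal ((1 + 2 * c) powr M * (4 * \<delta> / (1 - \<eta>\<^sup>2)) / sqrt (1 - cmod a) * kden a \<xi> powr (3/2 - M))"
proof -
  define d where "d = 1 - cmod a"
  have d: "0 < d" unfolding d_def using a by simp
  define R where "R = kden a \<xi>"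
  have R: "d \<le> R" "0 < R" unfolding R_def d_def using kden_ge[OF a, of \<xi>] kden_pos[OF a, of \<xi>] \<xi> by auto
  have \<eta>2: "0 < 1 - \<eta>\<^sup>2" using \<eta> by (simp add: abs_square_less_1)
  define Q where "Q = (1 + 2 * c) powr M * R powr (- M) * (4 / ((1 - \<eta>\<^sup>2) * d))"
  have Q: "0 \<le> Q" unfolding Q_def using \<eta>2 d by simp
  have "cone_int c (\<lambda>z. hweight p (testfun p M a) z * indicator B z) \<xi> \<le> (\<integral>\<^sup>+z. ennreal Q * indicator B z \<partial>lborel)"
    unfolding cone_int_def
  proof (rule nn_integral_mono)
    fix z
    show "hweight p (testfun p M a) z * indicator B z * indicator (stolz c \<xi>) z \<le> ennreal Q * indicator B z"
    proof (cases "z \<in> stolz c \<xi> \<and> z \<in> B")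
      case True
      then have z: "cmod z < 1" using stolz_subset_disc[OF c, of \<xi>] by auto
      have h: "(1 - \<eta>\<^sup>2) * d / 4 \<le> 1 - cmod z" using pseudo_disc_height[OF a \<eta>] True BP unfolding d_def by blast
      have "R \<le> (1 + 2 * c) * kden a z" using kden_cone[OF a c, of z \<xi>] True unfolding R_def by (meson add_increasing2 norm_ge_zero order_trans le_add_same_cancel1)
      then have "R / (1 + 2 * c) \<le> kden a z" using c by (simp add: pos_divide_le_eq mult.commute)
      then have "kden a z powr (- M) \<le> (R / (1 + 2 * c)) powr (- M)" using R c M by (intro powr_mono2') auto
      also have "\<dots> = (1 + 2 * c) powr M * R powr (- M)" using R c by (simp add: powr_divide powr_minus_divide)
      finally have 1: "kden a z powr (- M) \<le> (1 + 2 * c) powr M * R powr (- M)" .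
      have "1 / (1 - cmod z) \<le> 1 / ((1 - \<eta>\<^sup>2) * d / 4)" using h z \<eta>2 d by (intro divide_left_mono mult_pos_pos) auto
      then have "1 / (1 - cmod z) \<le> 4 / ((1 - \<eta>\<^sup>2) * d)" by simp
      with 1 have "kden a z powr (- M) * (1 / (1 - cmod z)) \<le> Q" unfolding Q_def using z by (intro mult_mono) auto
      then show ?thesis using True z unfolding hweight_testfun[OF a p] by (simp add: ennreal_leI)
    qed auto
  qed
  also have "\<dots> = ennreal Q * emeasure lborel B" by (rule nn_integral_cmult_indicator) simp
  also have "\<dots> \<le> ennreal Q * ennreal (\<delta> * d\<^sup>2)" using small unfolding d_def by (intro mult_left_mono) auto
  also have "\<dots> = ennreal (Q * (\<delta> * d\<^sup>2))" using Q \<delta> by (simp add: ennreal_mult)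
  also have "\<dots> \<le> ennreal ((1 + 2 * c) powr M * (4 * \<delta> / (1 - \<eta>\<^sup>2)) / sqrt d * R powr (3/2 - M))"
  proof (rule ennreal_leI)
    have "d powr (3/2) \<le> R powr (3/2)" using R d by (intro powr_mono2) auto
    moreover have "d powr (3/2) = d * sqrt d"
    proof -
      have "d powr (3/2) = d powr (1 + 1/2)" by simp
      then show ?thesis using d by (simp only: powr_add) (simp add: powr_half_sqrt)
    qed
    \<comment> \<open>Since d <= R, the spare factor d is converted into the exponent 3/2 of the
      outer estimate.\<close>
    ultimately have dR: "d \<le> R powr (3/2) / sqrt d" using d by (simp add: pos_le_divide_eq)
    have "Q * (\<delta> * d\<^sup>2) = ((1 + 2 * c) powr M * R powr (- M) * (4 * \<delta> / (1 - \<eta>\<^sup>2))) * d"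
      unfolding Q_def using d by (simp add: power2_eq_square)
    also have "\<dots> \<le> ((1 + 2 * c) powr M * R powr (- M) * (4 * \<delta> / (1 - \<eta>\<^sup>2))) * (R powr (3/2) / sqrt d)"
      using dR \<delta> \<eta>2 by (intro mult_left_mono) auto
    also have "\<dots> = (1 + 2 * c) powr M * (4 * \<delta> / (1 - \<eta>\<^sup>2)) / sqrt d * (R powr (3/2) * R powr (- M))" by simp
    also have "R powr (3/2) * R powr (- M) = R powr (3/2 - M)" by (simp only: powr_add[symmetric]) simp
    finally show "Q * (\<delta> * d\<^sup>2) \<le> (1 + 2 * c) powr M * (4 * \<delta> / (1 - \<eta>\<^sup>2)) / sqrt d * R powr (3/2 - M)" .
  qed
  finally show ?thesis unfolding d_def R_def .
qed

text \<open>The choice M = 5 + 2/s gives (3/2 - M) s = -(2 + 7s/2), which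
  \<open>circle_kernel_bound\<close> admits with \<gamma> = 7s/2 however small s is. The final
  exponent -(1 + 4s) is the sum of -s/2 and -(1 + 7s/2).\<close>

lemma testfun_circle_upper:
  assumes s: "0 < s" and a: "cmod a < 1" and \<kappa>: "0 < \<kappa>" and M: "M = 5 + 2 / s"
    and X: "\<And>\<xi>. cmod \<xi> = 1 \<Longrightarrow> X \<xi> \<le> ennreal (\<kappa> / sqrt (1 - cmod a) * kden a \<xi> powr (3/2 - M))"
  shows "(\<integral>\<^sup>+\<xi>. enn_powr (X \<xi>) s \<partial>circle_measure) \<le> ennreal (192 * \<kappa> powr s * (1 - cmod a) powr (- (1 + 4 * s)))"
proof -
  define d where "d = 1 - cmod a"
  have d: "0 < d" unfolding d_def using a by simp
  have "(\<integral>\<^sup>+\<xi>. enn_powr (X \<xi>) s \<partial>circle_measure)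
    \<le> (\<integral>\<^sup>+\<xi>. ennreal (\<kappa> powr s * d powr (- s / 2)) * ennreal (kden a \<xi> powr (- (2 + 7 * s / 2))) \<partial>circle_measure)"
  proof (rule nn_integral_circle_mono)
    fix \<xi> :: complex assume \<xi>: "cmod \<xi> = 1"
    have "enn_powr (X \<xi>) s \<le> enn_powr (ennreal (\<kappa> / sqrt d * kden a \<xi> powr (3/2 - M))) s"
      using X[OF \<xi>] s unfolding d_def by (intro enn_powr_mono) auto
    also have "\<dots> = ennreal ((\<kappa> / sqrt d * kden a \<xi> powr (3/2 - M)) powr s)"
      using \<kappa> d by (intro enn_powr_ennreal) auto
    also have "(\<kappa> / sqrt d * kden a \<xi> powr (3/2 - M)) powr s = (\<kappa> powr s * d powr (- s / 2)) * kden a \<xi> powr (- (2 + 7 * s / 2))"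
    proof -
      have "(3/2 - M) * s = - (2 + 7 * s / 2)" unfolding M using s by (simp add: field_simps)
      moreover have "sqrt d powr s = d powr (s / 2)" using d by (simp add: powr_half_sqrt[symmetric] powr_powr)
      ultimately show ?thesis using \<kappa> d by (simp add: powr_mult powr_divide powr_powr powr_minus_divide)
    qed
    finally show "enn_powr (X \<xi>) s \<le> ennreal (\<kappa> powr s * d powr (- s / 2)) * ennreal (kden a \<xi> powr (- (2 + 7 * s / 2)))"
      by (simp add: ennreal_mult)
  qed
  also have "\<dots> = ennreal (\<kappa> powr s * d powr (- s / 2)) * (\<integral>\<^sup>+\<xi>. ennreal (kden a \<xi> powr (- (2 + 7 * s / 2))) \<partial>circle_measure)"
    by (rule nn_integral_cmult) measurable
  also have "\<dots> \<le> ennreal (\<kappa> powr s * d powr (- s / 2)) * ennreal (192 * d powr (- (1 + 7 * s / 2)))"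
    unfolding d_def using s by (intro mult_left_mono circle_kernel_bound[OF a]) auto
  also have "\<dots> = ennreal (192 * \<kappa> powr s * (d powr (- s / 2) * d powr (- (1 + 7 * s / 2))))"
    by (subst ennreal_mult[symmetric]) (auto simp: mult_ac)
  also have "d powr (- s / 2) * d powr (- (1 + 7 * s / 2)) = d powr (- (1 + 4 * s))"
  proof -
    have "- s / 2 + - (1 + 7 * s / 2) = - (1 + 4 * s)" by (simp add: field_simps)
    then show ?thesis by (simp only: powr_add[symmetric])
  qed
  finally show ?thesis unfolding d_def .
qed

text \<open>It suffices to keep z within d/50 of a and \<xi> within d/50 of the projection u. There
  the kernel is at most 3d and 1 - |z| at most 2d, while d/50 + d + d/50 < (11/10) (49/50) d puts z
  into the cone. The power of d agrees with \<open>testfun_circle_upper\<close>, so the two bounds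
  compare uniformly in a.\<close>

lemma testfun_circle_lower:
  assumes p: "0 < p" and s: "0 < s" and a: "cmod a < 1" and M: "M = 5 + 2 / s"
  shows "ennreal ((3 powr (- M) * pi / 5000) powr s / 50 * (1 - cmod a) powr (- (1 + 4 * s)))
    \<le> (cone_power s (11/10) (hweight p (testfun p M a)))"
proof -
  define d where "d = 1 - cmod a"
  have d: "0 < d" "d \<le> 1" unfolding d_def using a by auto
  obtain u where u: "cmod u = 1" "a = of_real (cmod a) * u" by (rule unit_direction)
  have "a - u = of_real (cmod a - 1) * u" by (subst u(2)) (simp add: algebra_simps)
  then have au: "cmod (a - u) = d" unfolding d_def using a u(1) by (simp add: norm_mult del: of_real_diff)
  define B where "B = ball a (d / 50)"
  define Q where "Q = (3 * d) powr (- M) / (2 * d)"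
  have M0: "0 < M" unfolding M using s by (simp add: add_pos_pos)
  have inner: "ennreal ((3 powr (- M) * pi / 5000) * d powr (1 - M)) \<le> cone_int (11/10) (hweight p (testfun p M a)) \<xi>"
    if \<xi>: "\<xi> \<in> ball u (d / 50)" for \<xi>
  proof -
    have "ennreal ((3 powr (- M) * pi / 5000) * d powr (1 - M)) = ennreal Q * ennreal (pi * (d / 50)\<^sup>2)"
    proof -
      have "Q * (pi * (d / 50)\<^sup>2) = (3 powr (- M) * pi / 5000) * (d powr (- M) * d powr 1)"
        unfolding Q_def powr_mult using d by (simp add: power2_eq_square field_simps)
      also have "d powr (- M) * d powr 1 = d powr (1 - M)" by (simp only: powr_add[symmetric]) simp
      finally show ?thesis using d unfolding Q_def by (subst ennreal_mult[symmetric]) auto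
    qed
    also have "\<dots> = (\<integral>\<^sup>+z. ennreal Q * indicator B z \<partial>lborel)"
      unfolding B_def using d by (subst nn_integral_cmult_indicator) (simp_all add: emeasure_ball_complex)
    also have "\<dots> \<le> cone_int (11/10) (hweight p (testfun p M a)) \<xi>" unfolding cone_int_def
    proof (rule nn_integral_mono)
      fix z
      show "ennreal Q * indicator B z \<le> hweight p (testfun p M a) z * indicator (stolz (11/10) \<xi>) z"
      proof (cases "z \<in> B")
        case True
        then have za: "cmod (z - a) < d / 50" unfolding B_def by (simp add: dist_norm norm_minus_commute)
        have "cmod z \<le> cmod (z - a) + cmod a" using norm_triangle_ineq[of "z - a" a] by simp
        then have h1: "49/50 * d \<le> 1 - cmod z" using za unfolding d_def by simp
        have "cmod a \<le> cmod (z - a) + cmod z" using norm_triangle_ineq3[of a z] by (simp add: norm_minus_commute)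
        then have h2: "1 - cmod z \<le> 2 * d" using za d unfolding d_def by simp
        have z1: "cmod z < 1" using h1 d by simp
        have "z - \<xi> = (z - a) + (a - u) + (u - \<xi>)" by simp
        then have "cmod (z - \<xi>) \<le> cmod (z - a) + cmod (a - u) + cmod (u - \<xi>)"
          by (metis norm_triangle_ineq norm_triangle_le add_right_mono)
        also have "\<dots> < d / 50 + d + d / 50" using za au \<xi> by (simp add: dist_norm)
        also have "\<dots> \<le> 11/10 * (49/50 * d)" using d by simp
        also have "\<dots> \<le> 11/10 * (1 - cmod z)" using h1 by simp
        finally have zS: "z \<in> stolz (11/10) \<xi>" unfolding stolz_def by simp
        have "kden a z \<le> kden a a + cmod (z - a)" by (rule kden_lipschitz[OF a])
        also have "kden a a \<le> 2 * d"
        proof -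
          have "cnj a * a = of_real ((cmod a)\<^sup>2)" unfolding complex_norm_square by (rule mult.commute)
          then have "1 - cnj a * a = of_real (1 - (cmod a)\<^sup>2)" by (simp only: of_real_diff of_real_1)
          then have "kden a a = \<bar>1 - (cmod a)\<^sup>2\<bar>" by (simp only: norm_of_real)
          also have "\<dots> = (1 - cmod a) * (1 + cmod a)" using a by (simp add: power2_eq_square algebra_simps abs_square_le_1 mult_le_one)
          also have "\<dots> \<le> d * 2" unfolding d_def using a by (intro mult_left_mono) auto
          finally show ?thesis by simp
        qed
        finally have "kden a z \<le> 3 * d" using za d by simp
        then have "(3 * d) powr (- M) \<le> kden a z powr (- M)" using kden_pos[OF a, of z] z1 M0 by (intro powr_mono2') auto
        moreover have "1 / (2 * d) \<le> 1 / (1 - cmod z)" using h2 z1 d by (intro divide_left_mono mult_pos_pos) auto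
        ultimately have "(3 * d) powr (- M) * (1 / (2 * d)) \<le> kden a z powr (- M) * (1 / (1 - cmod z))" using d by (intro mult_mono) auto
        then have "Q \<le> kden a z powr (- M) / (1 - cmod z)" unfolding Q_def by simp
        then show ?thesis using True zS z1 unfolding hweight_testfun[OF a p] by (simp add: ennreal_leI)
      qed simp
    qed
    finally show ?thesis .
  qed
  define W where "W = (3 powr (- M) * pi / 5000) * d powr (1 - M)"
  have W: "0 \<le> W" unfolding W_def by simp
  have "W powr s = (3 powr (- M) * pi / 5000) powr s * d powr ((1 - M) * s)"
    unfolding W_def by (simp only: powr_mult powr_powr)
  moreover have "(1 - M) * s = - (2 + 4 * s)" unfolding M using s by (simp add: field_simps)
  moreover have "d powr (- (2 + 4 * s)) * d powr 1 = d powr (- (1 + 4 * s))" by (simp only: powr_add[symmetric]) simp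
  ultimately have "(3 powr (- M) * pi / 5000) powr s / 50 * d powr (- (1 + 4 * s)) = W powr s * (d / 50)" using d by simp
  then have "ennreal ((3 powr (- M) * pi / 5000) powr s / 50 * d powr (- (1 + 4 * s))) = ennreal (W powr s) * ennreal (d / 50)"
    using d by (simp add: ennreal_mult[symmetric])
  also have "\<dots> \<le> ennreal (W powr s) * emeasure circle_measure (ball u (d / 50))"
    using d u pi_gt3 by (intro mult_left_mono circle_ball_lower) auto
  also have "\<dots> = (\<integral>\<^sup>+\<xi>. ennreal (W powr s) * indicator (ball u (d / 50)) \<xi> \<partial>circle_measure)"
    by (rule nn_integral_cmult_indicator[symmetric]) simp
  also have "\<dots> \<le> (cone_power s (11/10) (hweight p (testfun p M a)))"
  proof (rule nn_integral_mono)
    fix \<xi>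
    show "ennreal (W powr s) * indicator (ball u (d / 50)) \<xi> \<le> enn_powr (cone_int (11/10) (hweight p (testfun p M a)) \<xi>) s"
    proof (cases "\<xi> \<in> ball u (d / 50)")
      case True
      then have "enn_powr (ennreal W) s \<le> enn_powr (cone_int (11/10) (hweight p (testfun p M a)) \<xi>) s"
        using s inner unfolding W_def by (intro enn_powr_mono) auto
      then show ?thesis using True W by (simp add: enn_powr_ennreal)
    qed simp
  qed
  finally show ?thesis unfolding d_def .
qed

text \<open>Failure of the density at a single a contradicts the inequality for the test function
  attached to that a. The radius \<eta>, through \<theta> = 1 - \<eta>^2, is fixed so that the part
  outside the disc takes at most half of \<kappa>; \<delta> is then small enough, depending on
  \<theta>, for the part inside.\<close>

lemma density_necessary:
  assumes p: "0 < p" and s: "0 < s" and c: "0 < c" and K: "0 < K"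
    and T: "\<And>\<xi>. cmod \<xi> = 1 \<Longrightarrow> stolz (11/10) \<xi> \<subseteq> T \<xi>" "\<And>\<xi>. cmod \<xi> = 1 \<Longrightarrow> T \<xi> \<subseteq> stolz 3 \<xi>"
  obtains \<eta> \<delta> :: real where "0 < \<eta>" "\<eta> < 1" "0 < \<delta>"
    "\<And>G a. G \<in> sets borel \<Longrightarrow> cmod a < 1 \<Longrightarrow> 
      (\<And>f. f holomorphic_on ball 0 1 \<Longrightarrow>
        (tent_power s T (hweight p f)) < \<infinity> \<Longrightarrow>
        ennreal K * (tent_power s T (hweight p f))
          \<le> (cone_power s c (\<lambda>z. hweight p f z * indicator G z))) \<Longrightarrow>
      pseudo_disc a \<eta> \<in> sets borel \<Longrightarrow>
      ennreal (\<delta> * (1 - cmod a)\<^sup>2) \<le> emeasure lborel (G \<inter> pseudo_disc a \<eta>)"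
proof -
  define M where "M = 5 + 2 / s"
  have M: "5 \<le> M" "0 < M" unfolding M_def using s by (auto intro: add_pos_pos)
  obtain A where A: "0 < A" "\<forall>a \<xi> \<theta> Z. cmod a < 1 \<longrightarrow> cmod \<xi> = 1 \<longrightarrow> 0 \<le> \<theta> \<longrightarrow>
    (\<forall>z\<in>Z. cmod z < 1 \<longrightarrow> (1 - cmod a) * (1 - cmod z) \<le> \<theta> * (kden a z)\<^sup>2) \<longrightarrow>
    cone_int c (\<lambda>z. hweight p (testfun p M a) z * indicator Z z) \<xi>
      \<le> ennreal (A * sqrt \<theta> / sqrt (1 - cmod a) * kden a \<xi> powr (3/2 - M))"
    using testfun_cone_outer[OF p M(1) c] by blast
  obtain A3 where A3: "0 < A3" "\<forall>a \<xi> \<theta> Z. cmod a < 1 \<longrightarrow> cmod \<xi> = 1 \<longrightarrow> 0 \<le> \<theta> \<longrightarrow>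
    (\<forall>z\<in>Z. cmod z < 1 \<longrightarrow> (1 - cmod a) * (1 - cmod z) \<le> \<theta> * (kden a z)\<^sup>2) \<longrightarrow>
    cone_int 3 (\<lambda>z. hweight p (testfun p M a) z * indicator Z z) \<xi>
      \<le> ennreal (A3 * sqrt \<theta> / sqrt (1 - cmod a) * kden a \<xi> powr (3/2 - M))"
    using testfun_cone_outer[OF p M(1) zero_less_numeral] by blast
  define L where "L = (3 powr (- M) * pi / 5000) powr s / 50"
  have L: "0 < L" unfolding L_def by simp
  \<comment> \<open>Makes the upper constant 192 \<kappa>^s = (192/400) K L strictly smaller than
    the lower constant K L.\<close>
  define \<kappa> where "\<kappa> = (K * L / 400) powr (1 / s)"
  have \<kappa>: "0 < \<kappa>" "\<kappa> powr s = K * L / 400" unfolding \<kappa>_def using K L s by (auto simp: powr_powr)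
  define \<theta> where "\<theta> = min (1/2) ((\<kappa> / (2 * A))\<^sup>2)"
  have \<theta>: "0 < \<theta>" "\<theta> < 1" unfolding \<theta>_def using \<kappa> A by auto
  have "sqrt \<theta> \<le> sqrt ((\<kappa> / (2 * A))\<^sup>2)" unfolding \<theta>_def by (intro real_sqrt_le_mono min.cobounded2)
  also have "\<dots> = \<kappa> / (2 * A)" using \<kappa> A by simp
  finally have A\<theta>: "A * sqrt \<theta> \<le> \<kappa> / 2" using A by (simp add: field_simps)
  define \<eta> where "\<eta> = sqrt (1 - \<theta>)"
  have \<eta>: "0 < \<eta>" "\<eta> < 1" "1 - \<eta>\<^sup>2 = \<theta>" unfolding \<eta>_def using \<theta> by auto
  define \<delta> where "\<delta> = \<kappa> * \<theta> / (8 * (1 + 2 * c) powr M)"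
  have \<delta>: "0 < \<delta>" unfolding \<delta>_def using \<kappa> \<theta> c by simp
  have \<delta>2: "(1 + 2 * c) powr M * (4 * \<delta> / \<theta>) = \<kappa> / 2" unfolding \<delta>_def using \<theta> c by simp
  show ?thesis
  proof (rule that[OF \<eta>(1,2) \<delta>], rule ccontr)
    fix G a assume G [measurable]: "G \<in> sets borel" and a: "cmod a < 1" and P [measurable]: "pseudo_disc a \<eta> \<in> sets borel"
      and hyp: "\<And>f. f holomorphic_on ball 0 1 \<Longrightarrow>
        (tent_power s T (hweight p f)) < \<infinity> \<Longrightarrow>
        ennreal K * (tent_power s T (hweight p f))
          \<le> (cone_power s c (\<lambda>z. hweight p f z * indicator G z))"
      and "\<not> ennreal (\<delta> * (1 - cmod a)\<^sup>2) \<le> emeasure lborel (G \<inter> pseudo_disc a \<eta>)"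
    then have small: "emeasure lborel (G \<inter> pseudo_disc a \<eta>) \<le> ennreal (\<delta> * (1 - cmod a)\<^sup>2)" by simp
    define f where "f = testfun p M a"
    have f: "f holomorphic_on ball 0 1" unfolding f_def by (rule testfun_holomorphic[OF a])
    note [measurable] = hweight_measurable[OF f]
    define I where "I = (tent_power s T (hweight p f))"
    define D where "D = (1 - cmod a) powr (- (1 + 4 * s))"
    have D: "0 < D" unfolding D_def using a by simp
    \<comment> \<open>Finiteness of the tent power of the test function, from the outer estimate
      with \<theta> = 1 and no restriction on z.\<close>
    have "I \<le> (cone_power s 3 (\<lambda>z. hweight p f z * indicator UNIV z))"
      unfolding I_def cone_int_def using T(2) s
      by (intro nn_integral_circle_mono enn_powr_mono nn_integral_mono) (auto split: split_indicator)
    also have "\<dots> \<le> ennreal (192 * (A3 * sqrt 1) powr s * (1 - cmod a) powr (- (1 + 4 * s)))"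
    proof (rule testfun_circle_upper[OF s a _ M_def])
      fix \<xi> :: complex assume \<xi>: "cmod \<xi> = 1"
      show "cone_int 3 (\<lambda>z. hweight p f z * indicator UNIV z) \<xi> \<le> ennreal (A3 * sqrt 1 / sqrt (1 - cmod a) * kden a \<xi> powr (3/2 - M))"
        unfolding f_def
      proof (intro A3(2)[rule_format] a \<xi>)
        fix z assume "cmod z < 1"
        then have "(1 - cmod a) * (1 - cmod z) \<le> kden a z * kden a z" using a by (intro mult_mono kden_ge kden_ge_compl) auto
        then show "(1 - cmod a) * (1 - cmod z) \<le> 1 * (kden a z)\<^sup>2" by (simp add: power2_eq_square)
      qed simp
    qed (use A3 in simp)
    finally have fin: "I < \<infinity>" by (rule le_less_trans) simp
    have "ennreal (L * D) \<le> (cone_power s (11/10) (hweight p f))"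
      unfolding L_def D_def f_def by (rule testfun_circle_lower[OF p s a M_def])
    also have "\<dots> \<le> I" unfolding I_def cone_int_def using T(1) s
      by (intro nn_integral_circle_mono enn_powr_mono nn_integral_mono) (auto split: split_indicator)
    finally have "ennreal K * ennreal (L * D) \<le> ennreal K * I" by (intro mult_left_mono) auto
    also have "\<dots> \<le> (cone_power s c (\<lambda>z. hweight p f z * indicator G z))"
      unfolding I_def by (rule hyp[OF f fin[unfolded I_def]])
    also have "\<dots> \<le> ennreal (192 * \<kappa> powr s * (1 - cmod a) powr (- (1 + 4 * s)))"
    proof (rule testfun_circle_upper[OF s a \<kappa>(1) M_def])
      fix \<xi> :: complex assume \<xi>: "cmod \<xi> = 1"
      let ?E = "kden a \<xi> powr (3/2 - M) / sqrt (1 - cmod a)"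
      have E0: "0 \<le> ?E" using a by simp
      have "cone_int c (\<lambda>z. hweight p f z * indicator G z) \<xi> = cone_int c (\<lambda>z. hweight p f z * indicator (G - pseudo_disc a \<eta>) z) \<xi>
        + cone_int c (\<lambda>z. hweight p f z * indicator (G \<inter> pseudo_disc a \<eta>) z) \<xi>"
        unfolding cone_int_def by (subst nn_integral_add[symmetric]) (auto intro!: nn_integral_cong split: split_indicator)
      also have "\<dots> \<le> ennreal (A * sqrt \<theta> / sqrt (1 - cmod a) * kden a \<xi> powr (3/2 - M))
        + ennreal ((1 + 2 * c) powr M * (4 * \<delta> / (1 - \<eta>\<^sup>2)) / sqrt (1 - cmod a) * kden a \<xi> powr (3/2 - M))"
      proof (rule add_mono)
        show "cone_int c (\<lambda>z. hweight p f z * indicator (G - pseudo_disc a \<eta>) z) \<xi> \<le> ennreal (A * sqrt \<theta> / sqrt (1 - cmod a) * kden a \<xi> powr (3/2 - M))"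
          unfolding f_def using pseudo_disc_compl_kden_ge[OF a \<eta>(1)] \<theta> unfolding \<eta>(3) by (intro A(2)[rule_format] a \<xi>) auto
        show "cone_int c (\<lambda>z. hweight p f z * indicator (G \<inter> pseudo_disc a \<eta>) z) \<xi>
          \<le> ennreal ((1 + 2 * c) powr M * (4 * \<delta> / (1 - \<eta>\<^sup>2)) / sqrt (1 - cmod a) * kden a \<xi> powr (3/2 - M))"
          unfolding f_def by (rule testfun_cone_inner[OF p M(2) c a \<xi> \<eta>(1,2) \<delta> _ _ small]) auto
      qed
      also have "\<dots> \<le> ennreal (\<kappa> / 2 * ?E) + ennreal (\<kappa> / 2 * ?E)"
      proof (intro add_mono ennreal_leI)
        show "A * sqrt \<theta> / sqrt (1 - cmod a) * kden a \<xi> powr (3/2 - M) \<le> \<kappa> / 2 * ?E"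
          using mult_right_mono[OF A\<theta> E0] by simp
        show "(1 + 2 * c) powr M * (4 * \<delta> / (1 - \<eta>\<^sup>2)) / sqrt (1 - cmod a) * kden a \<xi> powr (3/2 - M) \<le> \<kappa> / 2 * ?E"
          unfolding \<eta>(3) \<delta>2 by simp
      qed
      also have "\<dots> = ennreal (\<kappa> / 2 * ?E + \<kappa> / 2 * ?E)"
        using \<kappa>(1) by (intro ennreal_plus[symmetric] mult_nonneg_nonneg E0) simp_all
      also have "\<kappa> / 2 * ?E + \<kappa> / 2 * ?E = \<kappa> / sqrt (1 - cmod a) * kden a \<xi> powr (3/2 - M)" by simp
      finally show "cone_int c (\<lambda>z. hweight p f z * indicator G z) \<xi> \<le> ennreal (\<kappa> / sqrt (1 - cmod a) * kden a \<xi> powr (3/2 - M))" .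
    qed
    also have "192 * \<kappa> powr s * (1 - cmod a) powr (- (1 + 4 * s)) = 192 / 400 * (K * (L * D))" unfolding \<kappa>(2) D_def by simp
    finally have "ennreal (K * (L * D)) \<le> ennreal (192 / 400 * (K * (L * D)))" using K L D by (simp add: ennreal_mult)
    moreover have pos: "0 < K * (L * D)" using K L D by simp
    ultimately have "K * (L * D) \<le> 192 / 400 * (K * (L * D))" by (subst (asm) ennreal_le_iff) simp_all
    then show False using pos by linarith
  qed
qed

section \<open>Comparison of discs and reduction to Lebesgue measure\<close>

lemma pseudo_disc_borel:
  assumes a: "cmod a < 1"
  shows "pseudo_disc a \<eta> \<in> sets borel"
proof -
  have "pseudo_disc a \<eta> = {z. cmod z < 1} \<inter> {z. cmod (a - z) < \<eta> * kden a z}"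
    using mem_pseudo_disc_iff[OF a] by blast
  moreover have "open ({z. cmod z < 1} \<inter> {z. cmod (a - z) < \<eta> * kden a z})"
    by (intro open_Int open_Collect_less continuous_intros)
  ultimately show ?thesis by (simp only: borel_open)
qed

lemma eucl_disc_eq_ball:
  assumes "cmod a < 1" "\<eta> < 1"
  shows "eucl_disc \<eta> a = ball a (\<eta> * (1 - cmod a))"
proof -
  have "cmod z < 1" if "cmod (z - a) < \<eta> * (1 - cmod a)" for z
  proof -
    have "\<eta> * (1 - cmod a) \<le> 1 * (1 - cmod a)" using assms by (intro mult_right_mono) auto
    moreover have "cmod z \<le> cmod (z - a) + cmod a" using norm_triangle_ineq[of "z - a" a] by simp
    ultimately show ?thesis using that by simp
  qed
  then show ?thesis unfolding eucl_disc_def by (auto simp: dist_norm norm_minus_commute)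
qed

lemma eucl_disc_subset_pseudo_disc:
  assumes a: "cmod a < 1" and \<eta>: "0 < \<eta>"
  shows "eucl_disc \<eta> a \<subseteq> pseudo_disc a \<eta>"
proof
  fix z assume z: "z \<in> eucl_disc \<eta> a"
  then have z1: "cmod z < 1" "cmod (a - z) < \<eta> * (1 - cmod a)" unfolding eucl_disc_def by (auto simp: norm_minus_commute)
  moreover have "\<eta> * (1 - cmod a) \<le> \<eta> * kden a z" using \<eta> z1 by (intro mult_left_mono kden_ge a) auto
  ultimately show "z \<in> pseudo_disc a \<eta>" using mem_pseudo_disc_iff[OF a] by auto
qed

text \<open>A pseudohyperbolic disc of radius close to 1 is not inside the Euclidean disc with the same
  centre; moving its centre radially towards the circle, so that the distance to the circle
  shrinks by the factor \<open>s\<close>, repairs this.\<close>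
lemma pseudo_disc_subset_eucl_disc:
  assumes a: "cmod a < 1" and \<eta>: "0 < \<eta>" "\<eta> < 1" and s: "s = (1 - \<eta>\<^sup>2) / 16"
  obtains b where "cmod b < 1" "1 - cmod b = s * (1 - cmod a)" "pseudo_disc b \<eta> \<subseteq> eucl_disc (sqrt (1 - s\<^sup>2)) a"
proof -
  define d where "d = 1 - cmod a"
  have d: "0 < d" "d \<le> 1" unfolding d_def using a by auto
  have s0: "0 < s" "s \<le> 1/16" unfolding s using \<eta> by (auto simp: abs_square_less_1)
  obtain u where u: "cmod u = 1" "a = of_real (cmod a) * u" by (rule unit_direction)
  define \<rho> where "\<rho> = 1 - s * d"
  have "s * d \<le> 1/16 * 1" using s0 d by (intro mult_mono) auto
  then have \<rho>: "15/16 \<le> \<rho>" "\<rho> < 1" unfolding \<rho>_def using s0 d by auto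
  define b where "b = of_real \<rho> * u"
  have cb: "cmod b = \<rho>" unfolding b_def using \<rho> u by (simp add: norm_mult)
  have b1: "cmod b < 1" using cb \<rho> by simp
  have uu: "u * cnj u = 1" using u(1) by (simp add: complex_norm_square[symmetric])
  have "pseudo_disc b \<eta> \<subseteq> eucl_disc (sqrt (1 - s\<^sup>2)) a"
  proof
    fix z assume z: "z \<in> pseudo_disc b \<eta>"
    have z1: "cmod z < 1" using z mem_pseudo_disc_iff[OF b1] by auto
    \<comment> \<open>Rotation by the conjugate of u moves a and b to the nonnegative real axis; x
      and y are coordinates measured from the boundary point 1.\<close>
    define v where "v = cnj u * z"
    have cv: "cmod v = cmod z" unfolding v_def using u by (simp add: norm_mult)
    define x y where "x = 1 - Re v" and "y = Im v"
    have v2: "(cmod v)\<^sup>2 = (1 - x)\<^sup>2 + y\<^sup>2" unfolding x_def y_def cmod_power2 by simp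
    have x: "0 \<le> x" using complex_Re_le_cmod[of v] cv z1 unfolding x_def by simp
    have "1 - cmod z \<le> 1 - (cmod z)\<^sup>2" using z1 by (simp add: power2_eq_square mult_left_le)
    also have "\<dots> = 2 * x - x\<^sup>2 - y\<^sup>2" unfolding cv[symmetric] v2 by (simp add: power2_eq_square algebra_simps)
    also have "\<dots> \<le> 2 * x" by simp
    finally have hx: "1 - cmod z \<le> 2 * x" .
    have "cnj b * z = of_real \<rho> * v" unfolding b_def v_def by simp
    then have k2: "(kden b z)\<^sup>2 = (1 - \<rho> * (1 - x))\<^sup>2 + (\<rho> * y)\<^sup>2" unfolding cmod_power2 x_def y_def by simp
    have "(1 - \<eta>\<^sup>2) * (kden b z)\<^sup>2 \<le> 4 * (1 - cmod b) * (1 - cmod z)" by (rule pseudo_disc_kden_le[OF b1 \<eta>(1) z])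
    also have "4 * (1 - cmod b) * (1 - cmod z) \<le> 4 * (1 - cmod b) * (2 * x)" using hx b1 by (intro mult_left_mono) auto
    also have "4 * (1 - cmod b) * (2 * x) = s * (8 * (d * x))" unfolding cb \<rho>_def by simp
    also have "(1 - \<eta>\<^sup>2) * (kden b z)\<^sup>2 = s * (16 * (kden b z)\<^sup>2)" unfolding s by simp
    \<comment> \<open>The denominator 16 in the definition of s takes effect here: 1 - \<eta>^2 = 16
      s and 1 - |b| = s d, so s cancels.\<close>
    finally have "16 * (kden b z)\<^sup>2 \<le> 8 * (d * x)" using s0 by (simp only: mult_le_cancel_left_pos)
    moreover have "(s * d)\<^sup>2 + (1/2) * (x\<^sup>2 + y\<^sup>2) \<le> (kden b z)\<^sup>2"
    proof -
      have "(15/16)\<^sup>2 \<le> \<rho>\<^sup>2" using \<rho> by (intro power_mono) auto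
      then have "1/2 \<le> \<rho>\<^sup>2" by (simp add: power2_eq_square)
      then have "(1/2) * (x\<^sup>2 + y\<^sup>2) \<le> \<rho>\<^sup>2 * (x\<^sup>2 + y\<^sup>2)" by (intro mult_right_mono) auto
      moreover have "(kden b z)\<^sup>2 = (s * d)\<^sup>2 + 2 * (s * d) * (\<rho> * x) + \<rho>\<^sup>2 * (x\<^sup>2 + y\<^sup>2)"
      proof -
        have "1 - \<rho> * (1 - x) = s * d + \<rho> * x" unfolding \<rho>_def by (simp add: algebra_simps)
        then have "(1 - \<rho> * (1 - x))\<^sup>2 = (s * d + \<rho> * x)\<^sup>2" by (simp only:)
        also have "\<dots> = (s * d)\<^sup>2 + 2 * (s * d) * (\<rho> * x) + \<rho>\<^sup>2 * x\<^sup>2" by (simp add: power2_sum power_mult_distrib)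
        finally show ?thesis unfolding k2 by (simp add: power_mult_distrib distrib_left)
      qed
      moreover have "0 \<le> 2 * (s * d) * (\<rho> * x)" using s0 d \<rho> x by simp
      ultimately show ?thesis by linarith
    qed
    moreover have "2 * A + B \<le> t" if "16 * k \<le> 8 * t" "A + (1/2) * B \<le> k" for A B k t :: real
      using that by linarith
    \<comment> \<open>The term 2 (s d)^2 survives in the distance estimate below and gives the
      strict gain behind the radius sqrt (1 - s^2).\<close>
    ultimately have key: "2 * (s * d)\<^sup>2 + (x\<^sup>2 + y\<^sup>2) \<le> d * x" by blast
    have "(cmod (z - a))\<^sup>2 = (cmod (v - of_real (1 - d)))\<^sup>2"
    proof -
      have "u * (v - of_real (1 - d)) = u * cnj u * z - of_real (cmod a) * u" unfolding v_def d_def by (simp add: algebra_simps)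
      also have "\<dots> = z - a" using uu u(2) by simp
      finally have "cmod (z - a) = cmod (u * (v - of_real (1 - d)))" by simp
      then show ?thesis using u(1) by (simp add: norm_mult)
    qed
    also have "\<dots> = d\<^sup>2 - 2 * (d * x) + (x\<^sup>2 + y\<^sup>2)"
      unfolding cmod_power2 x_def y_def by (simp add: power2_eq_square algebra_simps)
    also have "\<dots> \<le> d\<^sup>2 - d * x - 2 * (s * d)\<^sup>2" using key by linarith
    also have "\<dots> < d\<^sup>2 - (s * d)\<^sup>2"
    proof -
      have "0 \<le> d * x" "0 < (s * d)\<^sup>2" using s0 d x by simp_all
      then show ?thesis by linarith
    qed
    also have "\<dots> = (1 - s\<^sup>2) * d\<^sup>2" by (simp add: power_mult_distrib algebra_simps)
    also have "\<dots> = (sqrt (1 - s\<^sup>2) * d)\<^sup>2" using s0 by (simp add: power_mult_distrib abs_square_le_1)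
    finally have "cmod (z - a) < sqrt (1 - s\<^sup>2) * d"
      by (rule power2_less_imp_less) (use d s0 in \<open>simp add: abs_square_le_1\<close>)
    then show "z \<in> eucl_disc (sqrt (1 - s\<^sup>2)) a" using z1 unfolding eucl_disc_def d_def by simp
  qed
  then show ?thesis using that[of b] b1 cb unfolding \<rho>_def d_def by simp
qed

section \<open>Measurability of the tent regions and passage to Borel sets\<close>

lemma pair_Gamma_region_measurable:
  assumes "0 < \<beta>"
  shows "{x :: complex \<times> complex. snd x \<in> Gamma_region \<beta> (fst x)} \<in> sets (borel \<Otimes>\<^sub>M borel)"
proof -
  define U where "U t = {x :: complex \<times> complex. cmod (of_real (1 - t) * fst x - snd x) < t * \<beta>}" for t
  have "open (U t)" for t unfolding U_def by (intro open_Collect_less continuous_intros)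
  then have "open (\<Union>t\<in>{0<..1}. U t)" by auto
  moreover have "closed {x :: complex \<times> complex. snd x = fst x}" by (intro closed_Collect_eq continuous_intros)
  moreover have "open {x :: complex \<times> complex. cmod (snd x) < \<beta>}" by (intro open_Collect_less continuous_intros)
  moreover have "{x :: complex \<times> complex. snd x \<in> Gamma_region \<beta> (fst x)}
    = ((\<Union>t\<in>{0<..1}. U t) - {x. snd x = fst x}) \<union> {x. cmod (snd x) < \<beta>}"
    unfolding Gamma_region_eq[OF assms] U_def by (auto simp: dist_norm)
  ultimately show ?thesis unfolding borel_prod by (simp add: open_Diff open_Un)
qed

lemma Gamma_region_borel:
  assumes "0 < \<beta>"
  shows "Gamma_region \<beta> \<xi> \<in> sets borel"
proof -
  have "(\<lambda>z. (\<xi>, z)) -` {x. snd x \<in> Gamma_region \<beta> (fst x)} \<in> sets borel"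
    using pair_Gamma_region_measurable[OF assms] by (rule sets_Pair1[of _ borel borel, simplified])
  then show ?thesis by (simp add: vimage_def)
qed

lemma Gamma_integral_measurable:
  assumes [measurable]: "w \<in> borel_measurable borel" and \<beta>: "0 < \<beta>"
  shows "(\<lambda>\<xi>. \<integral>\<^sup>+z. w z * indicator (Gamma_region \<beta> \<xi>) z \<partial>lborel) \<in> borel_measurable borel"
proof -
  note [measurable] = pair_Gamma_region_measurable[OF \<beta>]
  have "(\<lambda>x. w (snd x) * indicator {x. snd x \<in> Gamma_region \<beta> (fst x)} x) \<in> borel_measurable (borel \<Otimes>\<^sub>M lborel)"
    by measurable
  then have "(\<lambda>x. w (snd x) * indicator (Gamma_region \<beta> (fst x)) (snd x)) \<in> borel_measurable (borel \<Otimes>\<^sub>M lborel)"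
    by (simp add: indicator_def)
  then show ?thesis by (intro lborel.borel_measurable_nn_integral) (simp add: case_prod_beta)
qed

text \<open>G is only Lebesgue measurable, while the estimates above are stated for Borel sets;
  replacing G by a Borel set that differs from it by a null set changes none of the
  integrals.\<close>

lemma lebesgue_set_borel_AE_eq:
  assumes "G \<in> sets lebesgue"
  obtains G' :: "complex set" where "G' \<in> sets borel" "G' \<subseteq> G" "AE z in lborel. z \<in> G \<longleftrightarrow> z \<in> G'"
proof -
  obtain S N N' where *: "G = S \<union> N" "N \<subseteq> N'" "N' \<in> null_sets lborel" "S \<in> sets lborel"
    using sets_completionE[OF assms] .
  have "AE z in lborel. z \<in> G \<longleftrightarrow> z \<in> S"
    using AE_not_in[OF *(3)] by eventually_elim (use * in auto)
  then show ?thesis using that[of S] * by auto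
qed

lemma emeasure_disc_measure:
  assumes "A \<in> sets lebesgue" "A \<subseteq> ball 0 1" "A' \<in> sets borel" "AE z in lborel. z \<in> A \<longleftrightarrow> z \<in> A'"
  shows "emeasure disc_measure A = ennreal (1 / pi) * emeasure lborel A'"
proof -
  have "emeasure disc_measure A = ennreal (1 / pi) * emeasure lebesgue A"
    unfolding disc_measure_def using assms by (simp add: emeasure_restrict_space del: emeasure_completion)
  also have "emeasure lebesgue A = (\<integral>\<^sup>+z. indicator A z \<partial>lebesgue)" using assms by (simp del: emeasure_completion)
  also have "\<dots> = (\<integral>\<^sup>+z. indicator A z \<partial>lborel)" by (rule nn_integral_completion)
  also have "\<dots> = (\<integral>\<^sup>+z. indicator A' z \<partial>lborel)"
    by (rule nn_integral_cong_AE) (use assms(4) in eventually_elim, simp add: indicator_def)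
  also have "\<dots> = emeasure lborel A'" using assms by simp
  finally show ?thesis .
qed

lemma tent_inner_eq:
  assumes f: "f holomorphic_on ball 0 1" and S: "S \<in> sets lebesgue" and S': "AE z in lborel. z \<in> S \<longleftrightarrow> z \<in> S'"
  shows "tent_inner p S f = ennreal (1 / pi) * (\<integral>\<^sup>+z. hweight p f z * indicator S' z \<partial>lborel)"
proof -
  have b1: "ball 0 1 \<inter> space lebesgue \<in> sets (lebesgue :: complex measure)" by simp
  let ?g = "\<lambda>z. ennreal (cmod (f z) powr p / (1 - cmod z)) * indicator S z"
  have eq: "?g z * indicator (ball 0 1) z = hweight p f z * indicator S z" for z
    unfolding hweight_def by (simp only: mult_ac)
  have "(\<lambda>z. hweight p f z * indicator S z) \<in> borel_measurable lebesgue"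
  proof -
    have [measurable]: "hweight p f \<in> borel_measurable lebesgue"
      using hweight_measurable[OF f, of p] by (intro measurable_completion) simp
    note [measurable] = S
    show ?thesis by measurable
  qed
  then have "?g \<in> borel_measurable (restrict_space lebesgue (ball 0 1))"
    unfolding borel_measurable_restrict_space_iff_ennreal[OF b1] eq .
  then have "tent_inner p S f = ennreal (1 / pi) * (\<integral>\<^sup>+z. ?g z \<partial>restrict_space lebesgue (ball 0 1))"
    unfolding tent_inner_def disc_measure_def by (rule nn_integral_scale_measure)
  also have "(\<integral>\<^sup>+z. ?g z \<partial>restrict_space lebesgue (ball 0 1)) = (\<integral>\<^sup>+z. hweight p f z * indicator S z \<partial>lebesgue)"
    unfolding nn_integral_restrict_space[OF b1] eq ..
  also have "\<dots> = (\<integral>\<^sup>+z. hweight p f z * indicator S z \<partial>lborel)" by (rule nn_integral_completion)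
  also have "\<dots> = (\<integral>\<^sup>+z. hweight p f z * indicator S' z \<partial>lborel)"
    by (rule nn_integral_cong_AE) (use S' in eventually_elim, simp add: indicator_def)
  finally show ?thesis .
qed

lemma tent_functional_eq:
  assumes f: "f holomorphic_on ball 0 1" and \<beta>: "0 < \<beta>" and G: "G \<in> sets lebesgue" 
    and G' [measurable]: "G' \<in> sets borel" and GG': "AE z in lborel. z \<in> G \<longleftrightarrow> z \<in> G'"
  shows "tent_functional p q \<beta> G f = enn_powr (ennreal ((1 / pi) powr (q / p)) *
    (tent_power (q / p) (Gamma_region \<beta>) (\<lambda>z. hweight p f z * indicator G' z))) (1 / q)"
proof -
  note [measurable] = hweight_measurable[OF f]
  have "tent_inner p (Gamma_region \<beta> \<xi> \<inter> G) f = ennreal (1 / pi) * (\<integral>\<^sup>+z. hweight p f z * indicator G' z * indicator (Gamma_region \<beta> \<xi>) z \<partial>lborel)" for \<xi>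
  proof -
    have "Gamma_region \<beta> \<xi> \<in> sets lebesgue" using Gamma_region_borel[OF \<beta>] by simp
    moreover have "AE z in lborel. z \<in> Gamma_region \<beta> \<xi> \<inter> G \<longleftrightarrow> z \<in> G' \<inter> Gamma_region \<beta> \<xi>"
      using GG' by eventually_elim auto
    ultimately have "tent_inner p (Gamma_region \<beta> \<xi> \<inter> G) f = ennreal (1 / pi) * (\<integral>\<^sup>+z. hweight p f z * indicator (G' \<inter> Gamma_region \<beta> \<xi>) z \<partial>lborel)"
      using G by (intro tent_inner_eq[OF f]) auto
    then show ?thesis by (simp add: indicator_inter_arith mult.assoc)
  qed
  moreover have "(\<integral>\<^sup>+\<xi>. ennreal ((1 / pi) powr (q / p)) * enn_powr (\<integral>\<^sup>+z. hweight p f z * indicator G' z * indicator (Gamma_region \<beta> \<xi>) z \<partial>lborel) (q / p) \<partial>circle_measure)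
    = ennreal ((1 / pi) powr (q / p)) * (tent_power (q / p) (Gamma_region \<beta>) (\<lambda>z. hweight p f z * indicator G' z))"
  proof (rule nn_integral_cmult)
    have "(\<lambda>z. hweight p f z * indicator G' z) \<in> borel_measurable borel" by measurable
    note [measurable] = Gamma_integral_measurable[OF this \<beta>]
    show "(\<lambda>\<xi>. enn_powr (\<integral>\<^sup>+z. hweight p f z * indicator G' z * indicator (Gamma_region \<beta> \<xi>) z \<partial>lborel) (q / p)) \<in> borel_measurable circle_measure"
      by measurable
  qed
  ultimately show ?thesis unfolding tent_functional_def by (simp add: enn_powr_cmult del: divide_const_simps)
qed

lemma tent_norm_eq:
  assumes f: "f holomorphic_on ball 0 1"
  shows "tent_norm p q f = enn_powr (ennreal ((1 / pi) powr (q / p)) *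
    (tent_power (q / p) (Gamma_region (1/2)) (hweight p f))) (1 / q)"
proof -
  have "tent_norm p q f = tent_functional p q (1/2) UNIV f" unfolding tent_norm_def tent_functional_def by simp
  then show ?thesis using tent_functional_eq[OF f, of "1/2" UNIV UNIV p q] by simp
qed

text \<open>The outer root 1/q and the factor (1/pi)^(q/p) from the normalised area occur on both
  sides and cancel, leaving tent powers compared with the constant K^q.\<close>

lemma tent_inequality_iff:
  assumes f: "f holomorphic_on ball 0 1" and \<beta>: "0 < \<beta>" and G: "G \<in> sets lebesgue" 
    and G': "G' \<in> sets borel" and GG': "AE z in lborel. z \<in> G \<longleftrightarrow> z \<in> G'" and q: "0 < q" and K: "0 < K"
  shows "tent_functional p q \<beta> G f \<ge> ennreal K * tent_norm p q f \<longleftrightarrow>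
    ennreal (K powr q) * (tent_power (q / p) (Gamma_region (1/2)) (hweight p f))
      \<le> (tent_power (q / p) (Gamma_region \<beta>) (\<lambda>z. hweight p f z * indicator G' z))"
    (is "_ \<longleftrightarrow> _ * ?I \<le> ?J")
proof -
  let ?k = "ennreal ((1 / pi) powr (q / p))"
  have k: "0 < ?k" "?k < top" by simp_all
  have "ennreal K * tent_norm p q f = enn_powr (ennreal (K powr q) * (?k * ?I)) (1 / q)"
    unfolding tent_norm_eq[OF f] using K q by (subst enn_powr_cmult) (simp_all add: powr_powr)
  also have "ennreal (K powr q) * (?k * ?I) = ?k * (ennreal (K powr q) * ?I)" by (simp only: mult_ac)
  finally have "tent_functional p q \<beta> G f \<ge> ennreal K * tent_norm p q f \<longleftrightarrow> ?k * (ennreal (K powr q) * ?I) \<le> ?k * ?J"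
    unfolding tent_functional_eq[OF f \<beta> G G' GG'] using q by (simp only: enn_powr_le_iff zero_less_divide_1_iff)
  also have "\<dots> \<longleftrightarrow> ennreal (K powr q) * ?I \<le> ?J" using k by (subst ennreal_mult_le_mult_iff) auto
  finally show ?thesis .
qed

lemma AT_iff:
  assumes "0 < q"
  shows "f \<in> AT p q \<longleftrightarrow> f holomorphic_on ball 0 1 \<and>
    (tent_power (q / p) (Gamma_region (1/2)) (hweight p f)) < \<infinity>"
proof -
  have "(0::real) < (1 / pi) powr (q / p)" by simp
  then have "tent_norm p q f < \<infinity> \<longleftrightarrow> (tent_power (q / p) (Gamma_region (1/2)) (hweight p f)) < \<infinity>"
    if "f holomorphic_on ball 0 1"
    unfolding tent_norm_eq[OF that] enn_powr_less_top_iff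
    by (simp add: ennreal_mult_less_top less_top[symmetric] ennreal_mult_eq_top_iff del: powr_gt_zero)
  then show ?thesis unfolding AT_def by auto
qed

section \<open>Relative density as a lower bound of order (1 - |a|)^2\<close>

lemma pseudo_disc_area:
  assumes a: "cmod a < 1" and \<eta>: "0 < \<eta>" "\<eta> < 1"
  shows "emeasure lborel (pseudo_disc a \<eta>) \<le> ennreal (16 * pi / (1 - \<eta>\<^sup>2)\<^sup>2 * (1 - cmod a)\<^sup>2)"
    and "ennreal (pi * \<eta>\<^sup>2 * (1 - cmod a)\<^sup>2) \<le> emeasure lborel (pseudo_disc a \<eta>)"
proof -
  have \<eta>2: "0 < 1 - \<eta>\<^sup>2" using \<eta> by (simp add: abs_square_less_1)
  have "emeasure lborel (pseudo_disc a \<eta>) \<le> emeasure lborel (ball a (4 * (1 - cmod a) / (1 - \<eta>\<^sup>2)))"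
    using pseudo_disc_subset_ball[OF a \<eta>] by (intro emeasure_mono) auto
  also have "\<dots> = ennreal (16 * pi / (1 - \<eta>\<^sup>2)\<^sup>2 * (1 - cmod a)\<^sup>2)"
  proof -
    have eq: "pi * (4 * d / (1 - \<eta>\<^sup>2))\<^sup>2 = 16 * pi / (1 - \<eta>\<^sup>2)\<^sup>2 * d\<^sup>2" for d
      by (simp add: power_divide power_mult_distrib)
    show ?thesis by (subst emeasure_ball_complex) (use a \<eta>2 in simp, simp only: eq)
  qed
  finally show "emeasure lborel (pseudo_disc a \<eta>) \<le> ennreal (16 * pi / (1 - \<eta>\<^sup>2)\<^sup>2 * (1 - cmod a)\<^sup>2)" .
  have "emeasure lborel (eucl_disc \<eta> a) \<le> emeasure lborel (pseudo_disc a \<eta>)"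
    using eucl_disc_subset_pseudo_disc[OF a \<eta>(1)] pseudo_disc_borel[OF a] by (intro emeasure_mono) auto
  moreover have "emeasure lborel (eucl_disc \<eta> a) = ennreal (pi * \<eta>\<^sup>2 * (1 - cmod a)\<^sup>2)"
    unfolding eucl_disc_eq_ball[OF a \<eta>(2)] using a \<eta>
    by (subst emeasure_ball_complex) (auto simp: power_mult_distrib mult_ac)
  ultimately show "ennreal (pi * \<eta>\<^sup>2 * (1 - cmod a)\<^sup>2) \<le> emeasure lborel (pseudo_disc a \<eta>)" by simp
qed

text \<open>The area of \<open>P a\<close> lies between multiples of (1 - |a|)^2, so relative
  density amounts to an absolute lower bound of that order, the form in which the sampling estimates
  use it. The constant changes by the factor l or 1/u.\<close>

lemma relative_density_iff:
  assumes G: "G \<in> sets lebesgue" and G': "G' \<in> sets borel" and GG': "AE z in lborel. z \<in> G \<longleftrightarrow> z \<in> G'"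
    and P: "\<And>a. cmod a < 1 \<Longrightarrow> P a \<in> sets borel" "\<And>a. cmod a < 1 \<Longrightarrow> P a \<subseteq> ball 0 1"
    and l: "0 < l" "\<And>a. cmod a < 1 \<Longrightarrow> ennreal (l * (1 - cmod a)\<^sup>2) \<le> emeasure lborel (P a)"
    and u: "0 < u" "\<And>a. cmod a < 1 \<Longrightarrow> emeasure lborel (P a) \<le> ennreal (u * (1 - cmod a)\<^sup>2)"
  shows "(\<exists>\<delta>>0. \<forall>a\<in>ball 0 1. emeasure disc_measure (G \<inter> P a) \<ge> ennreal \<delta> * emeasure disc_measure (P a))
    \<longleftrightarrow> (\<exists>\<delta>>0. \<forall>a\<in>ball 0 1. ennreal (\<delta> * (1 - cmod a)\<^sup>2) \<le> emeasure lborel (G' \<inter> P a))"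
proof -
  have eq: "emeasure disc_measure (G \<inter> P a) \<ge> ennreal \<delta> * emeasure disc_measure (P a)
    \<longleftrightarrow> ennreal \<delta> * emeasure lborel (P a) \<le> emeasure lborel (G' \<inter> P a)" if a: "cmod a < 1" for a \<delta>
  proof -
    have "emeasure disc_measure (P a) = ennreal (1 / pi) * emeasure lborel (P a)"
      using P[OF a] by (intro emeasure_disc_measure) auto
    moreover have "emeasure disc_measure (G \<inter> P a) = ennreal (1 / pi) * emeasure lborel (G' \<inter> P a)"
    proof (rule emeasure_disc_measure)
      show "AE z in lborel. z \<in> G \<inter> P a \<longleftrightarrow> z \<in> G' \<inter> P a" using GG' by eventually_elim auto
    qed (use P[OF a] G G' in auto)
    ultimately have "emeasure disc_measure (G \<inter> P a) \<ge> ennreal \<delta> * emeasure disc_measure (P a)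
      \<longleftrightarrow> ennreal (1 / pi) * (ennreal \<delta> * emeasure lborel (P a)) \<le> ennreal (1 / pi) * emeasure lborel (G' \<inter> P a)"
      by (simp only: mult.left_commute)
    also have "\<dots> \<longleftrightarrow> ennreal \<delta> * emeasure lborel (P a) \<le> emeasure lborel (G' \<inter> P a)"
      by (subst ennreal_mult_le_mult_iff) auto
    finally show ?thesis .
  qed
  show ?thesis
  proof
    assume "\<exists>\<delta>>0. \<forall>a\<in>ball 0 1. emeasure disc_measure (G \<inter> P a) \<ge> ennreal \<delta> * emeasure disc_measure (P a)"
    then obtain \<delta> where \<delta>: "0 < \<delta>" "\<And>a. cmod a < 1 \<Longrightarrow> ennreal \<delta> * emeasure lborel (P a) \<le> emeasure lborel (G' \<inter> P a)"
      using eq by auto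
    have "ennreal (\<delta> * l * (1 - cmod a)\<^sup>2) \<le> emeasure lborel (G' \<inter> P a)" if a: "cmod a < 1" for a
    proof -
      have "ennreal (\<delta> * l * (1 - cmod a)\<^sup>2) = ennreal \<delta> * ennreal (l * (1 - cmod a)\<^sup>2)"
        using \<delta> l by (simp add: ennreal_mult[symmetric] mult.assoc)
      also have "\<dots> \<le> ennreal \<delta> * emeasure lborel (P a)" by (intro mult_left_mono l(2) a) auto
      finally show ?thesis using \<delta>(2)[OF a] by simp
    qed
    then show "\<exists>\<delta>>0. \<forall>a\<in>ball 0 1. ennreal (\<delta> * (1 - cmod a)\<^sup>2) \<le> emeasure lborel (G' \<inter> P a)"
      using \<delta> l by (intro exI[of _ "\<delta> * l"]) auto
  next
    assume "\<exists>\<delta>>0. \<forall>a\<in>ball 0 1. ennreal (\<delta> * (1 - cmod a)\<^sup>2) \<le> emeasure lborel (G' \<inter> P a)"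
    then obtain \<delta> where \<delta>: "0 < \<delta>" "\<And>a. cmod a < 1 \<Longrightarrow> ennreal (\<delta> * (1 - cmod a)\<^sup>2) \<le> emeasure lborel (G' \<inter> P a)" by auto
    have "ennreal (\<delta> / u) * emeasure lborel (P a) \<le> emeasure lborel (G' \<inter> P a)" if a: "cmod a < 1" for a
    proof -
      have "ennreal (\<delta> / u) * emeasure lborel (P a) \<le> ennreal (\<delta> / u) * ennreal (u * (1 - cmod a)\<^sup>2)"
        by (intro mult_left_mono u(2) a) auto
      also have "\<dots> = ennreal (\<delta> * (1 - cmod a)\<^sup>2)" using \<delta> u by (simp add: ennreal_mult[symmetric])
      finally show ?thesis using \<delta>(2)[OF a] by simp
    qed
    then show "\<exists>\<delta>>0. \<forall>a\<in>ball 0 1. emeasure disc_measure (G \<inter> P a) \<ge> ennreal \<delta> * emeasure disc_measure (P a)"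
      using \<delta> u eq by (intro exI[of _ "\<delta> / u"]) auto
  qed
qed

text \<open>A Euclidean disc lies in the pseudohyperbolic disc with the same centre and radius,
  which settles one direction. In the other, density at a is read off from the pseudohyperbolic disc
  about a shifted centre b; since 1 - |b| = s (1 - |a|), the constant drops by s^2.\<close>

lemma pseudo_density_iff_eucl_density:
  assumes G: "G \<in> sets borel"
  shows "(\<exists>\<eta> \<delta>. 0 < \<eta> \<and> \<eta> < 1 \<and> 0 < \<delta> \<and> (\<forall>a\<in>ball 0 1. ennreal (\<delta> * (1 - cmod a)\<^sup>2) \<le> emeasure lborel (G \<inter> pseudo_disc a \<eta>)))
    \<longleftrightarrow> (\<exists>\<eta> \<delta>. 0 < \<eta> \<and> \<eta> < 1 \<and> 0 < \<delta> \<and> (\<forall>a\<in>ball 0 1. ennreal (\<delta> * (1 - cmod a)\<^sup>2) \<le> emeasure lborel (G \<inter> eucl_disc \<eta> a)))"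
    (is "?P \<longleftrightarrow> ?E")
proof
  assume ?P
  then obtain \<eta> \<delta> where \<eta>: "0 < \<eta>" "\<eta> < 1" and \<delta>: "0 < \<delta>"
    and dens: "\<And>a. cmod a < 1 \<Longrightarrow> ennreal (\<delta> * (1 - cmod a)\<^sup>2) \<le> emeasure lborel (G \<inter> pseudo_disc a \<eta>)" by auto
  define s where "s = (1 - \<eta>\<^sup>2) / 16"
  have "0 < 1 - \<eta>\<^sup>2" using \<eta> by (simp add: abs_square_less_1)
  then have "0 < s" unfolding s_def by simp
  moreover have "s \<le> 1 / 16" unfolding s_def by (rule divide_right_mono) simp_all
  ultimately have s: "0 < s" "s < 1" by simp_all
  have s2: "0 < s\<^sup>2" "s\<^sup>2 < 1" using s by (auto simp: abs_square_less_1)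
  have "ennreal (\<delta> * s\<^sup>2 * (1 - cmod a)\<^sup>2) \<le> emeasure lborel (G \<inter> eucl_disc (sqrt (1 - s\<^sup>2)) a)" if a: "cmod a < 1" for a
  proof -
    obtain b where b: "cmod b < 1" "1 - cmod b = s * (1 - cmod a)" "pseudo_disc b \<eta> \<subseteq> eucl_disc (sqrt (1 - s\<^sup>2)) a"
      by (rule pseudo_disc_subset_eucl_disc[OF a \<eta> s_def])
    have "sqrt (1 - s\<^sup>2) < 1" using s2 by simp
    then have eb: "eucl_disc (sqrt (1 - s\<^sup>2)) a \<in> sets borel" using eucl_disc_eq_ball[OF a] by simp
    have "ennreal (\<delta> * s\<^sup>2 * (1 - cmod a)\<^sup>2) = ennreal (\<delta> * (1 - cmod b)\<^sup>2)" unfolding b(2) by (simp add: power_mult_distrib mult.assoc)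
    also have "\<dots> \<le> emeasure lborel (G \<inter> pseudo_disc b \<eta>)" by (rule dens[OF b(1)])
    also have "\<dots> \<le> emeasure lborel (G \<inter> eucl_disc (sqrt (1 - s\<^sup>2)) a)" using b(3) G eb by (intro emeasure_mono) auto
    finally show ?thesis .
  qed
  then show ?E using s2 \<delta> by (intro exI[of _ "sqrt (1 - s\<^sup>2)"] exI[of _ "\<delta> * s\<^sup>2"]) auto
next
  assume ?E
  then obtain \<eta> \<delta> where \<eta>: "0 < \<eta>" "\<eta> < 1" and \<delta>: "0 < \<delta>"
    and dens: "\<And>a. cmod a < 1 \<Longrightarrow> ennreal (\<delta> * (1 - cmod a)\<^sup>2) \<le> emeasure lborel (G \<inter> eucl_disc \<eta> a)" by auto
  have "ennreal (\<delta> * (1 - cmod a)\<^sup>2) \<le> emeasure lborel (G \<inter> pseudo_disc a \<eta>)" if a: "cmod a < 1" for a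
    using eucl_disc_subset_pseudo_disc[OF a \<eta>(1)] pseudo_disc_borel[OF a] G
    by (intro order_trans[OF dens[OF a] emeasure_mono]) auto
  then show ?P using \<eta> \<delta> by (intro exI[of _ \<eta>] exI[of _ \<delta>]) auto
qed

text \<open>The numerical instances are (11/10)^2 (1 - 1/4) = 0.9075 <= 1 and (1 + 1/2)/(1 - 1/2) =
  3.\<close>

lemma half_region_bounds:
  assumes "cmod \<xi> = 1"
  shows "stolz (11/10) \<xi> \<subseteq> Gamma_region (1/2) \<xi>" "Gamma_region (1/2) \<xi> \<subseteq> stolz 3 \<xi>"
  using stolz_subset_Gamma_region[of "1/2" \<xi> "11/10"] Gamma_region_subset_stolz[of "1/2" \<xi>] assms
  by (simp_all add: power2_eq_square)

theorem theorem3: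
  fixes p q :: real and G :: "complex set"
  assumes "1 \<le> p" "1 \<le> q"
    and "G \<in> sets lebesgue" "G \<subseteq> ball 0 1"
  shows "((\<exists>\<beta> K. 0 < \<beta> \<and> \<beta> < 1 \<and> K > 0 \<and>
             (\<forall>f \<in> AT p q. tent_functional p q \<beta> G f \<ge> ennreal K * tent_norm p q f))
          \<longleftrightarrow> (\<exists>\<eta> \<delta>. 0 < \<eta> \<and> \<eta> < 1 \<and> \<delta> > 0 \<and>
             (\<forall>\<alpha> \<in> ball 0 1. emeasure disc_measure (G \<inter> pseudo_disc \<alpha> \<eta>)
                 \<ge> ennreal \<delta> * emeasure disc_measure (pseudo_disc \<alpha> \<eta>))))
       \<and> ((\<exists>\<eta> \<delta>. 0 < \<eta> \<and> \<eta> < 1 \<and> \<delta> > 0 \<and>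
             (\<forall>\<alpha> \<in> ball 0 1. emeasure disc_measure (G \<inter> pseudo_disc \<alpha> \<eta>)
                 \<ge> ennreal \<delta> * emeasure disc_measure (pseudo_disc \<alpha> \<eta>)))
          \<longleftrightarrow> (\<exists>\<eta> \<delta>. 0 < \<eta> \<and> \<eta> < 1 \<and> \<delta> > 0 \<and>
             (\<forall>\<alpha> \<in> ball 0 1. emeasure disc_measure (G \<inter> eucl_disc \<eta> \<alpha>)
                 \<ge> ennreal \<delta> * emeasure disc_measure (eucl_disc \<eta> \<alpha>))))"
    (is "(?a \<longleftrightarrow> ?b) \<and> (?b \<longleftrightarrow> ?c)")
proof -
  define s where "s = q / p"
  have pq: "0 < p" "0 < q" "0 < s" unfolding s_def using assms by auto
  obtain G' :: "complex set" where G': "G' \<in> sets borel" "G' \<subseteq> G" "AE z in lborel. z \<in> G \<longleftrightarrow> z \<in> G'"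
    by (rule lebesgue_set_borel_AE_eq[OF assms(3)])
  define b' where "b' \<longleftrightarrow> (\<exists>\<eta> \<delta>. 0 < \<eta> \<and> \<eta> < 1 \<and> 0 < \<delta> \<and>
    (\<forall>a\<in>ball 0 1. ennreal (\<delta> * (1 - cmod a)\<^sup>2) \<le> emeasure lborel (G' \<inter> pseudo_disc a \<eta>)))"
  define c' where "c' \<longleftrightarrow> (\<exists>\<eta> \<delta>. 0 < \<eta> \<and> \<eta> < 1 \<and> 0 < \<delta> \<and>
    (\<forall>a\<in>ball 0 1. ennreal (\<delta> * (1 - cmod a)\<^sup>2) \<le> emeasure lborel (G' \<inter> eucl_disc \<eta> a)))"
  have bc': "b' \<longleftrightarrow> c'" unfolding b'_def c'_def by (rule pseudo_density_iff_eucl_density[OF G'(1)])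
  have b: "?b \<longleftrightarrow> b'"
  proof -
    have "(\<exists>\<delta>>0. \<forall>a\<in>ball 0 1. emeasure disc_measure (G \<inter> pseudo_disc a \<eta>) \<ge> ennreal \<delta> * emeasure disc_measure (pseudo_disc a \<eta>))
      \<longleftrightarrow> (\<exists>\<delta>>0. \<forall>a\<in>ball 0 1. ennreal (\<delta> * (1 - cmod a)\<^sup>2) \<le> emeasure lborel (G' \<inter> pseudo_disc a \<eta>))"
      if \<eta>: "0 < \<eta>" "\<eta> < 1" for \<eta>
    proof (rule relative_density_iff[OF assms(3) G'(1,3)])
      show "0 < pi * \<eta>\<^sup>2" "0 < 16 * pi / (1 - \<eta>\<^sup>2)\<^sup>2" using \<eta> abs_square_less_1[of \<eta>] by simp_all
    qed (use pseudo_disc_area[OF _ \<eta>] pseudo_disc_borel mem_pseudo_disc_iff in auto)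
    then show ?thesis unfolding b'_def by blast
  qed
  have c: "?c \<longleftrightarrow> c'"
  proof -
    have "(\<exists>\<delta>>0. \<forall>a\<in>ball 0 1. emeasure disc_measure (G \<inter> eucl_disc \<eta> a) \<ge> ennreal \<delta> * emeasure disc_measure (eucl_disc \<eta> a))
      \<longleftrightarrow> (\<exists>\<delta>>0. \<forall>a\<in>ball 0 1. ennreal (\<delta> * (1 - cmod a)\<^sup>2) \<le> emeasure lborel (G' \<inter> eucl_disc \<eta> a))"
      if \<eta>: "0 < \<eta>" "\<eta> < 1" for \<eta>
    proof (rule relative_density_iff[OF assms(3) G'(1,3)])
      have "emeasure lborel (eucl_disc \<eta> a) = ennreal (pi * \<eta>\<^sup>2 * (1 - cmod a)\<^sup>2)" if a: "cmod a < 1" for a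
        unfolding eucl_disc_eq_ball[OF a \<eta>(2)] using a \<eta>
        by (subst emeasure_ball_complex) (auto simp: power_mult_distrib mult_ac)
      then show "ennreal (pi * \<eta>\<^sup>2 * (1 - cmod a)\<^sup>2) \<le> emeasure lborel (eucl_disc \<eta> a)"
        "emeasure lborel (eucl_disc \<eta> a) \<le> ennreal (pi * \<eta>\<^sup>2 * (1 - cmod a)\<^sup>2)" if "cmod a < 1" for a
        using that by simp_all
      show "0 < pi * \<eta>\<^sup>2" "0 < pi * \<eta>\<^sup>2" using \<eta> by simp_all
      show "eucl_disc \<eta> a \<in> sets borel" if "cmod a < 1" for a using eucl_disc_eq_ball[OF that \<eta>(2)] by simp
      show "eucl_disc \<eta> a \<subseteq> ball 0 1" if "cmod a < 1" for a unfolding eucl_disc_def by blast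
    qed
    then show ?thesis unfolding c'_def by blast
  qed
  \<comment> \<open>Enlarging the region of aperture \<beta> to the cone of aperture (1 +
    \<beta>)/(1 - \<beta>) only increases the integral over G', so the inequality passes to the form
    required by \<open>density_necessary\<close>.\<close>
  have ab: "b'" if a: ?a
  proof -
    obtain \<beta> K where \<beta>: "0 < \<beta>" "\<beta> < 1" and K: "0 < K"
      and tent: "\<And>f. f \<in> AT p q \<Longrightarrow> tent_functional p q \<beta> G f \<ge> ennreal K * tent_norm p q f"
      using a by blast
    have cpos: "0 < (1 + \<beta>) / (1 - \<beta>)" and Kpos: "0 < K powr q" using \<beta> K by simp_all
    obtain \<eta> \<delta> where \<eta>: "0 < \<eta>" "\<eta> < 1" "0 < \<delta>" and dens:
      "\<And>G a. G \<in> sets borel \<Longrightarrow> cmod a < 1 \<Longrightarrow> 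
        (\<And>f. f holomorphic_on ball 0 1 \<Longrightarrow>
          (tent_power s (Gamma_region (1/2)) (hweight p f)) < \<infinity> \<Longrightarrow>
          ennreal (K powr q) * (tent_power s (Gamma_region (1/2)) (hweight p f))
            \<le> (cone_power s ((1 + \<beta>) / (1 - \<beta>)) (\<lambda>z. hweight p f z * indicator G z))) \<Longrightarrow>
        pseudo_disc a \<eta> \<in> sets borel \<Longrightarrow>
        ennreal (\<delta> * (1 - cmod a)\<^sup>2) \<le> emeasure lborel (G \<inter> pseudo_disc a \<eta>)"
    proof (rule density_necessary[OF pq(1,3) cpos Kpos half_region_bounds], goal_cases)
      case (3 \<eta> \<delta>)
      from 3(2-) show ?case by (rule 3(1))
    qed
    have "ennreal (\<delta> * (1 - cmod a)\<^sup>2) \<le> emeasure lborel (G' \<inter> pseudo_disc a \<eta>)" if a: "cmod a < 1" for a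
    proof (rule dens[OF G'(1) a _ pseudo_disc_borel[OF a]])
      fix f assume f: "f holomorphic_on ball 0 1"
        and fin: "(tent_power s (Gamma_region (1/2)) (hweight p f)) < \<infinity>"
      then have "f \<in> AT p q" unfolding AT_iff[OF pq(2)] s_def by simp
      from tent[OF this] have "ennreal (K powr q) * (tent_power s (Gamma_region (1/2)) (hweight p f))
        \<le> (tent_power s (Gamma_region \<beta>) (\<lambda>z. hweight p f z * indicator G' z))"
        unfolding tent_inequality_iff[OF f \<beta>(1) assms(3) G'(1,3) pq(2) K] s_def .
      also have "\<dots> \<le> (cone_power s ((1 + \<beta>) / (1 - \<beta>)) (\<lambda>z. hweight p f z * indicator G' z))"
        unfolding cone_int_def using Gamma_region_subset_stolz[OF \<beta>] pq
        by (intro nn_integral_circle_mono enn_powr_mono nn_integral_mono) (auto split: split_indicator)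
      finally show "ennreal (K powr q) * (tent_power s (Gamma_region (1/2)) (hweight p f))
        \<le> (cone_power s ((1 + \<beta>) / (1 - \<beta>)) (\<lambda>z. hweight p f z * indicator G' z))" .
    qed
    then show ?thesis unfolding b'_def using \<eta> by (intro exI[of _ \<eta>] exI[of _ \<delta>]) auto
  qed
  have ca: "?a" if c': c'
  proof -
    obtain \<eta> \<delta> where \<eta>: "0 < \<eta>" "\<eta> < 1" and \<delta>: "0 < \<delta>"
      and dens: "\<And>a. cmod a < 1 \<Longrightarrow> ennreal (\<delta> * (1 - cmod a)\<^sup>2) \<le> emeasure lborel (G' \<inter> eucl_disc \<eta> a)"
      using c' unfolding c'_def by auto
    obtain C c where C: "0 < C" and c: "1 < c" and samp:
      "\<And>f G. f holomorphic_on ball 0 1 \<Longrightarrow> G \<in> sets borel \<Longrightarrow>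
        (\<And>\<alpha>. \<alpha> \<in> ball 0 1 \<Longrightarrow> ennreal (\<delta> * (1 - cmod \<alpha>)\<^sup>2) \<le> emeasure lborel (G \<inter> ball \<alpha> (\<eta> * (1 - cmod \<alpha>)))) \<Longrightarrow>
        (tent_power s (Gamma_region (1/2)) (hweight p f)) < \<infinity> \<Longrightarrow>
        (tent_power s (Gamma_region (1/2)) (hweight p f))
          \<le> ennreal C * (cone_power s c (\<lambda>z. hweight p f z * indicator G z))"
    proof (rule sampling_inequality[OF assms(1) pq(3) \<eta> \<delta> half_region_bounds], goal_cases)
      case (3 C c)
      from 3(2-) show ?case by (rule 3(1))
    qed
    \<comment> \<open>This \<beta> solves c^2 (1 - \<beta>^2) = 1, the limiting case in which
      \<open>stolz_subset_Gamma_region\<close> still puts the cone of aperture c inside the region;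
      c > 1 makes \<beta> positive.\<close>
    define \<beta> where "\<beta> = sqrt (1 - 1 / c\<^sup>2)"
    have c2: "1 < c\<^sup>2" using c by (simp add: one_less_power)
    then have "0 < c\<^sup>2" by linarith
    then have "1 / c\<^sup>2 < 1" "0 < 1 / c\<^sup>2" using c2 by (simp_all only: divide_less_eq_1_pos zero_less_divide_1_iff)
    then have \<beta>: "0 < \<beta>" "\<beta> < 1" "\<beta>\<^sup>2 = 1 - 1 / c\<^sup>2" unfolding \<beta>_def by auto
    have c\<beta>: "c\<^sup>2 * (1 - \<beta>\<^sup>2) \<le> 1" unfolding \<beta>(3) using c2 by simp
    define K where "K = (1 / C) powr (1 / q)"
    have K: "0 < K" "K powr q = 1 / C" unfolding K_def using C pq by (simp_all add: powr_powr)
    have "tent_functional p q \<beta> G f \<ge> ennreal K * tent_norm p q f" if "f \<in> AT p q" for f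
    proof -
      have f: "f holomorphic_on ball 0 1" and fin: "(tent_power s (Gamma_region (1/2)) (hweight p f)) < \<infinity>"
        using that unfolding AT_iff[OF pq(2)] s_def by simp_all
      let ?I = "\<integral>\<^sup>+\<xi>. enn_powr (\<integral>\<^sup>+z. hweight p f z * indicator (Gamma_region (1/2) \<xi>) z \<partial>lborel) s \<partial>circle_measure"
      let ?J = "\<integral>\<^sup>+\<xi>. enn_powr (\<integral>\<^sup>+z. hweight p f z * indicator G' z * indicator (Gamma_region \<beta> \<xi>) z \<partial>lborel) s \<partial>circle_measure"
      have "?I \<le> ennreal C * (cone_power s c (\<lambda>z. hweight p f z * indicator G' z))"
        using dens eucl_disc_eq_ball[OF _ \<eta>(2)] by (intro samp[OF f G'(1) _ fin]) auto
      also have "\<dots> \<le> ennreal C * ?J"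
        unfolding cone_int_def using stolz_subset_Gamma_region[OF \<beta>(1,2) _ _ c\<beta>] c pq
        by (intro mult_left_mono nn_integral_circle_mono enn_powr_mono nn_integral_mono) (auto split: split_indicator)
      finally have "ennreal (1 / C) * ?I \<le> ennreal (1 / C) * (ennreal C * ?J)" by (intro mult_left_mono) auto
      also have "\<dots> = ennreal (1 / C) * ennreal C * ?J" by (simp only: mult.assoc)
      also have "ennreal (1 / C) * ennreal C = 1" using C by (simp flip: ennreal_mult)
      finally show ?thesis unfolding tent_inequality_iff[OF f \<beta>(1) assms(3) G'(1,3) pq(2) K(1)] K(2) s_def by simp
    qed
    then show ?thesis using \<beta> K by blast
  qed
  show ?thesis using ab ca b c bc' by blast
qed

end
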